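(* Let $q\in(0,1)$, let $n\ge1$, let $\lambda_1,\ldots,\lambda_n$ be complex numbers of modulus one, and let $\beta$ be the $*$-automorphism of $C(\partial B^{2n}_q)$ with $\beta(w_j)=\lambda_jw_j$ for $j=1,\ldots,n$. Then there exists an isomorphism $$\phi:C(\partial B^{2n+1}_q)\to C(S^{2n}_{q,\beta})$$ such that $\phi(t_i)=e_{i-1}$ for $i=1,\ldots,n+1$.
   Context: All universal $C^*$-algebras below are unital. Even balls: $C(B^{2n}_q)$ is the universal $C^*$-algebra generated by $z_1,\ldots,z_n$ subject to $z_iz_j=q^{1/2}z_jz_i$ and $z_iz_j^*=q^{-1/2}z_j^*z_i$ for $i<j$, and $z_i^*z_i-qz_iz_i^*=(1-q)(1-\sum_{j=i+1}^nz_jz_j^* )$ for $i=1,\ldots,n$. In it $\sum_{j=1}^nz_jz_j^*\le1$. Let $J_{2n}$ be the closed two-sided ideal generated by $1-\sum_{j=1}^nz_jz_j^*$, $C(\partial B^{2n}_q)=C(B^{2n}_q)/J_{2n}$, $\pi:C(B^{2n}_q)\to C(\partial B^{2n}_q)$ the quotient map, and $w_i=\pi(z_i)$. Odd balls: $C(B^{2n+1}_q)$ is the universal $C^*$-algebra generated by $x_1,\ldots,x_{n+1}$ subject to $x_1=x_1^*$; $x_ix_j=q^{1/2}x_jx_i$ for $i<j$; $x_ix_j^*=q^{-1/2}x_j^*x_i$ for $2\le i<j$; $x_i^*x_i-qx_ix_i^*=(1-q)(1-\sum_{j=i+1}^{n+1}x_jx_j^* )$ for $i=2,\ldots,n+1$;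 and $x_1^2+\sum_{j=2}^{n+1}x_jx_j^*\le1$. Let $J_{2n+1}$ be the closed two-sided ideal generated by $1-x_1^2-\sum_{j=2}^{n+1}x_jx_j^*$, $C(\partial B^{2n+1}_q)=C(B^{2n+1}_q)/J_{2n+1}$, and let $t_i$ be the image of $x_i$ in $C(\partial B^{2n+1}_q)$. Glued sphere: $C(S^{2n}_{q,\beta})=\{(x,y)\in C(B^{2n}_q)\oplus C(B^{2n}_q):\pi(x)=\beta(\pi(y))\}$. When $\beta$ is the $*$-automorphism of $C(\partial B^{2n}_q)$ with $\beta(w_j)=\lambda_jw_j$ for $j=1,\ldots,n$, where $\lambda_1,\ldots,\lambda_n$ are complex numbers of modulus one, the elements $e_0,\ldots,e_n$ of $C(S^{2n}_{q,\beta})$ are $$e_0=\Bigl(\bigl(1-\sum_{j=1}^nz_jz_j^*\bigr)^{1/2},\,-\bigl(1-\sum_{j=1}^nz_jz_j^*\bigr)^{1/2}\Bigr),\qquad e_i=(\lambda_iz_i,z_i),\quad i=1,\ldots,n.$$ *)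

theory Defs
  imports Complex_Main "HOL-Algebra.Module" "HOL-Algebra.QuotRing" "HOL-Library.Poly_Mapping"
begin

section \<open>The free unital complex *-algebra\<close>

datatype 'g letter = Gen 'g | Adj 'g

datatype 'g star_word = Word (letters: "'g letter list")

instantiation star_word :: (type) monoid_add
begin

definition zero_star_word :: "'a star_word"
  where "0 = Word []"

definition plus_star_word :: "'a star_word \<Rightarrow> 'a star_word \<Rightarrow> 'a star_word"
  where "v + w = Word (letters v @ letters w)"

instance
  by standard (simp_all add: zero_star_word_def plus_star_word_def)

end

text \<open>
  Words are written additively only because the convolution product of
  \<open>HOL-Library.Poly_Mapping\<close> expects an additive monoid of exponents. With it,
  finitely supported functions from words to the complex numbers
  form the algebra of noncommutative *-polynomials.
\<close>

type_synonym 'g star_poly = "'g star_word \<Rightarrow>\<^sub>0 complex"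

definition gen :: "'g \<Rightarrow> 'g star_poly"
  where "gen g = Poly_Mapping.single (Word [Gen g]) 1"

definition cst :: "complex \<Rightarrow> 'g star_poly"
  where "cst c = Poly_Mapping.single 0 c"

fun adj_letter :: "'g letter \<Rightarrow> 'g letter"
  where
    "adj_letter (Gen g) = Adj g"
  | "adj_letter (Adj g) = Gen g"

definition adj_word :: "'g star_word \<Rightarrow> 'g star_word"
  where "adj_word w = Word (rev (map adj_letter (letters w)))"

definition adj :: "'g star_poly \<Rightarrow> 'g star_poly"
  where "adj p = (\<Sum>w\<in>Poly_Mapping.keys p.
    Poly_Mapping.single (adj_word w) (cnj (Poly_Mapping.lookup p w)))"

definition star_polys :: "'g set \<Rightarrow> 'g star_poly set"
  where "star_polys G = {p. \<forall>w\<in>Poly_Mapping.keys p. set_star_word w \<subseteq> G}"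


section \<open>Normed *-algebras, quotients and isomorphisms\<close>

record 'a cstar = "(complex, 'a) module" +
  star :: "'a \<Rightarrow> 'a"
  cnorm :: "'a \<Rightarrow> real"

definition cstar_quot :: "'a cstar \<Rightarrow> 'a set \<Rightarrow> 'a set cstar"
  where "cstar_quot A I =
    \<lparr>carrier = carrier (A Quot I), mult = mult (A Quot I), one = one (A Quot I),
     zero = zero (A Quot I), add = add (A Quot I),
     smult = (\<lambda>c X. \<Union>x\<in>X. I +>\<^bsub>A\<^esub> (c \<odot>\<^bsub>A\<^esub> x)),
     star = (\<lambda>X. \<Union>x\<in>X. I +>\<^bsub>A\<^esub> star A x),
     cnorm = (\<lambda>X. INF x\<in>X. cnorm A x)\<rparr>"

definition closed_ideal :: "'a cstar \<Rightarrow> 'a set \<Rightarrow> bool"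
  where "closed_ideal A I \<longleftrightarrow> ideal I A \<and>
    (\<forall>s. \<forall>a\<in>carrier A. range s \<subseteq> I \<longrightarrow>
      (\<lambda>k::nat. cnorm A (s k \<ominus>\<^bsub>A\<^esub> a)) \<longlonglongrightarrow> 0 \<longrightarrow> a \<in> I)"

definition closed_ideal_gen :: "'a cstar \<Rightarrow> 'a \<Rightarrow> 'a set"
  where "closed_ideal_gen A a = \<Inter>{I. closed_ideal A I \<and> a \<in> I}"

text \<open>
  Isomorphisms are bijective unital *-homomorphisms; between C*-algebras they are
  automatically isometric.
\<close>

definition star_iso :: "'a cstar \<Rightarrow> 'b cstar \<Rightarrow> ('a \<Rightarrow> 'b) set"
  where "star_iso A B = {f \<in> ring_iso A B. \<forall>x\<in>carrier A.
    (\<forall>c. f (c \<odot>\<^bsub>A\<^esub> x) = c \<odot>\<^bsub>B\<^esub> f x) \<and> f (star A x) = star B (f x)}"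

definition positive :: "'a cstar \<Rightarrow> 'a \<Rightarrow> bool"
  where "positive A a \<longleftrightarrow> (\<exists>b\<in>carrier A. a = star A b \<otimes>\<^bsub>A\<^esub> b)"

definition cstar_sqrt :: "'a cstar \<Rightarrow> 'a \<Rightarrow> 'a"
  where "cstar_sqrt A a = (THE b. positive A b \<and> b \<otimes>\<^bsub>A\<^esub> b = a)"


section \<open>Universal unital C*-algebras\<close>

text \<open>
  The universal unital C*-algebra on generators \<open>G\<close>, subject to the equations
  \<open>r = 0\<close> for \<open>r \<in> R\<close> and the inequalities \<open>h \<ge> 0\<close> for \<open>h \<in> H\<close>, is the
  Hausdorff completion of the free unital *-algebra on \<open>G\<close> in the largest
  C*-seminorm under which the relations hold. C*-seminorms \<open>p\<close> on the free
  *-algebra correspond to the families of elements indexed by \<open>G\<close> that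
  generate a unital C*-algebra, namely the completion of the free *-algebra in \<open>p\<close>.
\<close>

definition cstar_seminorm :: "'g set \<Rightarrow> ('g star_poly \<Rightarrow> real) \<Rightarrow> bool"
  where "cstar_seminorm G p \<longleftrightarrow> (\<forall>x\<in>star_polys G.
    0 \<le> p x \<and> (\<forall>c. p (cst c * x) = cmod c * p x) \<and> p (adj x * x) = (p x)\<^sup>2 \<and>
    (\<forall>y\<in>star_polys G. p (x + y) \<le> p x + p y \<and> p (x * y) \<le> p x * p y))"

text \<open>
  The last condition below says that \<open>h\<close> is positive in the completion: the elements
  \<open>b\<^sup>* b\<close> of a C*-algebra form a closed set, and every \<open>b\<close> in the
  completion is a limit of *-polynomials.
\<close>

definition admissible ::
    "'g set \<Rightarrow> 'g star_poly set \<Rightarrow> 'g star_poly set \<Rightarrow> ('g star_poly \<Rightarrow> real) \<Rightarrow> bool"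
  where "admissible G R H p \<longleftrightarrow> cstar_seminorm G p \<and> (\<forall>r\<in>R. p r = 0) \<and>
    (\<forall>h\<in>H. \<forall>\<epsilon>>0. \<exists>b\<in>star_polys G. p (h - adj b * b) < \<epsilon>)"

text \<open>
  This is a supremum of real numbers, so it is meaningful only if the relations bound the
  generators, as those of the quantum balls do.
\<close>

definition universal_seminorm ::
    "'g set \<Rightarrow> 'g star_poly set \<Rightarrow> 'g star_poly set \<Rightarrow> 'g star_poly \<Rightarrow> real"
  where "universal_seminorm G R H x = (SUP p\<in>Collect (admissible G R H). p x)"

definition cauchy_algebra ::
    "'g set \<Rightarrow> ('g star_poly \<Rightarrow> real) \<Rightarrow> (nat \<Rightarrow> 'g star_poly) cstar"
  where "cauchy_algebra G p =
    \<lparr>carrier = {s. range s \<subseteq> star_polys G \<and>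
                   (\<forall>\<epsilon>>0. \<exists>N. \<forall>k\<ge>N. \<forall>l\<ge>N. p (s k - s l) < \<epsilon>)},
     mult = (\<lambda>s t k. s k * t k), one = (\<lambda>k. 1),
     zero = (\<lambda>k. 0), add = (\<lambda>s t k. s k + t k),
     smult = (\<lambda>c s k. cst c * s k),
     star = (\<lambda>s k. adj (s k)),
     cnorm = (\<lambda>s. lim (\<lambda>k. p (s k)))\<rparr>"

definition null_seqs :: "'g set \<Rightarrow> ('g star_poly \<Rightarrow> real) \<Rightarrow> (nat \<Rightarrow> 'g star_poly) set"
  where "null_seqs G p = {s \<in> carrier (cauchy_algebra G p). (\<lambda>k. p (s k)) \<longlonglongrightarrow> 0}"

type_synonym 'g univ = "(nat \<Rightarrow> 'g star_poly) set"

definition universal_cstar ::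
    "'g set \<Rightarrow> 'g star_poly set \<Rightarrow> 'g star_poly set \<Rightarrow> 'g univ cstar"
  where "universal_cstar G R H =
    (let p = universal_seminorm G R H in cstar_quot (cauchy_algebra G p) (null_seqs G p))"

definition universal_gen ::
    "'g set \<Rightarrow> 'g star_poly set \<Rightarrow> 'g star_poly set \<Rightarrow> 'g \<Rightarrow> 'g univ"
  where "universal_gen G R H g =
    (let p = universal_seminorm G R H in null_seqs G p +>\<^bsub>cauchy_algebra G p\<^esub> (\<lambda>k. gen g))"


section \<open>Even quantum balls and their boundaries\<close>

definition even_rels :: "real \<Rightarrow> nat \<Rightarrow> nat star_poly set"
  where "even_rels q n =
    {gen i * gen j - cst (of_real (q powr (1/2))) * (gen j * gen i) | i j.
       1 \<le> i \<and> i < j \<and> j \<le> n} \<union>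
    {gen i * adj (gen j) - cst (of_real (q powr (-1/2))) * (adj (gen j) * gen i) | i j.
       1 \<le> i \<and> i < j \<and> j \<le> n} \<union>
    {adj (gen i) * gen i - cst (of_real q) * (gen i * adj (gen i))
       - cst (of_real (1 - q)) * (1 - (\<Sum>j\<in>{i+1..n}. gen j * adj (gen j))) | i.
       1 \<le> i \<and> i \<le> n}"

definition even_ball :: "real \<Rightarrow> nat \<Rightarrow> nat univ cstar"
  where "even_ball q n = universal_cstar {1..n} (even_rels q n) {}"

definition z_gen :: "real \<Rightarrow> nat \<Rightarrow> nat \<Rightarrow> nat univ"
  where "z_gen q n i = universal_gen {1..n} (even_rels q n) {} i"

definition even_defect :: "real \<Rightarrow> nat \<Rightarrow> nat univ"
  where "even_defect q n = (let B = even_ball q n in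
    \<one>\<^bsub>B\<^esub> \<ominus>\<^bsub>B\<^esub> (\<Oplus>\<^bsub>B\<^esub>j\<in>{1..n}. z_gen q n j \<otimes>\<^bsub>B\<^esub> star B (z_gen q n j)))"

definition even_ideal :: "real \<Rightarrow> nat \<Rightarrow> nat univ set"
  where "even_ideal q n = closed_ideal_gen (even_ball q n) (even_defect q n)"

definition even_boundary :: "real \<Rightarrow> nat \<Rightarrow> nat univ set cstar"
  where "even_boundary q n = cstar_quot (even_ball q n) (even_ideal q n)"

definition even_proj :: "real \<Rightarrow> nat \<Rightarrow> nat univ \<Rightarrow> nat univ set"
  where "even_proj q n x = even_ideal q n +>\<^bsub>even_ball q n\<^esub> x"

definition w_gen :: "real \<Rightarrow> nat \<Rightarrow> nat \<Rightarrow> nat univ set"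
  where "w_gen q n i = even_proj q n (z_gen q n i)"


section \<open>Odd quantum balls and their boundaries\<close>

text \<open>\<open>odd_ball q n\<close> is the ball of dimension \<open>2n+1\<close>.\<close>

definition odd_rels :: "real \<Rightarrow> nat \<Rightarrow> nat star_poly set"
  where "odd_rels q n =
    {gen 1 - adj (gen 1)} \<union>
    {gen i * gen j - cst (of_real (q powr (1/2))) * (gen j * gen i) | i j.
       1 \<le> i \<and> i < j \<and> j \<le> n + 1} \<union>
    {gen i * adj (gen j) - cst (of_real (q powr (-1/2))) * (adj (gen j) * gen i) | i j.
       2 \<le> i \<and> i < j \<and> j \<le> n + 1} \<union>
    {adj (gen i) * gen i - cst (of_real q) * (gen i * adj (gen i))
       - cst (of_real (1 - q)) * (1 - (\<Sum>j\<in>{i+1..n+1}. gen j * adj (gen j))) | i.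
       2 \<le> i \<and> i \<le> n + 1}"

definition odd_pos_rels :: "nat \<Rightarrow> nat star_poly set"
  where "odd_pos_rels n =
    {1 - ((gen 1)\<^sup>2 + (\<Sum>j\<in>{2..n+1}. gen j * adj (gen j)))}"

definition odd_ball :: "real \<Rightarrow> nat \<Rightarrow> nat univ cstar"
  where "odd_ball q n = universal_cstar {1..n+1} (odd_rels q n) (odd_pos_rels n)"

definition x_gen :: "real \<Rightarrow> nat \<Rightarrow> nat \<Rightarrow> nat univ"
  where "x_gen q n i = universal_gen {1..n+1} (odd_rels q n) (odd_pos_rels n) i"

definition odd_defect :: "real \<Rightarrow> nat \<Rightarrow> nat univ"
  where "odd_defect q n = (let B = odd_ball q n in
    \<one>\<^bsub>B\<^esub> \<ominus>\<^bsub>B\<^esub> (x_gen q n 1 \<otimes>\<^bsub>B\<^esub> x_gen q n 1)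
      \<ominus>\<^bsub>B\<^esub> (\<Oplus>\<^bsub>B\<^esub>j\<in>{2..n+1}. x_gen q n j \<otimes>\<^bsub>B\<^esub> star B (x_gen q n j)))"

definition odd_ideal :: "real \<Rightarrow> nat \<Rightarrow> nat univ set"
  where "odd_ideal q n = closed_ideal_gen (odd_ball q n) (odd_defect q n)"

definition odd_boundary :: "real \<Rightarrow> nat \<Rightarrow> nat univ set cstar"
  where "odd_boundary q n = cstar_quot (odd_ball q n) (odd_ideal q n)"

definition t_gen :: "real \<Rightarrow> nat \<Rightarrow> nat \<Rightarrow> nat univ set"
  where "t_gen q n i = odd_ideal q n +>\<^bsub>odd_ball q n\<^esub> x_gen q n i"


section \<open>The glued sphere\<close>

definition glued_sphere ::
    "real \<Rightarrow> nat \<Rightarrow> (nat univ set \<Rightarrow> nat univ set) \<Rightarrow> (nat univ \<times> nat univ) cstar"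
  where "glued_sphere q n \<beta> = (let B = even_ball q n in
    \<lparr>carrier = {(x, y). x \<in> carrier B \<and> y \<in> carrier B \<and>
                        even_proj q n x = \<beta> (even_proj q n y)},
     mult = (\<lambda>(x, y) (x', y'). (x \<otimes>\<^bsub>B\<^esub> x', y \<otimes>\<^bsub>B\<^esub> y')),
     one = (\<one>\<^bsub>B\<^esub>, \<one>\<^bsub>B\<^esub>),
     zero = (\<zero>\<^bsub>B\<^esub>, \<zero>\<^bsub>B\<^esub>),
     add = (\<lambda>(x, y) (x', y'). (x \<oplus>\<^bsub>B\<^esub> x', y \<oplus>\<^bsub>B\<^esub> y')),
     smult = (\<lambda>c (x, y). (c \<odot>\<^bsub>B\<^esub> x, c \<odot>\<^bsub>B\<^esub> y)),
     star = (\<lambda>(x, y). (star B x, star B y)),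
     cnorm = (\<lambda>(x, y). max (cnorm B x) (cnorm B y))\<rparr>)"

definition e_gen :: "real \<Rightarrow> nat \<Rightarrow> (nat \<Rightarrow> complex) \<Rightarrow> nat \<Rightarrow> nat univ \<times> nat univ"
  where "e_gen q n lam i = (let B = even_ball q n in
    if i = 0
    then (cstar_sqrt B (even_defect q n), \<ominus>\<^bsub>B\<^esub> cstar_sqrt B (even_defect q n))
    else (lam i \<odot>\<^bsub>B\<^esub> z_gen q n i, z_gen q n i))"

end

theory Submission
  imports Defs "HOL-Analysis.Analysis"
begin

text \<open>
  Let \<open>D = 1 - \<Sum> z\<^sub>j z\<^sub>j\<^sup>*\<close> in the algebra of the even ball. The relations give
  \<open>D z\<^sub>j = q z\<^sub>j D\<close> and, because \<open>q < 1\<close>, force \<open>D \<ge> 0\<close> (\<open>pos_defect\<close>). Its positive root \<open>s\<close> then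
  satisfies \<open>s z\<^sub>j = q\<^sup>1\<^sup>/\<^sup>2 z\<^sub>j s\<close>. In the odd ball the generators \<open>x\<^sub>2, \<dots>, x\<^sub>n\<^sub>+\<^sub>1\<close> satisfy the
  relations of the even ball, and on its boundary \<open>x\<^sub>1\<^sup>2\<close> is their defect: there \<open>x\<^sub>1\<close> is some self-adjoint
  root of \<open>D\<close>. The choices \<open>x\<^sub>1 \<mapsto> s\<close> and \<open>x\<^sub>1 \<mapsto> -s\<close> define two *-homomorphisms \<open>F\<^sub>1, F\<^sub>2\<close> to the algebra
  of the even ball, and the isomorphism is \<open>a \<mapsto> (F\<^sub>1 a, F\<^sub>2 a)\<close>.
  
  Injectivity. Let \<open>r\<close> be the positive root of the defect of \<open>x\<^sub>2, \<dots>, x\<^sub>n\<^sub>+\<^sub>1\<close>. On the boundary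
  \<open>(r + x\<^sub>1) (r - x\<^sub>1) = 0\<close>, and both factors commute with every generator up to a scalar, so the closed
  ideals that they generate annihilate each other. Imposing \<open>x\<^sub>1 = r\<close> leaves the even ball; hence the kernel of
  \<open>F\<^sub>1\<close> lies in the ideal of \<open>r - x\<^sub>1\<close>, and that of \<open>F\<^sub>2\<close> in the ideal of \<open>r + x\<^sub>1\<close>. An element \<open>a\<close> of both
  kernels satisfies \<open>a\<^sup>* a = 0\<close> (\<open>kernel_subset\<close>).
  
  Surjectivity. A glued pair differs from the image of a lift of its second component by a pair
  \<open>(d, 0)\<close> with \<open>d\<close> in the ideal generated by \<open>D\<close>. The elements \<open>d\<close> for which \<open>(d, 0)\<close> is in the image form an
  ideal, which contains \<open>2 s\<close>, the value of \<open>F\<^sub>1\<close> at \<open>r + x\<^sub>1\<close>. It is closed, because orthogonality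
  allows lifts whose norm is close to that of \<open>d\<close> (\<open>lift\<close>, \<open>closed_L\<close>, \<open>K_lift\<close>). The automorphism \<open>\<beta>\<close> is known on
  generators only; it is determined by them because it is continuous (\<open>automorphism_closed\<close>).
  
  The C*-algebra theory behind this starts from one construction, the square root of \<open>1 - x\<close> for
  \<open>\<parallel>x\<parallel> \<le> 1\<close> by iteration, without spectra: positivity of \<open>c\<^sup>* c\<close> (\<open>pos_dag_mult\<close>), uniqueness of positive roots and
  their commutation relations, both from a Sylvester equation (\<open>sylvester\<close>), and cutoffs for closed ideals
  (\<open>ideal_cutoff\<close>). It is developed for a type class. The algebras of the theorem are records
  that depend on \<open>q\<close> and \<open>n\<close>; every such record is a corner of one algebra in the class, the bounded
  families of elements, one from each C*-algebra with the same carrier type (\<open>embed\<close>).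
\<close>

section \<open>Unital C*-algebras\<close>

text \<open>
  The unit may be zero: the zero algebra is a C*-algebra here, as it is for the records below.
\<close>

class unital_cstar = real_normed_algebra + complete_space + monoid_mult +
  fixes cscale :: "complex \<Rightarrow> 'a \<Rightarrow> 'a" (infixr "*\<^sub>C" 75)
    and dag :: "'a \<Rightarrow> 'a" ("_\<^sup>\<star>" [999] 999)
  assumes cscale_add_right: "c *\<^sub>C (x + y) = c *\<^sub>C x + c *\<^sub>C y"
    and cscale_add_left: "(c + d) *\<^sub>C x = c *\<^sub>C x + d *\<^sub>C x"
    and cscale_cscale [simp]: "c *\<^sub>C d *\<^sub>C x = (c * d) *\<^sub>C x"
    and cscale_of_real: "complex_of_real r *\<^sub>C x = r *\<^sub>R x"
    and cscale_mult_left [simp]: "c *\<^sub>C x * y = c *\<^sub>C (x * y)"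
    and cscale_mult_right [simp]: "x * (c *\<^sub>C y) = c *\<^sub>C (x * y)"
    and norm_cscale [simp]: "norm (c *\<^sub>C x) = cmod c * norm x"
    and dag_add [simp]: "(x + y)\<^sup>\<star> = x\<^sup>\<star> + y\<^sup>\<star>"
    and dag_mult [simp]: "(x * y)\<^sup>\<star> = y\<^sup>\<star> * x\<^sup>\<star>"
    and dag_cscale [simp]: "(c *\<^sub>C x)\<^sup>\<star> = cnj c *\<^sub>C x\<^sup>\<star>"
    and dag_dag [simp]: "x\<^sup>\<star>\<^sup>\<star> = x"
    and cstar_identity: "norm (x\<^sup>\<star> * x) = (norm x)\<^sup>2"

lemma cscale_one [simp]: "1 *\<^sub>C x = x"
  using cscale_of_real[of 1 x] by simp

lemma cscale_0 [simp]: "0 *\<^sub>C x = 0" and cscale_0_right [simp]: "c *\<^sub>C 0 = 0"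
  using cscale_of_real[of 0 x] cscale_add_right[of c 0 0] by simp_all

lemma cscale_minus_left [simp]: "(- c) *\<^sub>C x = - (c *\<^sub>C x)"
  using cscale_add_left[of c "-c" x] by (simp add: eq_neg_iff_add_eq_0 add.commute)

lemma cscale_minus_right [simp]: "c *\<^sub>C (- x) = - (c *\<^sub>C x)"
  using cscale_add_right[of c x "-x"] by (simp add: eq_neg_iff_add_eq_0 add.commute)

lemma cscale_diff_right: "c *\<^sub>C (x - y) = c *\<^sub>C x - c *\<^sub>C y"
  using cscale_add_right[of c x "-y"] by simp

lemma dag_0 [simp]: "0\<^sup>\<star> = 0"
  using dag_cscale[of 0 0] by simp

lemma dag_minus [simp]: "(- x)\<^sup>\<star> = - (x\<^sup>\<star>)"
  using dag_cscale[of "-1" x] by simp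

lemma dag_diff [simp]: "(x - y)\<^sup>\<star> = x\<^sup>\<star> - y\<^sup>\<star>"
  using dag_add[of x "-y"] by simp

lemma dag_scaleR [simp]: "(r *\<^sub>R x)\<^sup>\<star> = r *\<^sub>R x\<^sup>\<star>"
  using dag_cscale[of "complex_of_real r" x] by (simp only: cscale_of_real complex_cnj_complex_of_real)

lemma dag_one [simp]: "1\<^sup>\<star> = 1"
  by (metis dag_dag dag_mult mult_1_right)

lemma norm_dag [simp]:
  fixes x :: "'a::unital_cstar"
  shows "norm (x\<^sup>\<star>) = norm x"
proof -
  have *: "norm x \<le> norm (x\<^sup>\<star>)" for x :: 'a
  proof (cases "norm x = 0")
    case False
    have "norm x * norm x \<le> norm (x\<^sup>\<star>) * norm x"
      using norm_mult_ineq[of "x\<^sup>\<star>" x] by (simp add: cstar_identity power2_eq_square)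
    with False show ?thesis by (simp add: mult_le_cancel_right)
  qed simp
  from *[of x] *[of "x\<^sup>\<star>"] show ?thesis by simp
qed

lemma dag_mult_eq_0_iff: "x\<^sup>\<star> * x = 0 \<longleftrightarrow> x = 0"
proof
  assume "x\<^sup>\<star> * x = 0"
  then have "(norm x)\<^sup>2 = 0" using cstar_identity[of x] by simp
  then show "x = 0" by simp
qed simp

lemma norm_self_adjoint_square: "h\<^sup>\<star> = h \<Longrightarrow> norm (h * h) = (norm h)\<^sup>2"
  using cstar_identity[of h] by simp

lemma self_adjoint_square_eq_0: "h\<^sup>\<star> = h \<Longrightarrow> h * h = 0 \<Longrightarrow> h = 0"
  using dag_mult_eq_0_iff[of h] by simp

lemma norm_one_le: "norm (1::'a::unital_cstar) \<le> 1"
proof -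
  have "norm (1::'a) = (norm (1::'a))\<^sup>2" using cstar_identity[of 1] by simp
  then have "norm (1::'a) * (norm (1::'a) - 1) = 0" by (simp add: power2_eq_square algebra_simps)
  then show ?thesis by auto
qed

lemma tendsto_dag [tendsto_intros]:
  fixes f :: "'b \<Rightarrow> 'a::unital_cstar"
  assumes "(f \<longlongrightarrow> a) F" shows "((\<lambda>x. (f x)\<^sup>\<star>) \<longlongrightarrow> a\<^sup>\<star>) F"
  by (rule tendsto_dist_iff[THEN iffD2])
    (use assms in \<open>simp add: tendsto_dist_iff[of f] dist_norm flip: dag_diff\<close>)

lemma tendsto_cscale [tendsto_intros]:
  fixes f :: "'b \<Rightarrow> 'a::unital_cstar"
  assumes "(f \<longlongrightarrow> a) F" shows "((\<lambda>x. c *\<^sub>C f x) \<longlongrightarrow> c *\<^sub>C a) F"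
proof -
  have "((\<lambda>x. cmod c * norm (f x - a)) \<longlongrightarrow> cmod c * norm (a - a)) F"
    by (intro tendsto_intros assms)
  then show ?thesis
    by (subst tendsto_dist_iff) (simp add: dist_norm flip: cscale_diff_right)
qed

section \<open>Square roots\<close>

text \<open>
  The iteration \<open>y \<mapsto> (x + y\<^sup>2) / 2\<close> from \<open>0\<close> converges to a solution of \<open>2 y = x + y\<^sup>2\<close>, that is
  \<open>(1 - y)\<^sup>2 = 1 - x\<close>. For the number \<open>x = 1\<close> it increases and stays below \<open>1\<close>; for \<open>\<parallel>x\<parallel> \<le> 1\<close> the
  steps have norm at most those of the numerical iteration, which proves convergence up to the boundary case
  \<open>\<parallel>x\<parallel> = 1\<close>. The limit inherits what holds for polynomials in \<open>x\<close>.
\<close>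

lemma sqrt_one_minus:
  fixes x :: "'a::unital_cstar"
  assumes x: "norm x \<le> 1"
  obtains y where "norm y \<le> 1" "(1 - y) * (1 - y) = 1 - x" "x\<^sup>\<star> = x \<Longrightarrow> y\<^sup>\<star> = y"
    "\<And>c. c * x = x * c \<Longrightarrow> c * y = y * c"
proof -
  define Y where "Y k = ((\<lambda>y. (1/2) *\<^sub>R (x + y * y)) ^^ k) 0" for k :: nat
  define E where "E k = ((\<lambda>t. (1 + t\<^sup>2) / 2) ^^ k) (0::real)" for k :: nat
  have Y0: "Y 0 = 0" and YS: "Y (Suc k) = (1/2) *\<^sub>R (x + Y k * Y k)" for k by (simp_all add: Y_def)
  have E0: "E 0 = 0" and ES: "E (Suc k) = (1 + (E k)\<^sup>2) / 2" for k by (simp_all add: E_def)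
  have E1: "0 \<le> E k \<and> E k \<le> 1" for k
    by (induct k) (auto simp: E0 ES power_le_one)
  have Yn: "norm (Y k) \<le> E k" for k
  proof (induct k)
    case (Suc k)
    have "norm (x + Y k * Y k) \<le> 1 + E k * E k"
      using x norm_mult_ineq[of "Y k" "Y k"] mult_mono[OF Suc Suc] E1[of k]
      by (intro norm_triangle_le) auto
    then show ?case by (simp add: YS ES power2_eq_square)
  qed (simp add: Y0 E0)
  have step: "norm (Y (Suc k) - Y k) \<le> E (Suc k) - E k" for k
  proof (induct k)
    case 0 then show ?case using x by (simp add: Y0 YS E0 ES)
  next
    case (Suc k)
    have "Y (Suc (Suc k)) - Y (Suc k)
        = (1/2) *\<^sub>R ((Y (Suc k) - Y k) * Y (Suc k) + Y k * (Y (Suc k) - Y k))"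
      by (subst YS, subst (3) YS) (simp add: algebra_simps)
    also have "norm \<dots> \<le> (1/2) * ((E (Suc k) - E k) * E (Suc k) + E k * (E (Suc k) - E k))"
    proof -
      have "norm ((Y (Suc k) - Y k) * Y (Suc k)) \<le> (E (Suc k) - E k) * E (Suc k)"
        by (rule order_trans[OF norm_mult_ineq mult_mono]) (use Suc Yn E1[of k] E1[of "Suc k"] norm_ge_zero order_trans in \<open>blast+\<close>)
      moreover have "norm (Y k * (Y (Suc k) - Y k)) \<le> E k * (E (Suc k) - E k)"
        by (rule order_trans[OF norm_mult_ineq mult_mono]) (use Suc Yn E1 norm_ge_zero order_trans in \<open>blast+\<close>)
      ultimately show ?thesis
        using norm_triangle_ineq[of "(Y (Suc k) - Y k) * Y (Suc k)" "Y k * (Y (Suc k) - Y k)"] by simp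
    qed
    also have "\<dots> = E (Suc (Suc k)) - E (Suc k)"
      by (simp only: ES[of "Suc k"], subst (3) ES) (simp add: power2_eq_square algebra_simps)
    finally show ?case .
  qed
  have mono: "incseq E"
  proof (rule incseq_SucI)
    fix k show "E k \<le> E (Suc k)" using step[of k] norm_ge_zero[of "Y (Suc k) - Y k"] by linarith
  qed
  have diff: "norm (Y (k + m) - Y k) \<le> E (k + m) - E k" for k m
  proof (induct m)
    case (Suc m)
    then show ?case using step[of "k + m"] norm_triangle_ineq[of "Y (Suc (k+m)) - Y (k+m)" "Y (k+m) - Y k"]
      by (simp add: algebra_simps)
  qed simp
  have CE: "Cauchy E"
  proof -
    obtain L where "E \<longlonglongrightarrow> L" using incseq_convergent[OF mono, of 1] E1 by blast
    then show ?thesis by (rule LIMSEQ_imp_Cauchy)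
  qed
  have "Cauchy Y"
  proof (rule CauchyI')
    fix e :: real assume "0 < e"
    then obtain M where M: "\<And>m n. m \<ge> M \<Longrightarrow> n \<ge> M \<Longrightarrow> norm (E m - E n) < e"
      using CauchyD[OF CE] by blast
    have "norm (Y m - Y n) < e" if "m \<ge> M" "n > m" for m n
    proof -
      have "norm (Y m - Y n) \<le> E n - E m"
        using diff[of m "n - m"] that by (simp add: norm_minus_commute)
      also have "\<dots> \<le> norm (E n - E m)" by simp
      also have "\<dots> < e" using M[of n m] that by simp
      finally show ?thesis .
    qed
    then show "\<exists>M. \<forall>m\<ge>M. \<forall>n>m. dist (Y m) (Y n) < e" by (auto simp: dist_norm)
  qed
  then obtain y where y: "Y \<longlonglongrightarrow> y" by (auto simp: Cauchy_convergent_iff convergent_def)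
  have "norm y \<le> 1"
    by (rule LIMSEQ_le_const2[OF tendsto_norm[OF y]]) (use Yn E1 order_trans in blast)
  moreover have "y = (1/2) *\<^sub>R (x + y * y)"
  proof (rule LIMSEQ_unique)
    show "(\<lambda>k. Y (Suc k)) \<longlonglongrightarrow> y" using y by (rule LIMSEQ_Suc)
    show "(\<lambda>k. Y (Suc k)) \<longlonglongrightarrow> (1/2) *\<^sub>R (x + y * y)"
      unfolding YS by (intro tendsto_intros y)
  qed
  then have "2 *\<^sub>R y = 2 *\<^sub>R ((1/2) *\<^sub>R (x + y * y))" by (rule arg_cong)
  then have "(1 - y) * (1 - y) = 1 - x" by (simp add: algebra_simps scaleR_2)
  moreover have "y\<^sup>\<star> = y" if "x\<^sup>\<star> = x"
  proof -
    have "(Y k)\<^sup>\<star> = Y k" for k by (induct k) (simp_all add: Y0 YS that)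
    then have "Y \<longlonglongrightarrow> y\<^sup>\<star>" using tendsto_dag[OF y] by simp
    from LIMSEQ_unique[OF this y] show ?thesis .
  qed
  moreover have "c * y = y * c" if c: "c * x = x * c" for c
  proof -
    have "c * Y k = Y k * c" for k
    proof (induct k)
      case (Suc k)
      have "c * (Y k * Y k) = Y k * Y k * c"
        using Suc by (metis mult.assoc)
      then show ?case by (simp add: YS c distrib_left distrib_right)
    qed (simp add: Y0)
    then have "(\<lambda>k. Y k * c) \<longlonglongrightarrow> c * y" using tendsto_mult_left[OF y, of c] by simp
    from LIMSEQ_unique[OF this tendsto_mult_right[OF y, of c]] show ?thesis .
  qed
  ultimately show ?thesis by (rule that)
qed

text \<open>
  If \<open>b\<close> is the root of \<open>1 - h\<^sup>2\<close>, then \<open>u = h + \<i> b\<close> is unitary. So \<open>b\<close> and \<open>2 h b\<close>, the imaginary parts of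
  \<open>u\<close> and \<open>u\<^sup>2\<close>, have norm at most 1.
\<close>

lemma complementary_root:
  fixes h :: "'a::unital_cstar"
  assumes h: "h\<^sup>\<star> = h" and n: "norm h \<le> 1"
  obtains b where "b\<^sup>\<star> = b" "h * h + b * b = 1" "norm b \<le> 1" "norm (h * b) \<le> 1/2" "h * b = b * h"
proof -
  have "norm (h * h) \<le> 1" using n by (simp add: norm_self_adjoint_square[OF h] power_le_one)
  then obtain y where y: "(1 - y) * (1 - y) = 1 - h * h" "(h * h)\<^sup>\<star> = h * h \<Longrightarrow> y\<^sup>\<star> = y"
    "\<And>c. c * (h * h) = (h * h) * c \<Longrightarrow> c * y = y * c" by (rule sqrt_one_minus) metis
  define b where "b = 1 - y"
  have b: "b\<^sup>\<star> = b" using y(2) h by (simp add: b_def)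
  have hb: "h * b = b * h" using y(3)[of h] by (simp add: b_def algebra_simps mult.assoc)
  have s: "h * h + b * b = 1" using y(1) by (simp add: b_def)
  define u where "u = h + \<i> *\<^sub>C b"
  have us: "u\<^sup>\<star> = h - \<i> *\<^sub>C b" by (simp add: u_def h b)
  have "u\<^sup>\<star> * u = h * h + b * b"
    using hb by (simp add: us) (simp add: u_def algebra_simps cscale_add_right cscale_diff_right)
  then have "u\<^sup>\<star> * u = 1" using s by simp
  then have "(norm u)\<^sup>2 \<le> 1" using cstar_identity[of u] norm_one_le by metis
  then have u1: "norm u \<le> 1" using power2_le_imp_le[of "norm u" 1] by simp
  have "2 *\<^sub>R b = (- \<i>) *\<^sub>C (u - u\<^sup>\<star>)"
    by (simp add: us) (simp add: u_def cscale_diff_right cscale_add_right scaleR_2)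
  then have "norm (2 *\<^sub>R b) = norm ((- \<i>) *\<^sub>C (u - u\<^sup>\<star>))" by (rule arg_cong)
  then have "2 * norm b = norm (u - u\<^sup>\<star>)" by simp
  also have "\<dots> \<le> 2" using norm_triangle_ineq4[of u "u\<^sup>\<star>"] u1 by simp
  finally have nb: "norm b \<le> 1" by simp
  have "4 *\<^sub>R (h * b) = (- \<i>) *\<^sub>C (u * u - u\<^sup>\<star> * u\<^sup>\<star>)"
    using scaleR_add_left[of 2 2 "h * b"]
    by (simp add: us) (simp add: u_def hb algebra_simps cscale_diff_right cscale_add_right scaleR_2)
  then have "norm (4 *\<^sub>R (h * b)) = norm ((- \<i>) *\<^sub>C (u * u - u\<^sup>\<star> * u\<^sup>\<star>))" by (rule arg_cong)
  then have "4 * norm (h * b) = norm (u * u - u\<^sup>\<star> * u\<^sup>\<star>)" by simp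
  also have "\<dots> \<le> norm u * norm u + norm u * norm u"
    using norm_triangle_ineq4[of "u*u" "u\<^sup>\<star> * u\<^sup>\<star>"] norm_mult_ineq[of u u] norm_mult_ineq[of "u\<^sup>\<star>" "u\<^sup>\<star>"] by simp
  also have "\<dots> \<le> 2" using mult_mono[OF u1 u1] by simp
  finally have "norm (h * b) \<le> 1/2" by simp
  with b s nb hb that show ?thesis by blast
qed

section \<open>Positive elements\<close>

text \<open>
  Squares of self-adjoint elements are easier to handle than elements of the form \<open>c\<^sup>* c\<close>; that the
  latter are positive is the content of \<open>pos_dag_mult\<close>.
\<close>

definition pos :: "'a::unital_cstar \<Rightarrow> bool"
  where "pos a \<longleftrightarrow> (\<exists>h. h\<^sup>\<star> = h \<and> a = h * h)"

lemma pos_dag: "pos a \<Longrightarrow> a\<^sup>\<star> = a"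
  by (auto simp: pos_def)

lemma pos_square: "h\<^sup>\<star> = h \<Longrightarrow> pos (h * h)"
  by (auto simp: pos_def)

lemma pos_0 [simp]: "pos 0"
  using pos_square[of 0] by simp

lemma pos_scaleR:
  assumes "pos a" "0 \<le> r" shows "pos (r *\<^sub>R a)"
proof -
  from assms obtain h where "h\<^sup>\<star> = h" "a = h * h" by (auto simp: pos_def)
  then have "(sqrt r *\<^sub>R h)\<^sup>\<star> = sqrt r *\<^sub>R h" "r *\<^sub>R a = (sqrt r *\<^sub>R h) * (sqrt r *\<^sub>R h)"
    using assms(2) by simp_all
  then show ?thesis using pos_square by metis
qed

text \<open>
  Together with \<open>posI_norm\<close> this turns positivity of \<open>a\<close> into the inequality \<open>\<parallel>r - a\<parallel> \<le> r\<close>,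
  which is visibly stable under sums.
\<close>

lemma norm_diff_pos_le:
  assumes "pos a" "norm a \<le> r" shows "norm (r *\<^sub>R 1 - a) \<le> r"
proof (cases "r = 0")
  case True
  with assms show ?thesis by simp
next
  case False
  with assms norm_ge_zero[of a] have r: "0 < r" by linarith
  from assms(1) obtain h where h: "h\<^sup>\<star> = h" "a = h * h" by (auto simp: pos_def)
  define g where "g = (1 / sqrt r) *\<^sub>R h"
  have g: "g\<^sup>\<star> = g" by (simp add: g_def h)
  have gg: "a = r *\<^sub>R (g * g)" using r by (simp add: g_def h(2))
  have "r * (norm g)\<^sup>2 \<le> r * 1"
    using assms(2) r by (simp add: gg norm_self_adjoint_square[OF g])
  then have "(norm g)\<^sup>2 \<le> 1" using r by (simp only: mult_le_cancel_left_pos)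
  then have "norm g \<le> 1" using power2_le_imp_le[of "norm g" 1] by simp
  from complementary_root[OF g this] obtain b where b: "g * g + b * b = 1" "norm b \<le> 1" by metis
  have "r *\<^sub>R 1 - a = r *\<^sub>R (b * b)" unfolding gg b(1)[symmetric] by (simp add: scaleR_add_right)
  also have "norm \<dots> \<le> r"
    using norm_mult_ineq[of b b] mult_mono[OF b(2) b(2)] r
    by (simp add: mult_left_le)
  finally show ?thesis .
qed

lemma sqrt_of_norm_diff_le:
  assumes "a\<^sup>\<star> = a" "norm (r *\<^sub>R 1 - a) \<le> r"
  obtains s where "s\<^sup>\<star> = s" "s * s = a" "norm (sqrt r *\<^sub>R 1 - s) \<le> sqrt r" "\<And>c. c * a = a * c \<Longrightarrow> c * s = s * c"
proof (cases "r = 0")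
  case True
  with assms(2) show ?thesis by (intro that[of 0]) auto
next
  case False
  then have r: "0 < r" using assms(2) norm_ge_zero[of "r *\<^sub>R 1 - a"] by linarith
  define x where "x = 1 - (1/r) *\<^sub>R a"
  have "x = (1/r) *\<^sub>R (r *\<^sub>R 1 - a)" using r by (simp add: x_def scaleR_diff_right)
  then have "norm x \<le> 1" using assms(2) r by simp
  from sqrt_one_minus[OF this] obtain y where y: "norm y \<le> 1" "(1 - y) * (1 - y) = 1 - x"
    "x\<^sup>\<star> = x \<Longrightarrow> y\<^sup>\<star> = y" "\<And>c. c * x = x * c \<Longrightarrow> c * y = y * c" by blast
  show ?thesis
  proof (rule that[of "sqrt r *\<^sub>R (1 - y)"])
    show "(sqrt r *\<^sub>R (1 - y))\<^sup>\<star> = sqrt r *\<^sub>R (1 - y)" using y(3) assms(1) by (simp add: x_def)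
    show "sqrt r *\<^sub>R (1 - y) * sqrt r *\<^sub>R (1 - y) = a" using y(2) r by (simp add: x_def)
    show "norm (sqrt r *\<^sub>R 1 - sqrt r *\<^sub>R (1 - y)) \<le> sqrt r"
      using y(1) r by (simp add: mult_left_le flip: scaleR_diff_right)
    show "c * sqrt r *\<^sub>R (1 - y) = sqrt r *\<^sub>R (1 - y) * c" if "c * a = a * c" for c
    proof -
      have "c * x = x * c" using that by (simp add: x_def algebra_simps)
      from y(4)[OF this] show ?thesis by (simp add: algebra_simps)
    qed
  qed
qed

lemma posI_norm:
  assumes "a\<^sup>\<star> = a" "norm (r *\<^sub>R 1 - a) \<le> r" shows "pos a"
proof -
  obtain s where "s\<^sup>\<star> = s" "s * s = a" by (rule sqrt_of_norm_diff_le[OF assms])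
  then show ?thesis using pos_square by blast
qed

lemma pos_sqrt:
  assumes "pos a"
  obtains s where "pos s" "s * s = a" "\<And>c. c * a = a * c \<Longrightarrow> c * s = s * c"
proof -
  from sqrt_of_norm_diff_le[OF pos_dag[OF assms] norm_diff_pos_le[OF assms order_refl]]
  obtain s where s: "s\<^sup>\<star> = s" "s * s = a" "norm (sqrt (norm a) *\<^sub>R 1 - s) \<le> sqrt (norm a)"
    "\<And>c. c * a = a * c \<Longrightarrow> c * s = s * c" by blast
  from s(1,3) have "pos s" by (rule posI_norm)
  from this s(2,4) show ?thesis by (rule that)
qed

lemma pos_add:
  assumes "pos a" "pos b" shows "pos (a + b)"
proof (rule posI_norm)
  show "norm ((norm a + norm b) *\<^sub>R 1 - (a + b)) \<le> norm a + norm b"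
    using norm_triangle_mono[OF norm_diff_pos_le[OF assms(1) order_refl] norm_diff_pos_le[OF assms(2) order_refl]]
    by (simp add: algebra_simps)
qed (simp add: assms pos_dag)

lemma pos_diff_norm: "c\<^sup>\<star> = c \<Longrightarrow> norm c \<le> r \<Longrightarrow> pos (r *\<^sub>R 1 - c)"
  by (rule posI_norm[of _ r]) simp_all

text \<open>
  With \<open>a = h\<^sup>2\<close> and \<open>r - a = k\<^sup>2\<close> for commuting \<open>h\<close> and \<open>k\<close>, the element \<open>u = h + \<i> k\<close> satisfies \<open>u\<^sup>* u = r\<close>, and \<open>h\<close>
  is its real part.
\<close>

lemma norm_le_of_pos_diff:
  assumes a: "pos a" and ra: "pos (r *\<^sub>R 1 - a)" and r: "0 \<le> r"
  shows "norm a \<le> r"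
proof -
  from a obtain h where h: "h\<^sup>\<star> = h" "a = h * h" by (auto simp: pos_def)
  from ra obtain k where k: "pos k" "k * k = r *\<^sub>R 1 - a"
    "\<And>c. c * (r *\<^sub>R 1 - a) = (r *\<^sub>R 1 - a) * c \<Longrightarrow> c * k = k * c" using pos_sqrt[OF ra] by blast
  have hk: "h * k = k * h" by (rule k(3)) (simp add: h(2) algebra_simps mult.assoc)
  define u where "u = h + \<i> *\<^sub>C k"
  have us: "u\<^sup>\<star> = h - \<i> *\<^sub>C k" by (simp add: u_def h pos_dag[OF k(1)])
  have "u\<^sup>\<star> * u = h * h + k * k"
    using hk by (simp add: us) (simp add: u_def algebra_simps cscale_add_right cscale_diff_right)
  then have "norm (u\<^sup>\<star> * u) \<le> r"
    using r norm_one_le[where 'a='a] by (simp add: k(2) h(2) mult_left_le)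
  then have nu: "(norm u)\<^sup>2 \<le> r" by (simp add: cstar_identity)
  have "2 *\<^sub>R h = u + u\<^sup>\<star>" by (simp add: us) (simp add: u_def scaleR_2)
  then have "norm (2 *\<^sub>R h) \<le> 2 * norm u" using norm_triangle_ineq[of u "u\<^sup>\<star>"] by simp
  then have "norm h \<le> norm u" by simp
  then have "(norm h)\<^sup>2 \<le> (norm u)\<^sup>2" by (rule power_mono) simp
  with nu have "(norm h)\<^sup>2 \<le> r" by linarith
  then show ?thesis by (simp add: h(2) norm_self_adjoint_square[OF h(1)])
qed

lemma norm_pos_mono:
  assumes "pos a" "pos b" shows "norm a \<le> norm (a + b)"
proof (rule norm_le_of_pos_diff[OF assms(1)])
  have "pos (norm (a + b) *\<^sub>R 1 - (a + b) + b)"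
    by (intro pos_add pos_diff_norm assms) (simp_all add: assms pos_dag)
  then show "pos (norm (a + b) *\<^sub>R 1 - a)" by (simp add: algebra_simps)
qed simp

lemma pos_add_eq_0: "pos a \<Longrightarrow> pos b \<Longrightarrow> a + b = 0 \<Longrightarrow> a = 0"
  using norm_pos_mono[of a b] by simp

text \<open>
  Writing \<open>y = g + \<i> h\<close> gives \<open>y y\<^sup>* = 2 g\<^sup>2 + 2 h\<^sup>2 + k\<^sup>2 \<ge> 0\<close>, so \<open>\<parallel>(1 + y y\<^sup>*) y\<parallel> \<ge> \<parallel>y\<parallel>\<close>. But
  \<open>(1 + y y\<^sup>*) y = y (1 - k\<^sup>2)\<close>, and if \<open>\<parallel>y\<parallel> = \<parallel>k\<parallel> = 1\<close> then its norm is at most \<open>\<parallel>k b\<parallel> \<le> 1/2\<close>,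
  where \<open>b\<^sup>2 = 1 - k\<^sup>2\<close>.
\<close>

lemma dag_mult_eq_minus_square:
  assumes y: "y\<^sup>\<star> * y = - (k * k)" and k: "k\<^sup>\<star> = k"
  shows "y = 0"
proof -
  have normed: False if y: "y\<^sup>\<star> * y = - (k * k)" and k: "k\<^sup>\<star> = k" and y1: "norm y = 1" for y k :: 'a
  proof -
    define g where "g = (1/2) *\<^sub>R (y + y\<^sup>\<star>)"
    define h where "h = (- (\<i> / 2)) *\<^sub>C (y - y\<^sup>\<star>)"
    have gh: "g\<^sup>\<star> = g" "h\<^sup>\<star> = h" 
      by (simp_all add: g_def h_def add.commute cscale_diff_right)
    have yg: "y = g + \<i> *\<^sub>C h" 
      by (simp add: g_def h_def flip: cscale_of_real) (simp add: cscale_add_right cscale_diff_right flip: cscale_add_left)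
    have "y * y\<^sup>\<star> + y\<^sup>\<star> * y = 2 *\<^sub>R (g * g + h * h)"
      by (simp add: yg gh) (simp add: algebra_simps cscale_add_right cscale_diff_right scaleR_2)
    then have "y * y\<^sup>\<star> = 2 *\<^sub>R (g * g + h * h) + k * k" using y by (simp add: algebra_simps)
    then have P: "pos (y * y\<^sup>\<star>)" by (simp add: pos_add pos_scaleR pos_square gh k)
    have nP: "norm (y * y\<^sup>\<star>) = 1" using cstar_identity[of "y\<^sup>\<star>"] y1 by simp
    have nk: "norm k \<le> 1"
    proof -
      have "(norm k)\<^sup>2 = norm (y\<^sup>\<star> * y)" by (simp add: y norm_self_adjoint_square[OF k])
      then have "(norm k)\<^sup>2 = 1" by (simp add: cstar_identity y1)
      then show ?thesis using power2_le_imp_le[of "norm k" 1] by simp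
    qed
    from complementary_root[OF k nk] obtain b where b: "b\<^sup>\<star> = b" "k * k + b * b = 1" "norm b \<le> 1"
      "norm (k * b) \<le> 1/2" "k * b = b * k" by metis
    have bb: "1 - k * k = b * b" using b(2) by (simp add: algebra_simps)
    have "norm (y * (b * b)) \<ge> 1"
    proof -
      have "2 *\<^sub>R y - (1 *\<^sub>R 1 - y * y\<^sup>\<star>) * y = y + y * (y\<^sup>\<star> * y)"
        by (simp add: algebra_simps scaleR_2 mult.assoc)
      also have "\<dots> = y * (b * b)" by (simp add: y algebra_simps flip: bb)
      finally have e: "y * (b * b) = 2 *\<^sub>R y - (1 *\<^sub>R 1 - y * y\<^sup>\<star>) * y" by simp
      have "norm ((1 *\<^sub>R 1 - y * y\<^sup>\<star>) * y) \<le> 1"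
        using norm_mult_ineq[of "1 *\<^sub>R 1 - y * y\<^sup>\<star>" y] norm_diff_pos_le[OF P, of 1] nP y1 by simp
      then show ?thesis unfolding e using norm_triangle_ineq2[of "2 *\<^sub>R y" "(1 *\<^sub>R 1 - y * y\<^sup>\<star>) * y"] y1 by simp
    qed
    then have "1 \<le> (norm (y * (b * b)))\<^sup>2" by simp
    also have "\<dots> = norm ((y * (b * b))\<^sup>\<star> * (y * (b * b)))" by (simp only: cstar_identity)
    also have "(y * (b * b))\<^sup>\<star> * (y * (b * b)) = - ((b * (k * b)) * ((k * b) * b))"
    proof -
      have "(y * (b * b))\<^sup>\<star> * (y * (b * b)) = b * b * (y\<^sup>\<star> * y) * b * b" by (simp add: b(1) mult.assoc)
      also have "\<dots> = - (b * (b * k) * (k * b) * b)" by (simp only: y) (simp add: mult.assoc)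
      finally show ?thesis by (simp only: b(5)[symmetric]) (simp add: mult.assoc)
    qed
    also have "norm (- ((b * (k * b)) * ((k * b) * b))) \<le> (1/2) * (1/2)"
    proof -
      have "norm (b * (k * b)) \<le> 1 * (1/2)" "norm ((k * b) * b) \<le> (1/2) * 1"
        by (rule order_trans[OF norm_mult_ineq mult_mono]; use b in simp)+
      then show ?thesis
        using order_trans[OF norm_mult_ineq mult_mono[of "norm (b * (k * b))" "1/2" "norm ((k * b) * b)" "1/2"]] by simp
    qed
    finally show False by simp
  qed
  show ?thesis
  proof (rule ccontr)
    assume "y \<noteq> 0"
    define r where "r = 1 / norm y"
    have "(r *\<^sub>R y)\<^sup>\<star> * (r *\<^sub>R y) = - ((r *\<^sub>R k) * (r *\<^sub>R k))" using y by simp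
    moreover have "(r *\<^sub>R k)\<^sup>\<star> = r *\<^sub>R k" using k by simp
    moreover have "norm (r *\<^sub>R y) = 1" using \<open>y \<noteq> 0\<close> by (simp add: r_def)
    ultimately show False by (rule normed)
  qed
qed

lemma self_adjoint_cube_eq_0:
  assumes "n\<^sup>\<star> = n" "n * (n * n) = 0" shows "n = 0"
proof -
  have "(n * n)\<^sup>\<star> * (n * n) = 0" using assms by (simp add: mult.assoc)
  then have "n * n = 0" by (simp only: dag_mult_eq_0_iff)
  with assms(1) show ?thesis by (rule self_adjoint_square_eq_0)
qed

text \<open>
  \<open>s\<close> is the absolute value of \<open>b\<close>, and \<open>n\<close> is twice its negative part.
\<close>

lemma absolute_value:
  assumes "b\<^sup>\<star> = b"
  obtains s n where "pos s" "s * s = b * b" "n = s - b" "n\<^sup>\<star> = n" "s * b = b * s" "s * n = n * s"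
    "n * b = - (s * n)" "n * n = 2 *\<^sub>R (s * n)"
    "\<And>c. c * b = b * c \<Longrightarrow> c * s = s * c" "\<And>c. c * b = b * c \<Longrightarrow> c * n = n * c"
proof -
  from pos_sqrt[OF pos_square[OF assms]] obtain s where s: "pos s" "s * s = b * b"
    "\<And>c. c * (b * b) = (b * b) * c \<Longrightarrow> c * s = s * c" by metis
  have sb: "s * b = b * s" using s(3)[of b] by (simp add: mult.assoc)
  have c: "c * s = s * c" if "c * b = b * c" for c
    by (rule s(3)) (metis that mult.assoc)
  show ?thesis
  proof (rule that[of s "s - b"])
    show "c * (s - b) = (s - b) * c" if "c * b = b * c" for c
      using c[OF that] that by (simp add: algebra_simps)
    show "(s - b)\<^sup>\<star> = s - b" by (simp add: assms pos_dag[OF s(1)])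
    show "s * (s - b) = (s - b) * s" "(s - b) * b = - (s * (s - b))"
      using sb s(2) by (simp_all add: left_diff_distrib right_diff_distrib)
    show "(s - b) * (s - b) = 2 *\<^sub>R (s * (s - b))"
      using sb s(2) by (simp add: left_diff_distrib right_diff_distrib scaleR_2)
  qed (fact s(1) s(2) sb refl c)+
qed

text \<open>
  With \<open>n\<close> twice the negative part of \<open>b = c\<^sup>* c\<close>, the product \<open>(c n)\<^sup>* (c n) = n b n\<close> is minus a
  square; hence \<open>c n = 0\<close>, and then \<open>n = 0\<close>.
\<close>

lemma pos_dag_mult: "pos (c\<^sup>\<star> * c)"
proof -
  define b where "b = c\<^sup>\<star> * c"
  have "b\<^sup>\<star> = b" by (simp add: b_def)
  then obtain s n where s: "pos s" "n = s - b" "n\<^sup>\<star> = n" "s * n = n * s"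
    "n * b = - (s * n)" "n * n = 2 *\<^sub>R (s * n)" by (rule absolute_value)
  from pos_sqrt[OF s(1)] obtain h where h: "pos h" "h * h = s" "h * n = n * h" by (metis s(4))
  have hn: "(h * n)\<^sup>\<star> = h * n" by (simp add: h(3) s(3) pos_dag[OF h(1)])
  have "h * n * (h * n) = h * (n * h) * n" by (simp add: mult.assoc)
  also have "\<dots> = h * h * n * n" by (simp only: h(3)[symmetric] mult.assoc)
  also have "\<dots> = s * (n * n)" by (subst h(2)) (simp add: mult.assoc)
  finally have e: "(h * n) * (h * n) = s * (n * n)" .
  have "(c * n)\<^sup>\<star> * (c * n) = n * b * n" by (simp add: b_def s(3) mult.assoc)
  also have "\<dots> = - ((h * n) * (h * n))" by (simp only: e) (simp add: s(5) mult.assoc)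
  finally have "c * n = 0" using hn by (rule dag_mult_eq_minus_square)
  then have "n * b = 0" by (metis b_def mult.assoc mult_zero_right s(3,4,5) dag_mult dag_0 mult_zero_left)
  then have "s * n = 0" using s(5) by simp
  then have "n * n = 0" using s(6) by simp
  with s(3) have "n = 0" by (rule self_adjoint_square_eq_0)
  then show ?thesis using s(1,2) by (simp add: b_def)
qed

lemma pos_conj: "pos a \<Longrightarrow> pos (c\<^sup>\<star> * a * c)"
proof -
  assume "pos a"
  then obtain h where "h\<^sup>\<star> = h" "a = h * h" by (auto simp: pos_def)
  then show "pos (c\<^sup>\<star> * a * c)" using pos_dag_mult[of "h * c"] by (simp add: mult.assoc)
qed

lemma dag_mult_add_eq_0: "x\<^sup>\<star> * x + y\<^sup>\<star> * y = 0 \<Longrightarrow> x = 0"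
  using pos_add_eq_0[OF pos_dag_mult pos_dag_mult] dag_mult_eq_0_iff by metis

text \<open>
  From the equation, \<open>(y\<^sup>* y) K = - y\<^sup>* P y\<close> is self-adjoint, so \<open>y\<^sup>* y\<close> commutes with \<open>K\<close> and with a
  root \<open>k\<close> of it. Then \<open>(y k)\<^sup>* (y k)\<close> and \<open>y\<^sup>* P y\<close> are positive with sum zero.
\<close>

lemma sylvester:
  assumes P: "pos P" and K: "pos K" and e: "P * y = - (y * K)"
  shows "y * K = 0"
proof -
  from P obtain p where p: "p\<^sup>\<star> = p" "P = p * p" by (auto simp: pos_def)
  from K obtain k where k: "pos k" "k * k = K" "\<And>c. c * K = K * c \<Longrightarrow> c * k = k * c" using pos_sqrt[OF K] by blast
  define M where "M = y\<^sup>\<star> * y"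
  have MK: "M * K = - ((p * y)\<^sup>\<star> * (p * y))"
  proof -
    have "M * K = y\<^sup>\<star> * (y * K)" by (simp add: M_def mult.assoc)
    also have "y * K = - (P * y)" using e by simp
    finally show ?thesis by (simp add: p mult.assoc)
  qed
  then have "(M * K)\<^sup>\<star> = M * K" by simp
  then have "K * M = M * K" by (simp add: M_def pos_dag[OF K])
  then have "M * k = k * M" by (intro k(3)) simp
  then have "M * K = k * (M * k)" by (metis k(2) mult.assoc)
  then have "M * K = (y * k)\<^sup>\<star> * (y * k)" by (simp add: M_def pos_dag[OF k(1)] mult.assoc)
  with MK have "(y * k)\<^sup>\<star> * (y * k) + (p * y)\<^sup>\<star> * (p * y) = 0" by simp
  then have "y * k = 0" by (rule dag_mult_add_eq_0)
  then show ?thesis by (metis k(2) mult.assoc mult_zero_left)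
qed

text \<open>
  The difference \<open>y = b - s\<close> solves the Sylvester equation \<open>b y = - y s\<close>,
  whether or not \<open>b\<close> and \<open>s\<close> commute.
\<close>

lemma pos_sqrt_unique:
  assumes b: "pos b" and s: "pos s" and e: "b * b = s * s"
  shows "b = s"
proof -
  define y where "y = b - s"
  have y: "y\<^sup>\<star> = y" by (simp add: y_def b s pos_dag)
  have by': "b * y = - (y * s)" by (simp add: y_def e algebra_simps)
  from sylvester[OF b s this] have ys: "y * s = 0" .
  have sy: "s * y = 0" using arg_cong[OF ys, of dag] by (simp add: y pos_dag[OF s])
  have "y * y = b * y - s * y" by (simp add: y_def algebra_simps)
  also have "\<dots> = 0" by (simp add: by' ys sy)
  finally show ?thesis using self_adjoint_square_eq_0[OF y] by (simp add: y_def)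
qed

text \<open>
  The defect \<open>W = s z - c z s\<close> of the claim solves \<open>s W = - W (c s)\<close>.
\<close>

lemma pos_sqrt_twisted_commute:
  assumes s: "pos s" and c: "0 < c" and e: "s * s * z = c\<^sup>2 *\<^sub>R (z * (s * s))"
  shows "s * z = c *\<^sub>R (z * s)"
proof -
  define W where "W = s * z - c *\<^sub>R (z * s)"
  have "s * W = - (W * (c *\<^sub>R s))"
    using e by (simp add: W_def algebra_simps power2_eq_square)
  moreover from this have "W * (c *\<^sub>R s) = 0" using sylvester[OF s pos_scaleR[OF s], of c W] c by simp
  ultimately have sW: "s * W = 0" and Ws: "W * s = 0" using c by simp_all
  have "W\<^sup>\<star> * W = z\<^sup>\<star> * (s * W) - c *\<^sub>R (s * (z\<^sup>\<star> * W))"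
    by (subst W_def) (simp add: algebra_simps pos_dag[OF s] mult.assoc)
  then have WW: "W\<^sup>\<star> * W = - (c *\<^sub>R (s * (z\<^sup>\<star> * W)))" by (simp add: sW)
  have "W * (W\<^sup>\<star> * W) = - (c *\<^sub>R (W * s * (z\<^sup>\<star> * W)))" by (simp add: WW mult.assoc)
  then have "W * (W\<^sup>\<star> * W) = 0" by (simp add: Ws)
  then have "(W\<^sup>\<star> * W)\<^sup>\<star> * (W\<^sup>\<star> * W) = 0" by (simp add: mult.assoc)
  then have "W = 0" by (simp only: dag_mult_eq_0_iff)
  then show ?thesis by (simp add: W_def)
qed

text \<open>
  The element \<open>e = d - z z\<^sup>*\<close> satisfies \<open>e z = q z e\<close>, and so does twice its negative part \<open>n\<close>. With the
  positive elements \<open>A = n d n\<close> and \<open>B = n s n\<close>, where \<open>s\<close> is the absolute value of \<open>e\<close>, the relations give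
  \<open>(z n)\<^sup>* (z n) = A + q B\<close> and \<open>q\<^sup>2 (z n) (z n)\<^sup>* = A + B\<close>. Since both products have the same norm,
  \<open>\<parallel>A + B\<parallel> = q\<^sup>2 \<parallel>A + q B\<parallel> \<le> q\<^sup>2 \<parallel>A + B\<parallel>\<close>, and \<open>q < 1\<close> leaves only \<open>n = 0\<close>.
\<close>

lemma pos_defect_step:
  assumes d: "pos d" and dz: "d * z = z * d" and q: "0 < q" "q < 1"
    and r: "z\<^sup>\<star> * z = q *\<^sub>R (z * z\<^sup>\<star>) + (1 - q) *\<^sub>R d"
  shows "pos (d - z * z\<^sup>\<star>)"
proof -
  define e where "e = d - z * z\<^sup>\<star>"
  have es: "e\<^sup>\<star> = e" by (simp add: e_def pos_dag[OF d])
  have dz': "d * z\<^sup>\<star> = z\<^sup>\<star> * d" using arg_cong[OF dz, of dag] by (simp add: pos_dag[OF d])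
  have "e * z = d * z - z * (z\<^sup>\<star> * z)" by (simp add: e_def algebra_simps)
  also have "\<dots> = q *\<^sub>R (z * e)" by (simp add: e_def r dz algebra_simps)
  finally have ez: "e * z = q *\<^sub>R (z * e)" .
  have "d * (z * z\<^sup>\<star>) = (z * z\<^sup>\<star>) * d" by (metis dz dz' mult.assoc)
  then have de: "d * e = e * d" by (simp add: e_def algebra_simps)
  from es obtain s n where s: "pos s" "s * s = e * e" "n = s - e" "n\<^sup>\<star> = n" "s * n = n * s"
    "n * e = - (s * n)" "n * n = 2 *\<^sub>R (s * n)" "\<And>c. c * e = e * c \<Longrightarrow> c * n = n * c"
    by (rule absolute_value) metis
  have dn: "d * n = n * d" by (rule s(8)[OF de])
  have "s * s * z = q\<^sup>2 *\<^sub>R (z * (s * s))"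
  proof -
    have "e * e * z = e * (e * z)" by (simp add: mult.assoc)
    also have "\<dots> = q *\<^sub>R (e * z * e)" by (subst ez) (simp add: mult.assoc)
    also have "\<dots> = q\<^sup>2 *\<^sub>R (z * (e * e))" by (simp only: ez) (simp add: power2_eq_square mult.assoc)
    finally show ?thesis by (simp add: s(2))
  qed
  from pos_sqrt_twisted_commute[OF s(1) q(1) this] have "s * z = q *\<^sub>R (z * s)" .
  with ez have nz: "n * z = q *\<^sub>R (z * n)" by (simp add: s(3) algebra_simps)
  have zn: "z\<^sup>\<star> * n = q *\<^sub>R (n * z\<^sup>\<star>)"
    using arg_cong[OF nz, of dag] by (simp only: dag_mult dag_scaleR s(4))
  have nsn: "s * (n * n) = n * (s * n)" using s(5) by (metis mult.assoc)
  define A where "A = n * d * n"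
  define B where "B = n * s * n"
  have A: "pos A" using pos_conj[OF d, of n] by (simp add: A_def s(4))
  have B: "pos B" using pos_conj[OF s(1), of n] by (simp add: B_def s(4))
  have "q\<^sup>2 *\<^sub>R ((z * n) * (z * n)\<^sup>\<star>) = n * (z * z\<^sup>\<star>) * n"
  proof -
    have "n * (z * z\<^sup>\<star>) * n = (n * z) * (z\<^sup>\<star> * n)" by (simp add: mult.assoc)
    also have "\<dots> = q\<^sup>2 *\<^sub>R (z * n * (n * z\<^sup>\<star>))" by (simp only: nz zn) (simp add: power2_eq_square)
    finally show ?thesis by (simp add: s(4))
  qed
  also have "z * z\<^sup>\<star> = d - e" by (simp add: e_def)
  also have "n * (d - e) * n = A + B" by (simp add: A_def B_def algebra_simps s(6)) (rule nsn)
  finally have YY: "A + B = q\<^sup>2 *\<^sub>R ((z * n) * (z * n)\<^sup>\<star>)" by simp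
  have "(z * n)\<^sup>\<star> * (z * n) = n * (z\<^sup>\<star> * z) * n" by (simp add: s(4) mult.assoc)
  also have "z\<^sup>\<star> * z = d - q *\<^sub>R e" by (simp add: r e_def algebra_simps)
  also have "n * (d - q *\<^sub>R e) * n = A + q *\<^sub>R B" by (simp add: A_def B_def algebra_simps s(6)) (simp add: nsn)
  finally have YY': "(z * n)\<^sup>\<star> * (z * n) = A + q *\<^sub>R B" .
  have "norm (A + B) = q\<^sup>2 * norm (A + q *\<^sub>R B)"
    unfolding YY YY'[symmetric] using cstar_identity[of "z * n"] cstar_identity[of "(z * n)\<^sup>\<star>"] 
    by (simp only: norm_scaleR dag_dag norm_dag) simp
  also have "\<dots> \<le> q\<^sup>2 * norm (A + B)"
  proof -
    have "norm (A + q *\<^sub>R B) \<le> norm (A + q *\<^sub>R B + (1 - q) *\<^sub>R B)"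
      using q A B by (intro norm_pos_mono pos_add pos_scaleR) auto
    then have "norm (A + q *\<^sub>R B) \<le> norm (A + B)" by (simp add: algebra_simps)
    then show ?thesis by (rule mult_left_mono) simp
  qed
  finally have "(1 - q\<^sup>2) * norm (A + B) \<le> 0" by (simp add: algebra_simps)
  moreover have "0 < 1 - q\<^sup>2" using q by (simp add: power_less_one_iff)
  ultimately have "A + B = 0" by (simp add: mult_le_0_iff)
  then have "B = 0" using pos_add_eq_0[OF B A] by (simp add: add.commute)
  then have "n * (n * n) = 0" by (simp add: s(7) B_def mult.assoc)
  with s(4) have "n = 0" by (rule self_adjoint_cube_eq_0)
  then show ?thesis using s(1,3) by (simp add: e_def)
qed

section \<open>Closed ideals\<close>

text \<open>
  \<open>1 + P = (1 + \<parallel>P\<parallel>) (1 - X)\<close> with \<open>\<parallel>X\<parallel> \<le> \<parallel>P\<parallel> / (1 + \<parallel>P\<parallel>) < 1\<close>; the Neumann series of \<open>X\<close>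
  enters as a fixed point of \<open>y \<mapsto> 1 + X y\<close>.
\<close>

lemma inverse_one_plus_pos:
  assumes P: "pos P"
  obtains m where "m\<^sup>\<star> = m" "m * (1 + P) = 1" "(1 + P) * m = 1" "norm m \<le> 1"
proof -
  define c where "c = norm P / (1 + norm P)"
  define X where "X = (1 / (1 + norm P)) *\<^sub>R (norm P *\<^sub>R 1 - P)"
  have p: "0 < 1 + norm P" by (simp add: add_pos_nonneg)
  have c: "0 \<le> c" "c < 1" using p by (simp_all add: c_def)
  have X: "norm X \<le> c" using norm_diff_pos_le[OF P order_refl] p by (simp add: X_def c_def divide_right_mono)
  have "(1 + norm P) *\<^sub>R X = norm P *\<^sub>R 1 - P" using p by (simp add: X_def)
  then have X1: "1 + P = (1 + norm P) *\<^sub>R (1 - X)" by (simp add: scaleR_diff_right scaleR_add_left)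
  have "\<exists>!y. 1 + X * y = y"
    using c by (rule banach_fix_type)
      (auto simp: dist_norm simp flip: right_diff_distrib intro!: order_trans[OF norm_mult_ineq] mult_right_mono X)
  then obtain y where y: "1 + X * y = y" by auto
  have Xs: "X\<^sup>\<star> = X" by (simp add: X_def pos_dag[OF P])
  have y1: "(1 - X) * y = 1" using y by (simp add: algebra_simps)
  have y2: "y\<^sup>\<star> * (1 - X) = 1" using arg_cong[OF y1, of dag] by (simp add: Xs)
  have ys: "y\<^sup>\<star> = y" by (metis y1 y2 mult.assoc mult_1_left mult_1_right)
  have "norm y \<le> 1 + c * norm y"
  proof -
    have "norm y = norm (1 + X * y)" by (simp add: y)
    also have "\<dots> \<le> 1 + c * norm y"
      by (rule norm_triangle_mono[OF norm_one_le order_trans[OF norm_mult_ineq mult_right_mono[OF X norm_ge_zero]]])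
    finally show ?thesis .
  qed
  then have "norm y * (1 - c) \<le> 1" by (simp add: algebra_simps)
  moreover have "1 - c = 1 / (1 + norm P)" using p by (simp add: c_def field_simps)
  ultimately have ny: "norm y \<le> 1 + norm P" using p by (simp add: field_simps)
  show ?thesis
  proof (rule that[of "(1 / (1 + norm P)) *\<^sub>R y"])
    show "norm ((1 / (1 + norm P)) *\<^sub>R y) \<le> 1" using ny p by simp
    show "(1 / (1 + norm P)) *\<^sub>R y * (1 + P) = 1" "(1 + P) * (1 / (1 + norm P)) *\<^sub>R y = 1"
      using p y1 y2 by (simp_all add: X1 ys)
  qed (simp add: ys)
qed

text \<open>
  An ideal of the corner of a central projection is an ideal of the whole algebra, so this covers the ideals
  of corners as well.
\<close>

definition closed_ideal_of :: "'a::unital_cstar set \<Rightarrow> bool"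
  where "closed_ideal_of I \<longleftrightarrow> closed I \<and> 0 \<in> I \<and> (\<forall>a\<in>I. \<forall>b\<in>I. a + b \<in> I) \<and>
    (\<forall>a\<in>I. \<forall>x. x * a \<in> I \<and> a * x \<in> I)"

lemma closed_ideal_ofD:
  assumes "closed_ideal_of I"
  shows "closed I" "0 \<in> I" "a \<in> I \<Longrightarrow> b \<in> I \<Longrightarrow> a + b \<in> I" "a \<in> I \<Longrightarrow> x * a \<in> I" "a \<in> I \<Longrightarrow> a * x \<in> I"
    "a \<in> I \<Longrightarrow> - a \<in> I" "a \<in> I \<Longrightarrow> b \<in> I \<Longrightarrow> a - b \<in> I" "a \<in> I \<Longrightarrow> c *\<^sub>C a \<in> I" "a \<in> I \<Longrightarrow> r *\<^sub>R a \<in> I"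
proof -
  note I = assms[unfolded closed_ideal_of_def]
  show *: "closed I" "0 \<in> I" "a \<in> I \<Longrightarrow> b \<in> I \<Longrightarrow> a + b \<in> I" "a \<in> I \<Longrightarrow> x * a \<in> I" "a \<in> I \<Longrightarrow> a * x \<in> I" for a b x
    using I by auto
  show m: "a \<in> I \<Longrightarrow> - a \<in> I" for a using *(4)[of a "-1"] by simp
  show "a \<in> I \<Longrightarrow> b \<in> I \<Longrightarrow> a - b \<in> I" using *(3)[of a "-b"] m by simp
  show "a \<in> I \<Longrightarrow> c *\<^sub>C a \<in> I" using *(4)[of a "c *\<^sub>C 1"] by simp
  show "a \<in> I \<Longrightarrow> r *\<^sub>R a \<in> I" using *(4)[of a "r *\<^sub>R 1"] by simp
qed

text \<open>
  \<open>m = (1 + r y\<^sup>* y)\<^sup>-\<^sup>1\<close> for large \<open>r\<close> is congruent to 1 modulo \<open>I\<close> and almost annihilates \<open>y\<close>, since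
  \<open>r (y m)\<^sup>* (y m) = m (1 - m)\<close> is bounded. It takes the place of an approximate unit.
\<close>

lemma ideal_cutoff:
  assumes I: "closed_ideal_of I" and y: "y \<in> I" and \<epsilon>: "0 < \<epsilon>"
  obtains m where "m\<^sup>\<star> = m" "norm m \<le> 1" "norm (y * m) \<le> \<epsilon>" "1 - m \<in> I"
proof -
  define P where "P = y\<^sup>\<star> * y"
  define r where "r = 2 / \<epsilon>\<^sup>2"
  have r: "0 < r" using \<epsilon> by (simp add: r_def)
  have "pos (r *\<^sub>R P)" using r by (simp add: P_def pos_scaleR pos_dag_mult)
  then obtain m where m: "m\<^sup>\<star> = m" "m * (1 + r *\<^sub>R P) = 1" "(1 + r *\<^sub>R P) * m = 1" "norm m \<le> 1"
    by (rule inverse_one_plus_pos)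
  have m1: "1 - m = r *\<^sub>R (P * m)" using m(3) by (simp add: algebra_simps)
  have PI: "P * m \<in> I" using closed_ideal_ofD(4,5)[OF I] y by (simp add: P_def)
  have n1: "norm (1 - m) \<le> 2" using norm_triangle_ineq4[of 1 m] norm_one_le[where 'a='a] m(4) by linarith
  have "r *\<^sub>R ((y * m)\<^sup>\<star> * (y * m)) = m * (1 - m)" by (simp add: m1 P_def m(1) mult.assoc)
  then have "norm (r *\<^sub>R ((y * m)\<^sup>\<star> * (y * m))) \<le> 2"
    using order_trans[OF norm_mult_ineq mult_mono[OF m(4) n1]] by simp
  then have "r * (norm (y * m))\<^sup>2 \<le> 2" using r by (simp only: norm_scaleR cstar_identity abs_of_pos)
  then have "(norm (y * m))\<^sup>2 \<le> \<epsilon>\<^sup>2" using \<epsilon> by (simp add: r_def field_simps)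
  then have "norm (y * m) \<le> \<epsilon>" using \<epsilon> power2_le_imp_le by fastforce
  moreover have "1 - m \<in> I" unfolding m1 using PI by (rule closed_ideal_ofD(9)[OF I])
  ultimately show ?thesis using that m by blast
qed

text \<open>
  If \<open>m\<close> is a cutoff for \<open>x\<^sup>* x\<close>, then \<open>x m\<close> is small, and \<open>x - x m \<in> I\<close>.
\<close>

lemma closed_ideal_of_dag_mult:
  assumes I: "closed_ideal_of I" and x: "x\<^sup>\<star> * x \<in> I"
  shows "x \<in> I"
proof -
  have "\<exists>z\<in>I. dist z x < e" if e: "0 < e" for e
  proof -
    obtain m where m: "m\<^sup>\<star> = m" "norm m \<le> 1" "norm (x\<^sup>\<star> * x * m) \<le> e\<^sup>2 / 2" "1 - m \<in> I"
      using ideal_cutoff[OF I x, of "e\<^sup>2 / 2"] e by auto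
    have "(norm (x * m))\<^sup>2 = norm (m * (x\<^sup>\<star> * x * m))" using cstar_identity[of "x * m"] by (simp add: m(1) mult.assoc)
    also have "\<dots> \<le> 1 * (e\<^sup>2 / 2)" by (rule order_trans[OF norm_mult_ineq mult_mono]) (use m in auto)
    finally have "(norm (x * m))\<^sup>2 \<le> e\<^sup>2 / 2" by simp
    also have "\<dots> < e\<^sup>2" using e by simp
    finally have "norm (x * m) < e" using e power_less_imp_less_base[of "norm (x * m)" 2 e] by simp
    moreover have "x * (1 - m) \<in> I" using m(4) by (rule closed_ideal_ofD(4)[OF I])
    ultimately show ?thesis by (intro bexI[of _ "x * (1 - m)"]) (auto simp: dist_norm algebra_simps)
  qed
  then have "x \<in> closure I" by (simp add: closure_approachable)
  then show ?thesis using closed_ideal_ofD(1)[OF I] by simp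
qed

section \<open>C*-algebras as records\<close>

locale cstar_record = ring A for A :: "'a cstar" (structure) +
  assumes smult_closed: "x \<in> carrier A \<Longrightarrow> c \<odot> x \<in> carrier A"
    and smult_add_right: "\<lbrakk>x \<in> carrier A; y \<in> carrier A\<rbrakk> \<Longrightarrow> c \<odot> (x \<oplus> y) = c \<odot> x \<oplus> c \<odot> y"
    and smult_add_left: "x \<in> carrier A \<Longrightarrow> (c + d) \<odot> x = c \<odot> x \<oplus> d \<odot> x"
    and smult_smult: "x \<in> carrier A \<Longrightarrow> c \<odot> (d \<odot> x) = (c * d) \<odot> x"
    and smult_one: "x \<in> carrier A \<Longrightarrow> 1 \<odot> x = x"
    and smult_mult_left: "\<lbrakk>x \<in> carrier A; y \<in> carrier A\<rbrakk> \<Longrightarrow> (c \<odot> x) \<otimes> y = c \<odot> (x \<otimes> y)"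
    and smult_mult_right: "\<lbrakk>x \<in> carrier A; y \<in> carrier A\<rbrakk> \<Longrightarrow> x \<otimes> (c \<odot> y) = c \<odot> (x \<otimes> y)"
    and star_closed: "x \<in> carrier A \<Longrightarrow> star A x \<in> carrier A"
    and star_add: "\<lbrakk>x \<in> carrier A; y \<in> carrier A\<rbrakk> \<Longrightarrow> star A (x \<oplus> y) = star A x \<oplus> star A y"
    and star_mult: "\<lbrakk>x \<in> carrier A; y \<in> carrier A\<rbrakk> \<Longrightarrow> star A (x \<otimes> y) = star A y \<otimes> star A x"
    and star_smult: "x \<in> carrier A \<Longrightarrow> star A (c \<odot> x) = cnj c \<odot> star A x"
    and star_star: "x \<in> carrier A \<Longrightarrow> star A (star A x) = x"
    and cnorm_eq_0: "x \<in> carrier A \<Longrightarrow> cnorm A x = 0 \<Longrightarrow> x = \<zero>"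
    and cnorm_nonneg: "x \<in> carrier A \<Longrightarrow> 0 \<le> cnorm A x"
    and cnorm_triangle: "\<lbrakk>x \<in> carrier A; y \<in> carrier A\<rbrakk> \<Longrightarrow> cnorm A (x \<oplus> y) \<le> cnorm A x + cnorm A y"
    and cnorm_smult: "x \<in> carrier A \<Longrightarrow> cnorm A (c \<odot> x) = cmod c * cnorm A x"
    and cnorm_mult: "\<lbrakk>x \<in> carrier A; y \<in> carrier A\<rbrakk> \<Longrightarrow> cnorm A (x \<otimes> y) \<le> cnorm A x * cnorm A y"
    and cnorm_star_mult: "x \<in> carrier A \<Longrightarrow> cnorm A (star A x \<otimes> x) = (cnorm A x)\<^sup>2"
    and cnorm_complete: "\<lbrakk>range s \<subseteq> carrier A; \<And>\<epsilon>. 0 < \<epsilon> \<Longrightarrow> \<exists>N. \<forall>k\<ge>N. \<forall>l\<ge>N. cnorm A (s k \<ominus> s l) < \<epsilon>\<rbrakk>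
      \<Longrightarrow> \<exists>a\<in>carrier A. (\<lambda>k::nat. cnorm A (s k \<ominus> a)) \<longlonglongrightarrow> 0"
begin

lemma smult_0: "x \<in> carrier A \<Longrightarrow> 0 \<odot> x = \<zero>"
  using smult_add_left[of x 0 0] smult_closed[of x 0] by (simp add: add.r_cancel_one')

lemma smult_zero: "c \<odot> \<zero> = \<zero>"
  using smult_add_right[of \<zero> \<zero> c] smult_closed[of \<zero> c] by (simp add: add.r_cancel_one')

lemma smult_minus_one: "x \<in> carrier A \<Longrightarrow> (-1) \<odot> x = \<ominus> x"
  using smult_add_left[of x "-1" 1] smult_closed[of x "-1"]
  by (simp add: smult_0 smult_one minus_equality)

lemma cnorm_zero: "cnorm A \<zero> = 0"
  using cnorm_smult[of \<zero> 0] by (simp add: smult_zero)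

lemma cnorm_minus: "x \<in> carrier A \<Longrightarrow> cnorm A (\<ominus> x) = cnorm A x"
  using cnorm_smult[of x "-1"] by (simp add: smult_minus_one)

lemma star_zero: "star A \<zero> = \<zero>"
  using star_smult[of \<zero> 0] star_closed[of \<zero>] by (simp add: smult_zero smult_0)

lemma cnorm_diff_le: "x \<in> carrier A \<Longrightarrow> y \<in> carrier A \<Longrightarrow> cnorm A x \<le> cnorm A (x \<ominus> y) + cnorm A y"
  using cnorm_triangle[of "x \<ominus> y" y] by (simp add: minus_eq a_assoc l_neg)

lemma cnorm_diff_commute: "x \<in> carrier A \<Longrightarrow> y \<in> carrier A \<Longrightarrow> cnorm A (x \<ominus> y) = cnorm A (y \<ominus> x)"
  using cnorm_minus[of "x \<ominus> y"] by (simp add: minus_eq minus_add a_comm)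

lemma cnorm_one_le: "cnorm A \<one> \<le> 1"
proof -
  have "star A \<one> = \<one>" using star_mult[of \<one> "star A \<one>"] star_closed[of \<one>] star_star[of \<one>]
    by (metis l_one one_closed r_one)
  then have "cnorm A \<one> * (cnorm A \<one> - 1) = 0"
    using cnorm_star_mult[of \<one>] by (simp add: power2_eq_square algebra_simps)
  then show ?thesis by auto
qed

end

section \<open>The algebra of bounded families\<close>

text \<open>
  One type for all C*-algebras carried by \<open>'a\<close>: the bounded families of elements,
  one from each of them. It is a C*-algebra itself, with the supremum norm, and each
  C*-algebra on \<open>'a\<close> is the corner cut out by a central projection.
\<close>

definition bounded_families :: "('a cstar \<Rightarrow> 'a) set"
  where "bounded_families = {f. (\<forall>A. \<not> cstar_record A \<longrightarrow> f A = undefined) \<and>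
    (\<forall>A. cstar_record A \<longrightarrow> f A \<in> carrier A) \<and> (\<exists>M. \<forall>A. cstar_record A \<longrightarrow> cnorm A (f A) \<le> M)}"

lemma zero_in_bounded_families:
  "(\<lambda>A. if cstar_record A then \<zero>\<^bsub>A\<^esub> else undefined) \<in> (bounded_families :: ('a cstar \<Rightarrow> 'a) set)"
proof -
  have "cnorm A \<zero>\<^bsub>A\<^esub> \<le> 0" "\<zero>\<^bsub>A\<^esub> \<in> carrier A" if "cstar_record A" for A :: "'a cstar"
  proof -
    interpret cstar_record A by (fact that)
    show "cnorm A \<zero>\<^bsub>A\<^esub> \<le> 0" "\<zero>\<^bsub>A\<^esub> \<in> carrier A" by (simp_all add: cnorm_zero)
  qed
  then show ?thesis by (auto simp: bounded_families_def intro!: exI[of _ 0])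
qed

typedef 'a family = "bounded_families :: ('a cstar \<Rightarrow> 'a) set" morphisms component Family
  using zero_in_bounded_families by blast

definition family :: "('a cstar \<Rightarrow> 'a) \<Rightarrow> 'a family"
  where "family f = Family (\<lambda>A. if cstar_record A then f A else undefined)"

lemma component_family:
  assumes "\<And>A. cstar_record A \<Longrightarrow> f A \<in> carrier A \<and> cnorm A (f A) \<le> M" and "cstar_record A"
  shows "component (family f) A = f A"
proof -
  have "(\<lambda>A. if cstar_record A then f A else undefined) \<in> bounded_families"
    using assms(1) by (auto simp: bounded_families_def)
  then show ?thesis using assms(2) by (simp add: family_def Family_inverse)
qed

lemma component_closed: "cstar_record A \<Longrightarrow> component x A \<in> carrier A"
  using component[of x] by (simp add: bounded_families_def)

lemma component_bounded: "\<exists>M. \<forall>A. cstar_record A \<longrightarrow> cnorm A (component x A) \<le> M"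
  using component[of x] by (simp add: bounded_families_def)

lemma family_eqI:
  assumes "\<And>A. cstar_record A \<Longrightarrow> component x A = component y A" shows "x = y"
proof -
  have "component x A = component y A" for A
    using assms component[of x] component[of y] by (cases "cstar_record A") (simp_all add: bounded_families_def)
  then show ?thesis by (simp add: component_inject[symmetric] fun_eq_iff)
qed

text \<open>The operation that multiplies every component by the number \<open>c\<close> serves the real and the
  complex structure alike.\<close>

definition family_scale :: "complex \<Rightarrow> 'a family \<Rightarrow> 'a family"
  where "family_scale c x = family (\<lambda>A. c \<odot>\<^bsub>A\<^esub> component x A)"

instantiation family :: (type) "{real_normed_algebra, monoid_mult}"
begin

definition norm_family :: "'a family \<Rightarrow> real"
  where "norm x = Sup (insert 0 {cnorm A (component x A) | A. cstar_record A})"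

definition zero_family :: "'a family"
  where "0 = family (\<lambda>A. \<zero>\<^bsub>A\<^esub>)"

definition one_family :: "'a family"
  where "1 = family (\<lambda>A. \<one>\<^bsub>A\<^esub>)"

definition plus_family :: "'a family \<Rightarrow> 'a family \<Rightarrow> 'a family"
  where "x + y = family (\<lambda>A. component x A \<oplus>\<^bsub>A\<^esub> component y A)"

definition times_family :: "'a family \<Rightarrow> 'a family \<Rightarrow> 'a family"
  where "x * y = family (\<lambda>A. component x A \<otimes>\<^bsub>A\<^esub> component y A)"

definition scaleR_family :: "real \<Rightarrow> 'a family \<Rightarrow> 'a family"
  where "r *\<^sub>R x = family_scale (complex_of_real r) x"

definition uminus_family :: "'a family \<Rightarrow> 'a family"
  where "- x = family_scale (-1) x"

definition minus_family :: "'a family \<Rightarrow> 'a family \<Rightarrow> 'a family"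
  where "x - y = x + - (y::'a family)"

definition dist_family :: "'a family \<Rightarrow> 'a family \<Rightarrow> real"
  where "dist x y = norm (x - y :: 'a family)"

definition sgn_family :: "'a family \<Rightarrow> 'a family"
  where "sgn x = inverse (norm x) *\<^sub>R (x::'a family)"

definition uniformity_family :: "('a family \<times> 'a family) filter"
  where "uniformity = (INF e\<in>{0<..}. principal {(x, y). dist x (y::'a family) < e})"

definition open_family :: "'a family set \<Rightarrow> bool"
  where "open U = (\<forall>x\<in>U. \<forall>\<^sub>F (x', y) in uniformity. x' = x \<longrightarrow> (y::'a family) \<in> U)"

lemma cnorm_component_le: 
  assumes "cstar_record A" shows "cnorm A (component x A) \<le> norm x"
proof -
  obtain M where "\<And>A. cstar_record A \<Longrightarrow> cnorm A (component x A) \<le> M" using component_bounded[of x] by auto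
  then have "bdd_above (insert 0 {cnorm A (component x A) | A. cstar_record A})"
    by (auto intro!: bdd_aboveI[of _ M])
  then show ?thesis unfolding norm_family_def using assms by (intro cSup_upper) auto
qed

lemma norm_family_ge_0: "0 \<le> norm (x :: 'a family)"
proof -
  obtain M where "\<And>A. cstar_record A \<Longrightarrow> cnorm A (component x A) \<le> M" using component_bounded[of x] by auto
  then have "bdd_above (insert 0 {cnorm A (component x A) | A. cstar_record A})"
    by (auto intro!: bdd_aboveI[of _ M])
  then show ?thesis unfolding norm_family_def by (intro cSup_upper) auto
qed

lemma norm_family_le:
  "0 \<le> M \<Longrightarrow> (\<And>A. cstar_record A \<Longrightarrow> cnorm A (component x A) \<le> M) \<Longrightarrow> norm x \<le> M"
  unfolding norm_family_def by (rule cSup_least) auto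

lemma component_simps:
  assumes "cstar_record A"
  shows "component 0 A = \<zero>\<^bsub>A\<^esub>" "component 1 A = \<one>\<^bsub>A\<^esub>"
    "component (x + y) A = component x A \<oplus>\<^bsub>A\<^esub> component y A"
    "component (x * y) A = component x A \<otimes>\<^bsub>A\<^esub> component y A"
    "component (family_scale c x) A = c \<odot>\<^bsub>A\<^esub> component x A"
    "component (r *\<^sub>R x) A = complex_of_real r \<odot>\<^bsub>A\<^esub> component x A"
    "component (- x) A = \<ominus>\<^bsub>A\<^esub> component x A"
    "component (x - y) A = component x A \<ominus>\<^bsub>A\<^esub> component y A"
proof -
  have cn: "cnorm B (component x B) \<le> norm x" "cnorm B (component y B) \<le> norm y" if "cstar_record B" for B
    using that by (rule cnorm_component_le)+
  have cl: "component x B \<in> carrier B" "component y B \<in> carrier B" if "cstar_record B" for B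
    using that by (rule component_closed)+
  show "component 0 A = \<zero>\<^bsub>A\<^esub>" unfolding zero_family_def
  proof (rule component_family[OF _ assms])
    fix B :: "'a cstar" assume "cstar_record B" then interpret cstar_record B .
    show "\<zero>\<^bsub>B\<^esub> \<in> carrier B \<and> cnorm B \<zero>\<^bsub>B\<^esub> \<le> 0" by (simp add: cnorm_zero)
  qed
  show "component 1 A = \<one>\<^bsub>A\<^esub>" unfolding one_family_def
  proof (rule component_family[OF _ assms])
    fix B :: "'a cstar" assume "cstar_record B" then interpret cstar_record B .
    show "\<one>\<^bsub>B\<^esub> \<in> carrier B \<and> cnorm B \<one>\<^bsub>B\<^esub> \<le> 1" by (simp add: cnorm_one_le)
  qed
  have p: "component (x + y) A = component x A \<oplus>\<^bsub>A\<^esub> component y A"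
    if "cstar_record A" for A and x y :: "'a family" unfolding plus_family_def
  proof (rule component_family[OF _ that])
    fix B :: "'a cstar" assume B: "cstar_record B" then interpret cstar_record B .
    show "component x B \<oplus>\<^bsub>B\<^esub> component y B \<in> carrier B \<and> cnorm B (component x B \<oplus>\<^bsub>B\<^esub> component y B) \<le> norm x + norm y"
      using cnorm_triangle component_closed[OF B, of x] component_closed[OF B, of y]
       cnorm_component_le[OF B, of x] cnorm_component_le[OF B, of y] by force
  qed
  show "component (x + y) A = component x A \<oplus>\<^bsub>A\<^esub> component y A" by (rule p[OF assms])
  show "component (x * y) A = component x A \<otimes>\<^bsub>A\<^esub> component y A" unfolding times_family_def
  proof (rule component_family[OF _ assms])
    fix B :: "'a cstar" assume B: "cstar_record B" then interpret cstar_record B .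
    show "component x B \<otimes>\<^bsub>B\<^esub> component y B \<in> carrier B \<and> cnorm B (component x B \<otimes>\<^bsub>B\<^esub> component y B) \<le> norm x * norm y"
      using cl[OF B] cn[OF B] cnorm_nonneg norm_family_ge_0
      by (auto intro!: order_trans[OF cnorm_mult mult_mono])
  qed
  have s: "component (family_scale c x) A = c \<odot>\<^bsub>A\<^esub> component x A"
    if "cstar_record A" for A c and x :: "'a family" unfolding family_scale_def
  proof (rule component_family[OF _ that])
    fix B :: "'a cstar" assume B: "cstar_record B" then interpret cstar_record B .
    show "c \<odot>\<^bsub>B\<^esub> component x B \<in> carrier B \<and> cnorm B (c \<odot>\<^bsub>B\<^esub> component x B) \<le> cmod c * norm x"
      using component_closed[OF B] cnorm_component_le[OF B]
      by (auto simp: smult_closed cnorm_smult mult_left_mono)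
  qed
  show "component (family_scale c x) A = c \<odot>\<^bsub>A\<^esub> component x A" by (rule s[OF assms])
  show "component (r *\<^sub>R x) A = complex_of_real r \<odot>\<^bsub>A\<^esub> component x A"
    by (simp add: scaleR_family_def s[OF assms])
  show m: "component (- x) A = \<ominus>\<^bsub>A\<^esub> component x A" for x
    using cstar_record.smult_minus_one[OF assms component_closed[OF assms]]
    by (simp add: uminus_family_def s[OF assms])
  show "component (x - y) A = component x A \<ominus>\<^bsub>A\<^esub> component y A"
    by (simp add: minus_family_def p[OF assms] m a_minus_def)
qed

lemma record_rules:
  assumes "cstar_record A"
  shows "\<And>x y. x \<in> carrier A \<Longrightarrow> y \<in> carrier A \<Longrightarrow> x \<oplus>\<^bsub>A\<^esub> y \<in> carrier A"
    "\<And>x y. x \<in> carrier A \<Longrightarrow> y \<in> carrier A \<Longrightarrow> x \<otimes>\<^bsub>A\<^esub> y \<in> carrier A"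
    "\<And>x. x \<in> carrier A \<Longrightarrow> \<ominus>\<^bsub>A\<^esub> x \<in> carrier A"
    "\<And>x y. x \<in> carrier A \<Longrightarrow> y \<in> carrier A \<Longrightarrow> x \<ominus>\<^bsub>A\<^esub> y \<in> carrier A"
    "\<zero>\<^bsub>A\<^esub> \<in> carrier A" "\<one>\<^bsub>A\<^esub> \<in> carrier A"
    "\<And>x y z. x \<in> carrier A \<Longrightarrow> y \<in> carrier A \<Longrightarrow> z \<in> carrier A \<Longrightarrow> x \<oplus>\<^bsub>A\<^esub> y \<oplus>\<^bsub>A\<^esub> z = x \<oplus>\<^bsub>A\<^esub> (y \<oplus>\<^bsub>A\<^esub> z)"
    "\<And>x y z. x \<in> carrier A \<Longrightarrow> y \<in> carrier A \<Longrightarrow> z \<in> carrier A \<Longrightarrow> x \<otimes>\<^bsub>A\<^esub> y \<otimes>\<^bsub>A\<^esub> z = x \<otimes>\<^bsub>A\<^esub> (y \<otimes>\<^bsub>A\<^esub> z)"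
    "\<And>x y z. x \<in> carrier A \<Longrightarrow> y \<in> carrier A \<Longrightarrow> z \<in> carrier A \<Longrightarrow> (x \<oplus>\<^bsub>A\<^esub> y) \<otimes>\<^bsub>A\<^esub> z = x \<otimes>\<^bsub>A\<^esub> z \<oplus>\<^bsub>A\<^esub> y \<otimes>\<^bsub>A\<^esub> z"
    "\<And>x y z. x \<in> carrier A \<Longrightarrow> y \<in> carrier A \<Longrightarrow> z \<in> carrier A \<Longrightarrow> z \<otimes>\<^bsub>A\<^esub> (x \<oplus>\<^bsub>A\<^esub> y) = z \<otimes>\<^bsub>A\<^esub> x \<oplus>\<^bsub>A\<^esub> z \<otimes>\<^bsub>A\<^esub> y"
    "\<And>x. x \<in> carrier A \<Longrightarrow> \<zero>\<^bsub>A\<^esub> \<oplus>\<^bsub>A\<^esub> x = x"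
    "\<And>x. x \<in> carrier A \<Longrightarrow> x \<oplus>\<^bsub>A\<^esub> \<zero>\<^bsub>A\<^esub> = x"
    "\<And>x. x \<in> carrier A \<Longrightarrow> \<one>\<^bsub>A\<^esub> \<otimes>\<^bsub>A\<^esub> x = x"
    "\<And>x. x \<in> carrier A \<Longrightarrow> x \<otimes>\<^bsub>A\<^esub> \<one>\<^bsub>A\<^esub> = x"
    "\<And>x. x \<in> carrier A \<Longrightarrow> \<ominus>\<^bsub>A\<^esub> x \<oplus>\<^bsub>A\<^esub> x = \<zero>\<^bsub>A\<^esub>"
    "\<And>x. x \<in> carrier A \<Longrightarrow> \<zero>\<^bsub>A\<^esub> \<otimes>\<^bsub>A\<^esub> x = \<zero>\<^bsub>A\<^esub>"
    "\<And>x. x \<in> carrier A \<Longrightarrow> x \<otimes>\<^bsub>A\<^esub> \<zero>\<^bsub>A\<^esub> = \<zero>\<^bsub>A\<^esub>"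
proof -
  interpret cstar_record A by fact
  show "x \<in> carrier A \<Longrightarrow> \<ominus>\<^bsub>A\<^esub> x \<oplus>\<^bsub>A\<^esub> x = \<zero>\<^bsub>A\<^esub>"
    "x \<in> carrier A \<Longrightarrow> x \<otimes>\<^bsub>A\<^esub> \<one>\<^bsub>A\<^esub> = x" for x by simp_all (rule l_neg)
qed (use cstar_record.axioms(1)[OF assms] in \<open>auto simp: ring.ring_simprules\<close>)

lemma family_a_comm: "x + y = y + (x::'a family)"
proof (rule family_eqI)
  fix A :: "'a cstar" assume A: "cstar_record A" then interpret cstar_record A .
  show "component (x + y) A = component (y + x) A" by (simp add: component_simps[OF A] component_closed[OF A] a_comm)
qed

lemma norm_family_scale: "norm (family_scale c x) = cmod c * norm x"
  proof (rule antisym)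
    show le: "norm (family_scale c x) \<le> cmod c * norm x" for c and x :: "'a family"
      by (rule norm_family_le) (auto simp: component_simps norm_family_ge_0 component_closed
        cstar_record.cnorm_smult intro!: mult_left_mono cnorm_component_le)
    show "cmod c * norm x \<le> norm (family_scale c x)"
    proof (cases "c = 0")
      case False
      have "x = family_scale (inverse c) (family_scale c x)" using False
        by (intro family_eqI) (simp add: component_simps cstar_record.smult_one cstar_record.smult_smult component_closed)
      then have "norm x \<le> cmod (inverse c) * norm (family_scale c x)" using le by metis
      then show ?thesis using False by (simp add: norm_divide field_simps)
    qed (simp add: norm_family_ge_0)
  qed

instance
proof
  fix x y z :: "'a family" and a b :: real
  show "x + y + z = x + (y + z)" "x * y * z = x * (y * z)" "(x + y) * z = x * z + y * z"
    "x * (y + z) = x * y + x * z" "0 + x = x" "1 * x = x" "x * 1 = x" "- x + x = 0"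
    by (rule family_eqI; simp add: component_simps record_rules component_closed)+
  show "x + y = y + x" by (rule family_a_comm)
  show "x - y = x + - y" by (rule minus_family_def)
  show "a *\<^sub>R (x + y) = a *\<^sub>R x + a *\<^sub>R y"
    by (rule family_eqI; simp add: component_simps cstar_record.smult_add_right component_closed)
  show "(a + b) *\<^sub>R x = a *\<^sub>R x + b *\<^sub>R x"
    by (rule family_eqI; simp add: component_simps cstar_record.smult_add_left component_closed)
  show "a *\<^sub>R b *\<^sub>R x = (a * b) *\<^sub>R x"
    by (rule family_eqI; simp add: component_simps cstar_record.smult_smult component_closed)
  show "a *\<^sub>R x * y = a *\<^sub>R (x * y)"
    by (rule family_eqI; simp add: component_simps cstar_record.smult_mult_left component_closed)
  show "x * a *\<^sub>R y = a *\<^sub>R (x * y)"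
    by (rule family_eqI; simp add: component_simps cstar_record.smult_mult_right component_closed)
  show "1 *\<^sub>R x = x"
    by (rule family_eqI; simp add: component_simps cstar_record.smult_one component_closed)
  show "dist x y = norm (x - y)" by (rule dist_family_def)
  show "sgn x = inverse (norm x) *\<^sub>R x" by (rule sgn_family_def)
  show "uniformity = (INF e\<in>{0<..}. principal {(x, y). dist x (y::'a family) < e})" by (rule uniformity_family_def)
  show "open U = (\<forall>x\<in>U. \<forall>\<^sub>F (x', y) in uniformity. x' = x \<longrightarrow> y \<in> U)" for U :: "'a family set"
    by (rule open_family_def)
  show "(norm x = 0) = (x = 0)"
  proof
    assume n: "norm x = 0"
    show "x = 0"
    proof (rule family_eqI)
      fix A :: "'a cstar" assume A: "cstar_record A" then interpret cstar_record A .
      have "cnorm A (component x A) = 0"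
        using cnorm_component_le[OF A, of x] cnorm_nonneg[OF component_closed[OF A, of x]] n by simp
      then show "component x A = component 0 A"
        using component_closed[OF A] cnorm_eq_0 by (simp add: component_simps[OF A])
    qed
  next
    assume "x = 0"
    then have "norm x \<le> 0" by (intro norm_family_le) (simp_all add: component_simps cstar_record.cnorm_zero)
    then show "norm x = 0" using norm_family_ge_0[of x] by simp
  qed
  show "norm (x + y) \<le> norm x + norm y"
    by (rule norm_family_le) (auto simp: component_simps norm_family_ge_0 component_closed
        intro!: order_trans[OF cstar_record.cnorm_triangle] add_mono cnorm_component_le)
  show "norm (x * y) \<le> norm x * norm y"
    by (rule norm_family_le) (auto simp: component_simps norm_family_ge_0 component_closed
        cstar_record.cnorm_nonneg intro!: order_trans[OF cstar_record.cnorm_mult] mult_mono cnorm_component_le)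
  show "norm (a *\<^sub>R x) = \<bar>a\<bar> * norm x" by (simp add: scaleR_family_def norm_family_scale)
qed

end

instantiation family :: (type) unital_cstar
begin

definition cscale_family :: "complex \<Rightarrow> 'a family \<Rightarrow> 'a family"
  where "cscale_family = family_scale"

definition dag_family :: "'a family \<Rightarrow> 'a family"
  where "x\<^sup>\<star> = family (\<lambda>A. star A (component x A))"

lemma component_cscale: "cstar_record A \<Longrightarrow> component (c *\<^sub>C x) A = c \<odot>\<^bsub>A\<^esub> component x A"
  by (simp add: cscale_family_def component_simps)

lemma component_dag:
  assumes "cstar_record A" shows "component (x\<^sup>\<star>) A = star A (component x A)"
  unfolding dag_family_def
  proof (rule component_family[OF _ assms])
    fix B :: "'a cstar" assume B: "cstar_record B" then interpret cstar_record B .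
    have le: "cnorm B y \<le> cnorm B (star B y)" if "y \<in> carrier B" for y
    proof (cases "cnorm B y = 0")
      case False
      with cnorm_nonneg[OF that] have "0 < cnorm B y" by simp
      moreover have "cnorm B y * cnorm B y \<le> cnorm B (star B y) * cnorm B y"
        using cnorm_star_mult[OF that] cnorm_mult[OF star_closed[OF that] that] by (simp add: power2_eq_square)
      ultimately show ?thesis by simp
    qed (simp add: cnorm_nonneg star_closed that)
    show "star B (component x B) \<in> carrier B \<and> cnorm B (star B (component x B)) \<le> norm x"
      using order_trans[OF le[OF star_closed[OF component_closed[OF B]]]] cnorm_component_le[OF B]
      by (simp add: star_closed star_star component_closed[OF B])
  qed

instance
proof
  fix x y :: "'a family" and c d :: complex and r :: real
  note component_simps [simp] component_cscale [simp] component_dag [simp] component_closed [simp]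
  show "c *\<^sub>C (x + y) = c *\<^sub>C x + c *\<^sub>C y"
    by (rule family_eqI; simp add: cstar_record.smult_add_right)
  show "(c + d) *\<^sub>C x = c *\<^sub>C x + d *\<^sub>C x"
    by (rule family_eqI; simp add: cstar_record.smult_add_left)
  show "c *\<^sub>C d *\<^sub>C x = (c * d) *\<^sub>C x"
    by (rule family_eqI; simp add: cstar_record.smult_smult)
  show "complex_of_real r *\<^sub>C x = r *\<^sub>R x" by (simp add: scaleR_family_def cscale_family_def)
  show "c *\<^sub>C x * y = c *\<^sub>C (x * y)"
    by (rule family_eqI; simp add: cstar_record.smult_mult_left)
  show "x * (c *\<^sub>C y) = c *\<^sub>C (x * y)"
    by (rule family_eqI; simp add: cstar_record.smult_mult_right)
  show "(x + y)\<^sup>\<star> = x\<^sup>\<star> + y\<^sup>\<star>"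
    by (rule family_eqI; simp add: cstar_record.star_add)
  show "(x * y)\<^sup>\<star> = y\<^sup>\<star> * x\<^sup>\<star>"
    by (rule family_eqI; simp add: cstar_record.star_mult)
  show "(c *\<^sub>C x)\<^sup>\<star> = cnj c *\<^sub>C x\<^sup>\<star>"
    by (rule family_eqI; simp add: cstar_record.star_smult)
  show "x\<^sup>\<star>\<^sup>\<star> = x"
    by (rule family_eqI; simp add: cstar_record.star_star)
  show "norm (c *\<^sub>C x) = cmod c * norm x" by (simp add: cscale_family_def norm_family_scale)
  show "norm (x\<^sup>\<star> * x) = (norm x)\<^sup>2"
  proof (rule antisym)
    show "norm (x\<^sup>\<star> * x) \<le> (norm x)\<^sup>2"
      by (rule norm_family_le) (auto simp: component_dag component_simps component_closed
        cstar_record.cnorm_nonneg cstar_record.cnorm_star_mult intro!: power_mono cnorm_component_le)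
    have "norm x \<le> sqrt (norm (x\<^sup>\<star> * x))"
    proof (rule norm_family_le)
      fix A :: "'a cstar" assume A: "cstar_record A"
      have "(cnorm A (component x A))\<^sup>2 \<le> norm (x\<^sup>\<star> * x)"
        using cnorm_component_le[OF A, of "x\<^sup>\<star> * x"] A
        by (simp add: component_simps component_dag cstar_record.cnorm_star_mult component_closed)
      then show "cnorm A (component x A) \<le> sqrt (norm (x\<^sup>\<star> * x))" by (rule real_le_rsqrt)
    qed (simp add: norm_family_ge_0)
    then show "(norm x)\<^sup>2 \<le> norm (x\<^sup>\<star> * x)"
      using norm_family_ge_0 power_mono[of "norm x" "sqrt (norm (x\<^sup>\<star> * x))" 2] by simp
  qed
  show "convergent X" if "Cauchy X" for X :: "nat \<Rightarrow> 'a family"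
  proof -
    have C: "\<exists>N. \<forall>k\<ge>N. \<forall>l\<ge>N. norm (X k - X l) < e" if "0 < e" for e
      using \<open>Cauchy X\<close> that unfolding Cauchy_def dist_family_def by blast
    have "\<exists>a\<in>carrier A. (\<lambda>k. cnorm A (component (X k) A \<ominus>\<^bsub>A\<^esub> a)) \<longlonglongrightarrow> 0" if A: "cstar_record A" for A
    proof (rule cstar_record.cnorm_complete[OF A])
      fix e :: real assume "0 < e"
      with C obtain N where "\<And>k l. k \<ge> N \<Longrightarrow> l \<ge> N \<Longrightarrow> norm (X k - X l) < e" by blast
      then show "\<exists>N. \<forall>k\<ge>N. \<forall>l\<ge>N. cnorm A (component (X k) A \<ominus>\<^bsub>A\<^esub> component (X l) A) < e"
        using cnorm_component_le[OF A] le_less_trans by (metis component_simps(8)[OF A])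
    qed (auto simp: component_closed A)
    then obtain L where L: "\<And>A. cstar_record A \<Longrightarrow> L A \<in> carrier A"
      "\<And>A. cstar_record A \<Longrightarrow> (\<lambda>k. cnorm A (component (X k) A \<ominus>\<^bsub>A\<^esub> L A)) \<longlonglongrightarrow> 0" by metis
    have unif: "cnorm A (component (X k) A \<ominus>\<^bsub>A\<^esub> L A) \<le> e"
      if A: "cstar_record A" and N: "\<And>k l. k \<ge> N \<Longrightarrow> l \<ge> N \<Longrightarrow> norm (X k - X l) < e" and k: "k \<ge> N" for A k N e
    proof -
      interpret cstar_record A by (fact A)
      have 1: "(\<lambda>l. e + cnorm A (component (X l) A \<ominus>\<^bsub>A\<^esub> L A)) \<longlonglongrightarrow> e + 0"
        by (intro tendsto_intros L(2) A)
      have "cnorm A (component (X k) A \<ominus>\<^bsub>A\<^esub> L A) \<le> e + cnorm A (component (X l) A \<ominus>\<^bsub>A\<^esub> L A)" if "l \<ge> N" for l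
      proof -
        let ?x = "component (X k) A" and ?y = "component (X l) A"
        have cl: "?x \<in> carrier A" "?y \<in> carrier A" "L A \<in> carrier A" using A L(1) by (simp_all add: component_closed)
        have "?x \<ominus>\<^bsub>A\<^esub> L A = (?x \<ominus>\<^bsub>A\<^esub> ?y) \<oplus>\<^bsub>A\<^esub> (?y \<ominus>\<^bsub>A\<^esub> L A)" using cl
          by (simp add: minus_eq a_assoc) (simp add: l_neg flip: a_assoc)
        moreover have "cnorm A (?x \<ominus>\<^bsub>A\<^esub> ?y) \<le> e"
          using cnorm_component_le[OF A, of "X k - X l"] N[OF k that] by (simp add: component_simps[OF A])
        ultimately show ?thesis using cnorm_triangle[of "?x \<ominus>\<^bsub>A\<^esub> ?y" "?y \<ominus>\<^bsub>A\<^esub> L A"] cl by simp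
      qed
      then show ?thesis using LIMSEQ_le_const[OF 1] by auto
    qed
    obtain N1 where N1: "\<And>k l. k \<ge> N1 \<Longrightarrow> l \<ge> N1 \<Longrightarrow> norm (X k - X l) < 1" using C[of 1] by auto
    have LB: "cnorm A (L A) \<le> 1 + norm (X N1)" if A: "cstar_record A" for A
    proof -
      interpret cstar_record A by (fact A)
      show ?thesis
        using cnorm_diff_le[OF L(1)[OF A] component_closed[OF A, of "X N1"]] unif[of A N1 1 N1, OF A N1 order_refl]
         cnorm_component_le[OF A, of "X N1"] cnorm_diff_commute[OF L(1)[OF A] component_closed[OF A, of "X N1"]] by simp
    qed
    have cL: "component (family L) A = L A" if "cstar_record A" for A
      by (rule component_family[OF _ that]) (use L(1) LB in blast)
    have "X \<longlonglongrightarrow> family L"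
    proof (rule metric_LIMSEQ_I)
      fix e :: real assume "0 < e"
      then obtain N where N: "\<And>k l. k \<ge> N \<Longrightarrow> l \<ge> N \<Longrightarrow> norm (X k - X l) < e / 2" using C[of "e/2"] by auto
      have "norm (X k - family L) \<le> e / 2" if "k \<ge> N" for k
      proof (rule norm_family_le)
        fix A :: "'a cstar" assume A: "cstar_record A"
        show "cnorm A (component (X k - family L) A) \<le> e / 2"
          using unif[of A N "e / 2" k, OF A N that] by (simp add: component_simps A cL)
      qed (use \<open>0 < e\<close> in simp)
      then have "\<forall>k\<ge>N. dist (X k) (family L) < e"
        using \<open>0 < e\<close> unfolding dist_family_def by fastforce
      then show "\<exists>N. \<forall>k\<ge>N. dist (X k) (family L) < e" ..
    qed
    then show ?thesis by (auto simp: convergent_def)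
  qed
qed

end

definition embed :: "'a cstar \<Rightarrow> 'a \<Rightarrow> 'a family"
  where "embed A x = family (\<lambda>B. if B = A then x else \<zero>\<^bsub>B\<^esub>)"

context cstar_record
begin

lemma rec: "cstar_record A"
  by unfold_locales

lemma component_embed:
  assumes "x \<in> carrier A" "cstar_record B"
  shows "component (embed A x) B = (if B = A then x else \<zero>\<^bsub>B\<^esub>)"
  unfolding embed_def
  by (rule component_family[OF _ assms(2), of _ "cnorm A x"])
    (auto simp: assms(1) record_rules cstar_record.cnorm_zero cnorm_nonneg)

lemma component_embed_self: "x \<in> carrier A \<Longrightarrow> component (embed A x) A = x"
  by (simp add: component_embed rec)

lemma embed_hom:
  "\<lbrakk>x \<in> carrier A; y \<in> carrier A\<rbrakk> \<Longrightarrow> embed A (x \<oplus> y) = embed A x + embed A y"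
  "\<lbrakk>x \<in> carrier A; y \<in> carrier A\<rbrakk> \<Longrightarrow> embed A (x \<otimes> y) = embed A x * embed A y"
  "x \<in> carrier A \<Longrightarrow> embed A (star A x) = (embed A x)\<^sup>\<star>"
  "x \<in> carrier A \<Longrightarrow> embed A (c \<odot> x) = c *\<^sub>C embed A x"
  "x \<in> carrier A \<Longrightarrow> embed A (\<ominus> x) = - embed A x"
  "\<lbrakk>x \<in> carrier A; y \<in> carrier A\<rbrakk> \<Longrightarrow> embed A (x \<ominus> y) = embed A x - embed A y"
  by (auto intro!: family_eqI simp: component_simps component_cscale component_dag component_embed smult_closed star_closed
      record_rules cstar_record.star_zero cstar_record.smult_zero ring.ring_simprules[OF cstar_record.axioms(1)])

lemma embed_zero: "embed A \<zero> = 0"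
  by (auto intro!: family_eqI simp: component_simps component_embed)

lemma norm_embed: 
  assumes "x \<in> carrier A" shows "norm (embed A x) = cnorm A x"
proof (rule antisym)
  show "norm (embed A x) \<le> cnorm A x"
    by (rule norm_family_le) (auto simp: component_embed assms cstar_record.cnorm_zero cnorm_nonneg)
  show "cnorm A x \<le> norm (embed A x)"
    using cnorm_component_le[OF rec, of "embed A x"] by (simp add: component_embed_self assms)
qed

lemma embed_inject: "x \<in> carrier A \<Longrightarrow> y \<in> carrier A \<Longrightarrow> embed A x = embed A y \<longleftrightarrow> x = y"
  using component_embed_self by metis

text \<open>
  The image of the embedding is the corner cut out by the image of the unit.
\<close>

lemma embed_one_mult: "embed A \<one> * t = embed A (component t A)" "t * embed A \<one> = embed A (component t A)"
  by (auto intro!: family_eqI simp: component_simps component_embed component_closed rec record_rules)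

end

section \<open>Noncommutative *-polynomials\<close>

lemma adj_letter_adj_letter [simp]: "adj_letter (adj_letter l) = l"
  by (cases l) simp_all

lemma adj_word_adj_word [simp]: "adj_word (adj_word w) = w"
  by (simp add: adj_word_def rev_map comp_def)

lemma adj_word_add: "adj_word (v + w) = adj_word w + adj_word v"
  by (simp add: adj_word_def plus_star_word_def)

lemma adj_word_0 [simp]: "adj_word 0 = 0"
  by (simp add: adj_word_def zero_star_word_def)

lemma set_letter_adj_letter [simp]: "set_letter (adj_letter l) = set_letter l"
  by (cases l) simp_all

lemma set_star_word_eq: "set_star_word w = (\<Union>l\<in>set (letters w). set_letter l)"
  by (cases w) simp

lemma set_star_word_simps [simp]:
  "set_star_word (adj_word w) = set_star_word w" "set_star_word (v + w) = set_star_word v \<union> set_star_word w"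
  "set_star_word 0 = {}"
  by (simp_all add: set_star_word_eq adj_word_def plus_star_word_def zero_star_word_def UN_Un)

text \<open>
  The coefficients of an adjoint determine it, and the algebraic laws of \<open>adj\<close> are read off from them.
\<close>

lemma lookup_adj: "Poly_Mapping.lookup (adj f) w = cnj (Poly_Mapping.lookup f (adj_word w))"
proof -
  have "Poly_Mapping.lookup (adj f) w
      = (\<Sum>v\<in>Poly_Mapping.keys f. if v = adj_word w then cnj (Poly_Mapping.lookup f v) else 0)"
    unfolding adj_def lookup_sum by (intro sum.cong refl) (auto simp: lookup_single when_def)
  also have "\<dots> = cnj (Poly_Mapping.lookup f (adj_word w))"
    by (simp add: sum.delta in_keys_iff)
  finally show ?thesis .
qed

lemma adj_add: "adj (f + g) = adj f + adj g"
  by (rule poly_mapping_eqI) (simp add: lookup_adj lookup_add)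

lemma adj_adj [simp]: "adj (adj f) = f"
  by (rule poly_mapping_eqI) (simp add: lookup_adj)

lemma adj_single: "adj (Poly_Mapping.single w c) = Poly_Mapping.single (adj_word w) (cnj c)"
  by (rule poly_mapping_eqI) (auto simp: lookup_adj lookup_single when_def)

lemma adj_0 [simp]: "adj 0 = 0"
  by (rule poly_mapping_eqI) (simp add: lookup_adj)

lemma star_poly_induct [case_names zero single add]:
  assumes "P 0" "\<And>w c. P (Poly_Mapping.single w c)" "\<And>f g. P f \<Longrightarrow> P g \<Longrightarrow> P (f + g)"
  shows "P (f :: 'g star_poly)"
proof (induct f rule: update_induct)
  case (update f w c)
  have "Poly_Mapping.update w c f = f + Poly_Mapping.single w c"
    using update(1) by (intro poly_mapping_eqI) (auto simp: lookup_update lookup_add lookup_single when_def in_keys_iff)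
  then show ?case using assms update by simp
qed (rule assms)

lemma adj_mult: "adj (f * g) = adj g * adj f"
proof (induct f rule: star_poly_induct)
  case (single v c)
  show ?case
    by (induct g rule: star_poly_induct) (simp_all add: mult_single adj_single adj_word_add adj_add algebra_simps)
qed (simp_all add: adj_add algebra_simps)

lemma cst_simps: "cst 0 = 0" "cst 1 = 1" "cst (- c) = - cst c" "cst (c + d) = cst c + cst d"
    "cst (c * d) = cst c * cst d" "adj (cst c) = cst (cnj c)"
  by (simp_all add: cst_def single_add mult_single adj_single single_uminus flip: single_one)

lemma cst_commute: "f * cst c = cst c * f"
  by (induct f rule: star_poly_induct) (simp_all add: cst_def mult_single algebra_simps)

lemma adj_minus: "adj (- f) = - adj f"
  by (rule poly_mapping_eqI) (simp add: lookup_adj)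

lemma adj_diff: "adj (f - g) = adj f - adj g"
  using adj_add[of f "- g"] by (simp add: adj_minus)

lemma adj_one [simp]: "adj 1 = 1"
  using cst_simps(6)[of 1] by (simp add: cst_simps)

lemma star_polys_closed:
  "f \<in> star_polys G \<Longrightarrow> g \<in> star_polys G \<Longrightarrow> f + g \<in> star_polys G"
  "f \<in> star_polys G \<Longrightarrow> g \<in> star_polys G \<Longrightarrow> f * g \<in> star_polys G"
  "f \<in> star_polys G \<Longrightarrow> adj f \<in> star_polys G"
  "f \<in> star_polys G \<Longrightarrow> - f \<in> star_polys G"
  "f \<in> star_polys G \<Longrightarrow> g \<in> star_polys G \<Longrightarrow> f - g \<in> star_polys G"
proof -
  show s: "f + g \<in> star_polys G" if "f \<in> star_polys G" "g \<in> star_polys G" for f g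
    using that keys_add[of f g] unfolding star_polys_def by blast
  show "f * g \<in> star_polys G" if "f \<in> star_polys G" "g \<in> star_polys G"
    using that keys_mult[of f g] unfolding star_polys_def by fastforce
  have "adj_word w \<in> Poly_Mapping.keys f" if "w \<in> Poly_Mapping.keys (adj f)" for w
    using that by (simp add: in_keys_iff lookup_adj)
  then show "adj f \<in> star_polys G" if "f \<in> star_polys G"
    using that unfolding star_polys_def by force
  show m: "- f \<in> star_polys G" if "f \<in> star_polys G" for f
    using that by (simp add: star_polys_def)
  show "f - g \<in> star_polys G" if "f \<in> star_polys G" "g \<in> star_polys G"
    using s[OF that(1) m[OF that(2)]] by simp
qed

lemma star_polys_basic [simp]: "cst c \<in> star_polys G" "0 \<in> star_polys G" "1 \<in> star_polys G"
  "g \<in> G \<Longrightarrow> gen g \<in> star_polys G"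
  by (auto simp: star_polys_def cst_def gen_def simp flip: single_one split: if_splits)

lemma star_polys_induct [consumes 1, case_names cst gen adj_gen add mult]:
  assumes f: "f \<in> star_polys G"
    and c: "\<And>c. P (cst c)" and g: "\<And>g. g \<in> G \<Longrightarrow> P (gen g)" and a: "\<And>g. g \<in> G \<Longrightarrow> P (adj (gen g))"
    and s: "\<And>f g. f \<in> star_polys G \<Longrightarrow> g \<in> star_polys G \<Longrightarrow> P f \<Longrightarrow> P g \<Longrightarrow> P (f + g)"
    and m: "\<And>f g. f \<in> star_polys G \<Longrightarrow> g \<in> star_polys G \<Longrightarrow> P f \<Longrightarrow> P g \<Longrightarrow> P (f * g)"
  shows "P f"
proof -
  have letter: "P (Poly_Mapping.single (Word [l]) 1) \<and> Poly_Mapping.single (Word [l]) 1 \<in> star_polys G"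
    if "set_letter l \<subseteq> G" for l
  proof (cases l)
    case (Gen i)
    with that show ?thesis using g[of i] star_polys_basic(4)[of i G] by (simp add: gen_def)
  next
    case (Adj i)
    then have "Poly_Mapping.single (Word [l]) 1 = adj (gen i)" by (simp add: gen_def adj_single adj_word_def)
    with Adj that show ?thesis using a[of i] star_polys_closed(3)[OF star_polys_basic(4)[of i G]] by simp
  qed
  have word: "P (Poly_Mapping.single (Word ls) x) \<and> Poly_Mapping.single (Word ls) x \<in> star_polys G"
    if "\<forall>l\<in>set ls. set_letter l \<subseteq> G" for ls x
    using that
  proof (induct ls)
    case Nil
    show ?case using c[of x] star_polys_basic(1)[of x G] by (simp add: cst_def zero_star_word_def)
  next
    case (Cons l ls)
    have "Poly_Mapping.single (Word (l # ls)) x = Poly_Mapping.single (Word [l]) 1 * Poly_Mapping.single (Word ls) x"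
      by (simp add: mult_single plus_star_word_def)
    then show ?case using Cons letter[of l] m by (simp add: star_polys_closed)
  qed
  have single: "P (Poly_Mapping.single w x) \<and> Poly_Mapping.single w x \<in> star_polys G" if "set_star_word w \<subseteq> G" for w x
    using word[of "letters w" x] that by (cases w) (auto simp: set_star_word_eq)
  have "f \<in> star_polys G \<longrightarrow> P f"
  proof (induct f rule: update_induct)
    case const then show ?case using c[of 0] by (simp add: cst_simps)
  next
    case (update f w x)
    have e: "Poly_Mapping.update w x f = f + Poly_Mapping.single w x"
      using update(1) by (intro poly_mapping_eqI) (auto simp: lookup_update lookup_add lookup_single when_def in_keys_iff)
    show ?case
    proof
      assume u: "Poly_Mapping.update w x f \<in> star_polys G"
      have "Poly_Mapping.keys (Poly_Mapping.update w x f) = insert w (Poly_Mapping.keys f)"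
        using update(2) by (auto simp: in_keys_iff lookup_update split: if_splits)
      with u have "f \<in> star_polys G" "set_star_word w \<subseteq> G" by (auto simp: star_polys_def)
      then show "P (Poly_Mapping.update w x f)" unfolding e using update(3) single s by blast
    qed
  qed
  with f show ?thesis by simp
qed

section \<open>Completion in a C*-seminorm\<close>

text \<open>
  Being a ring depends on five fields of a record only; this carries the ring structure of a
  quotient over to the record with the additional fields.
\<close>

lemma ring_cong:
  assumes "ring R" "carrier S = carrier R" "monoid.mult S = monoid.mult R" "one S = one R" "zero S = zero R" "add S = add R"
  shows "ring S"
proof -
  interpret R: ring R by fact
  show ?thesis
    by (intro ringI abelian_groupI monoidI)
      (auto simp: assms(2-6) R.ring_simprules intro!: bexI[of _ "\<ominus>\<^bsub>R\<^esub> _"])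
qed

lemma cstar_quot_simps:
  "carrier (cstar_quot A I) = (\<lambda>x. I +>\<^bsub>A\<^esub> x) ` carrier A" "monoid.mult (cstar_quot A I) = rcoset_mult A I"
  "one (cstar_quot A I) = I +>\<^bsub>A\<^esub> \<one>\<^bsub>A\<^esub>" "zero (cstar_quot A I) = I" "add (cstar_quot A I) = set_add A"
  "module.smult (cstar_quot A I) = (\<lambda>c X. \<Union>x\<in>X. I +>\<^bsub>A\<^esub> (c \<odot>\<^bsub>A\<^esub> x))"
  "star (cstar_quot A I) = (\<lambda>X. \<Union>x\<in>X. I +>\<^bsub>A\<^esub> star A x)"
  "cnorm (cstar_quot A I) = (\<lambda>X. INF x\<in>X. cnorm A x)"
  by (auto simp: cstar_quot_def FactRing_def A_RCOSETS_defs a_r_coset_def)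

locale cstar_ideal = ideal I A for I :: "'a set" and A :: "'a cstar" (structure)
begin

lemma ring_cstar_quot: "ring (cstar_quot A I)"
  by (rule ring_cong[OF quotient_is_ring]) (simp_all add: cstar_quot_def)

lemma coset_eq_iff:
  assumes "x \<in> carrier A" "y \<in> carrier A"
  shows "I +> x = I +> y \<longleftrightarrow> x \<ominus> y \<in> I"
  using assms a_rcos_module_minus[OF ring_axioms, of y x] a_repr_independence'[of x y] a_rcos_self[of x] 
  by auto

lemma cstar_quot_ops:
  assumes "x \<in> carrier A" "y \<in> carrier A"
  shows "(I +> x) \<oplus>\<^bsub>cstar_quot A I\<^esub> (I +> y) = I +> (x \<oplus> y)"
    "(I +> x) \<otimes>\<^bsub>cstar_quot A I\<^esub> (I +> y) = I +> (x \<otimes> y)"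
  using assms a_rcos_sum rcoset_mult_add by (simp_all add: cstar_quot_simps)

lemma coset_Union:
  assumes "x \<in> carrier A" "\<And>z. z \<in> carrier A \<Longrightarrow> z \<ominus> x \<in> I \<Longrightarrow> I +> f z = I +> f x"
  shows "(\<Union>z\<in>I +> x. I +> f z) = I +> f x"
proof -
  have "I +> f z = I +> f x" if "z \<in> I +> x" for z
    using that assms a_rcos_module_minus[OF ring_axioms, of x z] a_r_coset_subset_G[OF a_subset, of x] by blast
  then show ?thesis using a_rcos_self[OF assms(1)] by blast
qed

end

locale poly_seminorm =
  fixes G :: "'g set" and p :: "'g star_poly \<Rightarrow> real"
  assumes seminorm: "cstar_seminorm G p"
begin

abbreviation "C \<equiv> cauchy_algebra G p"
abbreviation "N \<equiv> null_seqs G p"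
abbreviation "U \<equiv> cstar_quot C N"

lemma p_rules:
  assumes "x \<in> star_polys G" "y \<in> star_polys G"
  shows "0 \<le> p x" "p (cst c * x) = cmod c * p x" "p (adj x * x) = (p x)\<^sup>2" "p (x + y) \<le> p x + p y"
    "p (x * y) \<le> p x * p y"
  using seminorm assms unfolding cstar_seminorm_def by blast+

lemma p_zero: "p 0 = 0"
  using p_rules(2)[of 0 0 0] by simp

lemma p_minus: "x \<in> star_polys G \<Longrightarrow> p (- x) = p x"
  using p_rules(2)[of x x "-1"] by (simp add: cst_simps)

lemma p_diff_commute: "x \<in> star_polys G \<Longrightarrow> y \<in> star_polys G \<Longrightarrow> p (x - y) = p (y - x)"
  using p_minus[of "x - y"] by (simp add: star_polys_closed)

lemma p_diff: "x \<in> star_polys G \<Longrightarrow> y \<in> star_polys G \<Longrightarrow> \<bar>p x - p y\<bar> \<le> p (x - y)"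
  using p_rules(4)[of "x - y" y] p_rules(4)[of "y - x" x] p_diff_commute[of x y]
  by (simp add: star_polys_closed)

lemma p_adj: "x \<in> star_polys G \<Longrightarrow> p (adj x) = p x"
proof -
  have le: "p x \<le> p (adj x)" if "x \<in> star_polys G" for x
  proof (cases "p x = 0")
    case False
    then have "0 < p x" using p_rules(1)[OF that that] by simp
    moreover have "p x * p x \<le> p (adj x) * p x"
      using p_rules(3)[OF that that] p_rules(5)[OF star_polys_closed(3)[OF that] that] by (simp add: power2_eq_square)
    ultimately show ?thesis by simp
  qed (use p_rules(1) star_polys_closed(3) that in auto)
  assume "x \<in> star_polys G"
  then show ?thesis using le[of x] le[of "adj x"] star_polys_closed(3)[of x G] by simp
qed

lemma cauchyD:
  assumes "s \<in> carrier C"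
  shows "s k \<in> star_polys G" "0 < \<epsilon> \<Longrightarrow> \<exists>N. \<forall>k\<ge>N. \<forall>l\<ge>N. p (s k - s l) < \<epsilon>"
  using assms by (auto simp: cauchy_algebra_def)

lemma cauchyI:
  assumes "\<And>k. s k \<in> star_polys G" "\<And>\<epsilon>. 0 < \<epsilon> \<Longrightarrow> \<exists>N. \<forall>k\<ge>N. \<forall>l\<ge>N. p (s k - s l) < \<epsilon>"
  shows "s \<in> carrier C"
  using assms by (auto simp: cauchy_algebra_def)

lemma C_ops: "s \<oplus>\<^bsub>C\<^esub> t = (\<lambda>k. s k + t k)" "s \<otimes>\<^bsub>C\<^esub> t = (\<lambda>k. s k * t k)" "\<one>\<^bsub>C\<^esub> = (\<lambda>k. 1)" "\<zero>\<^bsub>C\<^esub> = (\<lambda>k. 0)"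
    "c \<odot>\<^bsub>C\<^esub> s = (\<lambda>k. cst c * s k)" "star C s = (\<lambda>k. adj (s k))"
  by (simp_all add: cauchy_algebra_def)

lemma const_cauchy: "f \<in> star_polys G \<Longrightarrow> (\<lambda>k. f) \<in> carrier C"
  by (rule cauchyI) (simp_all add: p_zero)

lemma p_convergent:
  assumes "s \<in> carrier C" shows "(\<lambda>k. p (s k)) \<longlonglongrightarrow> cnorm C s"
proof -
  have "Cauchy (\<lambda>k. p (s k))"
  proof (rule metric_CauchyI)
    fix e :: real assume "0 < e"
    then obtain N where "\<And>k l. k \<ge> N \<Longrightarrow> l \<ge> N \<Longrightarrow> p (s k - s l) < e" using cauchyD(2)[OF assms] by blast
    then show "\<exists>M. \<forall>m\<ge>M. \<forall>n\<ge>M. dist (p (s m)) (p (s n)) < e"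
      using p_diff[OF cauchyD(1)[OF assms] cauchyD(1)[OF assms]] le_less_trans unfolding dist_real_def by meson
  qed
  then show ?thesis by (simp add: cauchy_algebra_def Cauchy_convergent_iff convergent_LIMSEQ_iff)
qed

lemma p_bounded:
  assumes "s \<in> carrier C" obtains M where "0 < M" "\<And>k. p (s k) \<le> M"
proof -
  have "Bseq (\<lambda>k. p (s k))" using p_convergent[OF assms] convergentI convergent_imp_Bseq by blast
  then show ?thesis using that unfolding Bseq_def by (metis abs_ge_self order_trans real_norm_def)
qed

lemma add_cauchy:
  assumes "s \<in> carrier C" "t \<in> carrier C" shows "(\<lambda>k. s k + t k) \<in> carrier C"
proof (rule cauchyI)
  show "s k + t k \<in> star_polys G" for k using assms cauchyD(1) star_polys_closed(1) by blast
  fix e :: real assume "0 < e"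
  then have e2: "0 < e / 2" by simp
  obtain N M where NM: "\<And>k l. k \<ge> N \<Longrightarrow> l \<ge> N \<Longrightarrow> p (s k - s l) < e / 2"
      "\<And>k l. k \<ge> M \<Longrightarrow> l \<ge> M \<Longrightarrow> p (t k - t l) < e / 2"
    using cauchyD(2)[OF assms(1) e2] cauchyD(2)[OF assms(2) e2] by blast
  have "p (s k + t k - (s l + t l)) < e" if "k \<ge> max N M" "l \<ge> max N M" for k l
  proof -
    have "p ((s k - s l) + (t k - t l)) \<le> p (s k - s l) + p (t k - t l)"
      by (intro p_rules(4) star_polys_closed cauchyD(1) assms)
    then show ?thesis using NM(1)[of k l] NM(2)[of k l] that by (simp add: algebra_simps)
  qed
  then show "\<exists>N. \<forall>k\<ge>N. \<forall>l\<ge>N. p (s k + t k - (s l + t l)) < e" by blast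
qed

lemma mult_cauchy:
  assumes "s \<in> carrier C" "t \<in> carrier C" shows "(\<lambda>k. s k * t k) \<in> carrier C"
proof (rule cauchyI)
  note cl = cauchyD(1)[OF assms(1)] cauchyD(1)[OF assms(2)]
  show "s k * t k \<in> star_polys G" for k using cl star_polys_closed(2) by blast
  obtain S T where S: "0 < S" "\<And>k. p (s k) \<le> S" and T: "0 < T" "\<And>k. p (t k) \<le> T"
    using p_bounded[OF assms(1)] p_bounded[OF assms(2)] by metis
  fix e :: real assume "0 < e"
  then have eT: "0 < e / (2 * T)" and eS: "0 < e / (2 * S)" using S T by simp_all
  obtain N M where NM: "\<And>k l. k \<ge> N \<Longrightarrow> l \<ge> N \<Longrightarrow> p (s k - s l) < e / (2 * T)"
      "\<And>k l. k \<ge> M \<Longrightarrow> l \<ge> M \<Longrightarrow> p (t k - t l) < e / (2 * S)"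
    using cauchyD(2)[OF assms(1) eT] cauchyD(2)[OF assms(2) eS] by blast
  have "p (s k * t k - s l * t l) < e" if "k \<ge> max N M" "l \<ge> max N M" for k l
  proof -
    have "s k * t k - s l * t l = (s k - s l) * t k + s l * (t k - t l)" by (simp add: algebra_simps)
    then have "p (s k * t k - s l * t l) \<le> p ((s k - s l) * t k) + p (s l * (t k - t l))"
      using p_rules(4)[of "(s k - s l) * t k" "s l * (t k - t l)"] cl by (simp add: star_polys_closed)
    also have "\<dots> \<le> p (s k - s l) * p (t k) + p (s l) * p (t k - t l)"
      by (intro add_mono p_rules(5) star_polys_closed cl)
    also have "\<dots> \<le> p (s k - s l) * T + S * p (t k - t l)"
      using S T p_rules(1)[OF star_polys_closed(5)[OF cl(1) cl(1)], of "s 0"] p_rules(1)[OF star_polys_closed(5)[OF cl(2) cl(2)], of "t 0"] cl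
      by (intro add_mono mult_left_mono mult_right_mono) auto
    also have "\<dots> < e / (2 * T) * T + S * (e / (2 * S))"
      using S T NM(1)[of k l] NM(2)[of k l] that by (intro add_strict_mono mult_strict_right_mono mult_strict_left_mono) auto
    also have "\<dots> = e" using S T by simp
    finally show ?thesis .
  qed
  then show "\<exists>N. \<forall>k\<ge>N. \<forall>l\<ge>N. p (s k * t k - s l * t l) < e" by blast
qed

lemma adj_cauchy: "s \<in> carrier C \<Longrightarrow> (\<lambda>k. adj (s k)) \<in> carrier C"
  by (rule cauchyI) (simp_all add: star_polys_closed cauchyD p_adj flip: adj_diff)

lemma scale_cauchy: "s \<in> carrier C \<Longrightarrow> (\<lambda>k. cst c * s k) \<in> carrier C"
  using mult_cauchy[OF const_cauchy[of "cst c"]] by simp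

lemma minus_cauchy: "s \<in> carrier C \<Longrightarrow> (\<lambda>k. - s k) \<in> carrier C"
  using scale_cauchy[of s "-1"] by (simp add: cst_simps)

lemma diff_cauchy: "s \<in> carrier C \<Longrightarrow> t \<in> carrier C \<Longrightarrow> (\<lambda>k. s k - t k) \<in> carrier C"
  using add_cauchy[OF _ minus_cauchy] by simp

lemma ring_C: "ring C"
proof (rule ringI)
  show "abelian_group C"
    by (rule abelian_groupI) (auto simp: C_ops add_cauchy const_cauchy algebra_simps intro!: bexI[OF _ minus_cauchy])
  show "monoid C"
    by (rule monoidI) (auto simp: C_ops mult_cauchy const_cauchy algebra_simps)
qed (auto simp: C_ops algebra_simps)

sublocale C: ring C by (rule ring_C)

lemma C_minus: "s \<in> carrier C \<Longrightarrow> \<ominus>\<^bsub>C\<^esub> s = (\<lambda>k. - s k)"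
  by (rule C.minus_equality) (auto simp: C_ops minus_cauchy)

lemma C_diff: "s \<in> carrier C \<Longrightarrow> t \<in> carrier C \<Longrightarrow> s \<ominus>\<^bsub>C\<^esub> t = (\<lambda>k. s k - t k)"
  by (simp add: C.minus_eq C_minus C_ops)

lemma null_iff: "s \<in> carrier C \<Longrightarrow> s \<in> N \<longleftrightarrow> cnorm C s = 0"
  using p_convergent[of s] LIMSEQ_unique by (auto simp: null_seqs_def)

lemma cnorm_C:
  assumes "s \<in> carrier C" "t \<in> carrier C"
  shows "0 \<le> cnorm C s" "cnorm C (s \<oplus>\<^bsub>C\<^esub> t) \<le> cnorm C s + cnorm C t" "cnorm C (s \<otimes>\<^bsub>C\<^esub> t) \<le> cnorm C s * cnorm C t"
    "cnorm C (c \<odot>\<^bsub>C\<^esub> s) = cmod c * cnorm C s" "cnorm C (star C s) = cnorm C s"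
    "cnorm C (star C s \<otimes>\<^bsub>C\<^esub> s) = (cnorm C s)\<^sup>2"
proof -
  note cl = cauchyD(1)[OF assms(1)] cauchyD(1)[OF assms(2)]
  note lim = p_convergent[OF assms(1)] p_convergent[OF assms(2)]
  show "0 \<le> cnorm C s" by (rule LIMSEQ_le_const[OF lim(1)]) (use p_rules(1) cl in blast)
  show "cnorm C (s \<oplus>\<^bsub>C\<^esub> t) \<le> cnorm C s + cnorm C t"
    by (rule LIMSEQ_le[OF p_convergent tendsto_add[OF lim]])
      (use p_rules(4) cl in \<open>auto simp: C_ops add_cauchy assms\<close>)
  show "cnorm C (s \<otimes>\<^bsub>C\<^esub> t) \<le> cnorm C s * cnorm C t"
    by (rule LIMSEQ_le[OF p_convergent tendsto_mult[OF lim]])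
      (use p_rules(5) cl in \<open>auto simp: C_ops mult_cauchy assms\<close>)
  show "cnorm C (c \<odot>\<^bsub>C\<^esub> s) = cmod c * cnorm C s"
    using p_convergent[OF scale_cauchy[OF assms(1), of c]] tendsto_mult_left[OF lim(1), of "cmod c"] p_rules(2)[OF cl(1) cl(1)]
    by (simp add: C_ops LIMSEQ_unique)
  show "cnorm C (star C s) = cnorm C s"
    using p_convergent[OF adj_cauchy[OF assms(1)]] lim(1) by (simp add: C_ops p_adj cl LIMSEQ_unique)
  show "cnorm C (star C s \<otimes>\<^bsub>C\<^esub> s) = (cnorm C s)\<^sup>2"
    using p_convergent[OF mult_cauchy[OF adj_cauchy[OF assms(1)] assms(1)]] tendsto_power[OF lim(1), of 2] p_rules(3)[OF cl(1) cl(1)]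
    by (simp add: C_ops LIMSEQ_unique)
qed

lemma ideal_N: "ideal N C"
proof (rule idealI[OF ring_C])
  have sub: "s \<in> carrier C" if "s \<in> N" for s using that by (simp add: null_seqs_def)
  show "subgroup N (add_monoid C)"
  proof (rule C.add.subgroupI)
    show "N \<noteq> {}" using p_zero by (auto simp: null_seqs_def intro!: exI[of _ "\<lambda>k. 0"] const_cauchy)
    show "\<ominus>\<^bsub>C\<^esub> s \<in> N" if "s \<in> N" for s
      using that sub[OF that] by (simp add: C_minus null_seqs_def minus_cauchy p_minus cauchyD)
    show "s \<oplus>\<^bsub>C\<^esub> t \<in> N" if "s \<in> N" "t \<in> N" for s t
      using that sub[OF that(1)] sub[OF that(2)] cnorm_C(1,2)[of s t] cnorm_C(1)[of "s \<oplus>\<^bsub>C\<^esub> t" s]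
      by (simp add: null_iff)
  qed (use sub in auto)
  show "x \<otimes>\<^bsub>C\<^esub> s \<in> N" "s \<otimes>\<^bsub>C\<^esub> x \<in> N" if "s \<in> N" "x \<in> carrier C" for s x
    using that sub[OF that(1)] cnorm_C(3)[of s x] cnorm_C(3)[of x s] cnorm_C(1)[of "s \<otimes>\<^bsub>C\<^esub> x" s] cnorm_C(1)[of "x \<otimes>\<^bsub>C\<^esub> s" s]
    by (simp_all add: null_iff)
qed

sublocale N: cstar_ideal N C by (rule cstar_ideal.intro[OF ideal_N])

definition cl where "cl s = N +>\<^bsub>C\<^esub> s"

lemma cl_eq_iff: "s \<in> carrier C \<Longrightarrow> t \<in> carrier C \<Longrightarrow> cl s = cl t \<longleftrightarrow> (\<lambda>k. s k - t k) \<in> N"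
  using N.coset_eq_iff[of s t] by (simp add: cl_def C_diff)

lemma U_carrier: "carrier U = cl ` carrier C"
  by (simp add: cstar_quot_simps cl_def)

lemma cnorm_C_cong:
  assumes "s \<in> carrier C" "t \<in> carrier C" "(\<lambda>k. s k - t k) \<in> N" shows "cnorm C s = cnorm C t"
proof -
  have "cnorm C s \<le> cnorm C t" if "s \<in> carrier C" "t \<in> carrier C" "cnorm C (s \<ominus>\<^bsub>C\<^esub> t) = 0" for s t
  proof -
    have "s = (s \<ominus>\<^bsub>C\<^esub> t) \<oplus>\<^bsub>C\<^esub> t" using that by (simp add: C_diff C_ops)
    then show ?thesis using cnorm_C(2)[of "s \<ominus>\<^bsub>C\<^esub> t" t] that by simp
  qed
  moreover have "cnorm C (s \<ominus>\<^bsub>C\<^esub> t) = 0" using assms by (simp add: C_diff null_iff diff_cauchy)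
  moreover have "cnorm C (t \<ominus>\<^bsub>C\<^esub> s) = cnorm C ((-1) \<odot>\<^bsub>C\<^esub> (s \<ominus>\<^bsub>C\<^esub> t))" using assms
    by (simp add: C_diff) (simp add: C_ops cst_simps)
  ultimately show ?thesis using assms cnorm_C(4)[of "s \<ominus>\<^bsub>C\<^esub> t" s "-1"] by (simp add: antisym)
qed

lemma U_ops:
  shows "\<one>\<^bsub>U\<^esub> = cl (\<lambda>k. 1)" "\<zero>\<^bsub>U\<^esub> = cl (\<lambda>k. 0)"
    "\<lbrakk>s \<in> carrier C; t \<in> carrier C\<rbrakk> \<Longrightarrow> cl s \<oplus>\<^bsub>U\<^esub> cl t = cl (\<lambda>k. s k + t k)"
    "\<lbrakk>s \<in> carrier C; t \<in> carrier C\<rbrakk> \<Longrightarrow> cl s \<otimes>\<^bsub>U\<^esub> cl t = cl (\<lambda>k. s k * t k)"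
proof -
  show "\<one>\<^bsub>U\<^esub> = cl (\<lambda>k. 1)" by (simp add: cstar_quot_simps cl_def C_ops)
  have "cl \<zero>\<^bsub>C\<^esub> = N" unfolding cl_def using N.a_rcos_const[OF N.zero_closed] by simp
  then show "\<zero>\<^bsub>U\<^esub> = cl (\<lambda>k. 0)" by (simp add: cstar_quot_simps C_ops)
  assume "s \<in> carrier C" "t \<in> carrier C"
  then show "cl s \<oplus>\<^bsub>U\<^esub> cl t = cl (\<lambda>k. s k + t k)" "cl s \<otimes>\<^bsub>U\<^esub> cl t = cl (\<lambda>k. s k * t k)"
    unfolding cl_def using N.cstar_quot_ops by (simp_all add: C_ops)
qed

lemma U_unary_ops:
  assumes "s \<in> carrier C"
  shows "c \<odot>\<^bsub>U\<^esub> cl s = cl (\<lambda>k. cst c * s k)"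
    "star U (cl s) = cl (\<lambda>k. adj (s k))" "cnorm U (cl s) = cnorm C s"
proof -
  show "c \<odot>\<^bsub>U\<^esub> cl s = cl (\<lambda>k. cst c * s k)"
    unfolding cstar_quot_simps cl_def C_ops
  proof (rule N.coset_Union[OF assms])
    fix z assume z: "z \<in> carrier C" "z \<ominus>\<^bsub>C\<^esub> s \<in> N"
    then have "cnorm C (c \<odot>\<^bsub>C\<^esub> (z \<ominus>\<^bsub>C\<^esub> s)) = 0" using assms cnorm_C(4)[of "z \<ominus>\<^bsub>C\<^esub> s" s c] null_iff by auto
    then have "(\<lambda>k. cst c * z k - cst c * s k) \<in> N" using z assms
      by (subst null_iff) (simp_all add: scale_cauchy diff_cauchy C_diff C_ops algebra_simps)
    then show "N +>\<^bsub>C\<^esub> (\<lambda>k. cst c * z k) = N +>\<^bsub>C\<^esub> (\<lambda>k. cst c * s k)"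
      using cl_eq_iff[of "\<lambda>k. cst c * z k" "\<lambda>k. cst c * s k"] z assms by (simp add: cl_def scale_cauchy)
  qed
  show "star U (cl s) = cl (\<lambda>k. adj (s k))"
    unfolding cstar_quot_simps cl_def C_ops
  proof (rule N.coset_Union[OF assms])
    fix z assume z: "z \<in> carrier C" "z \<ominus>\<^bsub>C\<^esub> s \<in> N"
    then have "cnorm C (star C (z \<ominus>\<^bsub>C\<^esub> s)) = 0" using assms cnorm_C(5)[of "z \<ominus>\<^bsub>C\<^esub> s" s] null_iff by auto
    then have "(\<lambda>k. adj (z k) - adj (s k)) \<in> N" using z assms
      by (subst null_iff) (simp_all add: adj_cauchy diff_cauchy C_diff C_ops adj_diff)
    then show "N +>\<^bsub>C\<^esub> (\<lambda>k. adj (z k)) = N +>\<^bsub>C\<^esub> (\<lambda>k. adj (s k))"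
      using cl_eq_iff[of "\<lambda>k. adj (z k)" "\<lambda>k. adj (s k)"] z assms by (simp add: cl_def adj_cauchy)
  qed
  have "cnorm C z = cnorm C s" if "z \<in> cl s" for z
    using that assms N.a_rcos_module_minus[OF ring_C assms, of z] C.a_r_coset_subset_G[OF N.a_subset assms]
    unfolding cl_def by (intro cnorm_C_cong) (auto simp flip: C_diff)
  then have "cnorm C ` cl s = {cnorm C s}" using N.a_rcos_self[OF assms] unfolding cl_def by blast
  then show "cnorm U (cl s) = cnorm C s" by (simp add: cstar_quot_simps)
qed

lemma ring_U: "ring U"
  by (rule N.ring_cstar_quot)

sublocale U: ring U by (rule ring_U)

lemma U_diff: "s \<in> carrier C \<Longrightarrow> t \<in> carrier C \<Longrightarrow> cl s \<ominus>\<^bsub>U\<^esub> cl t = cl (\<lambda>k. s k - t k)"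
proof -
  assume st: "s \<in> carrier C" "t \<in> carrier C"
  have "\<ominus>\<^bsub>U\<^esub> cl t = cl (\<lambda>k. - t k)"
    by (rule U.minus_equality) (use st in \<open>auto simp: U_carrier U_ops U_unary_ops minus_cauchy\<close>)
  with st show ?thesis by (simp add: U.minus_eq U_ops U_unary_ops minus_cauchy)
qed

lemma cnorm_const: "f \<in> star_polys G \<Longrightarrow> cnorm U (cl (\<lambda>k. f)) = p f"
  using p_convergent[OF const_cauchy[of f]] by (simp add: U_ops U_unary_ops const_cauchy LIMSEQ_const_iff)

lemma const_dense:
  assumes s: "s \<in> carrier C" shows "(\<lambda>k. cnorm U (cl (\<lambda>_. s k) \<ominus>\<^bsub>U\<^esub> cl s)) \<longlonglongrightarrow> 0"
proof (rule LIMSEQ_I)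
  fix e :: real assume "0 < e"
  then obtain N where N: "\<And>k l. k \<ge> N \<Longrightarrow> l \<ge> N \<Longrightarrow> p (s k - s l) < e / 2" using cauchyD(2)[OF s, of "e/2"] by auto
  have "cnorm U (cl (\<lambda>_. s k) \<ominus>\<^bsub>U\<^esub> cl s) \<le> e / 2" if "k \<ge> N" for k
  proof -
    have c: "(\<lambda>l. s k - s l) \<in> carrier C" by (intro diff_cauchy const_cauchy cauchyD(1) s)
    have "cnorm C (\<lambda>l. s k - s l) \<le> e / 2"
      by (rule LIMSEQ_le_const2[OF p_convergent[OF c]]) (use N that less_imp_le in blast)
    then show ?thesis by (simp add: U_diff const_cauchy cauchyD s U_ops U_unary_ops c)
  qed
  moreover have "0 \<le> cnorm U (cl (\<lambda>_. s k) \<ominus>\<^bsub>U\<^esub> cl s)" for k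
    using cnorm_C(1)[of "\<lambda>l. s k - s l" s]
    by (simp add: U_diff U_ops U_unary_ops diff_cauchy const_cauchy cauchyD s)
  ultimately have "\<forall>k\<ge>N. norm (cnorm U (cl (\<lambda>_. s k) \<ominus>\<^bsub>U\<^esub> cl s) - 0) < e"
    using \<open>0 < e\<close> by fastforce
  then show "\<exists>N. \<forall>k\<ge>N. norm (cnorm U (cl (\<lambda>_. s k) \<ominus>\<^bsub>U\<^esub> cl s) - 0) < e" ..
qed

lemma U_triangle: "x \<in> carrier U \<Longrightarrow> y \<in> carrier U \<Longrightarrow> cnorm U (x \<oplus>\<^bsub>U\<^esub> y) \<le> cnorm U x + cnorm U y"
  using cnorm_C(2) by (auto simp: U_carrier U_ops U_unary_ops add_cauchy C_ops)

lemma U_diff_triangle: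
  assumes "x \<in> carrier U" "y \<in> carrier U" "z \<in> carrier U"
  shows "cnorm U (x \<ominus>\<^bsub>U\<^esub> z) \<le> cnorm U (x \<ominus>\<^bsub>U\<^esub> y) + cnorm U (y \<ominus>\<^bsub>U\<^esub> z)"
proof -
  have "x \<ominus>\<^bsub>U\<^esub> z = (x \<ominus>\<^bsub>U\<^esub> y) \<oplus>\<^bsub>U\<^esub> (y \<ominus>\<^bsub>U\<^esub> z)"
    using assms by (simp add: U.minus_eq U.a_assoc) (simp add: U.l_neg flip: U.a_assoc)
  then show ?thesis using U_triangle[of "x \<ominus>\<^bsub>U\<^esub> y" "y \<ominus>\<^bsub>U\<^esub> z"] assms by simp
qed

text \<open>
  Constant sequences are dense, so there are polynomials \<open>t\<^sub>k\<close> within \<open>1 / (k + 1)\<close> of the \<open>k\<close>-th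
  term. They form a Cauchy sequence, and its class is the limit.
\<close>

lemma U_complete:
  assumes X: "range X \<subseteq> carrier U"
    and Cau: "\<And>\<epsilon>. 0 < \<epsilon> \<Longrightarrow> \<exists>N. \<forall>k\<ge>N. \<forall>l\<ge>N. cnorm U (X k \<ominus>\<^bsub>U\<^esub> X l) < \<epsilon>"
  shows "\<exists>a\<in>carrier U. (\<lambda>k::nat. cnorm U (X k \<ominus>\<^bsub>U\<^esub> a)) \<longlonglongrightarrow> 0"
proof -
  have comm: "cnorm U (x \<ominus>\<^bsub>U\<^esub> y) = cnorm U (y \<ominus>\<^bsub>U\<^esub> x)" if xy: "x \<in> carrier U" "y \<in> carrier U" for x y
  proof -
    obtain s t where st: "s \<in> carrier C" "t \<in> carrier C" "x = cl s" "y = cl t" using xy by (auto simp: U_carrier)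
    have "(-1) \<odot>\<^bsub>C\<^esub> (\<lambda>k. s k - t k) = (\<lambda>k. t k - s k)" by (simp add: C_ops cst_simps)
    then show ?thesis using cnorm_C(4)[of "\<lambda>k. s k - t k" s "-1"] st by (simp add: U_diff U_ops U_unary_ops diff_cauchy)
  qed
  have "\<exists>f. f \<in> star_polys G \<and> cnorm U (cl (\<lambda>_. f) \<ominus>\<^bsub>U\<^esub> X k) < 1 / Suc k" for k
  proof -
    from X obtain s where s: "s \<in> carrier C" "X k = cl s" by (auto simp: U_carrier)
    from LIMSEQ_D[OF const_dense[OF s(1)], of "1 / Suc k"] obtain n where "norm (cnorm U (cl (\<lambda>_. s n) \<ominus>\<^bsub>U\<^esub> cl s) - 0) < 1 / Suc k"
      by auto
    then show ?thesis using s cauchyD(1)[OF s(1)] by (intro exI[of _ "s n"]) auto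
  qed
  then obtain t where t: "\<And>k. t k \<in> star_polys G" "\<And>k. cnorm U (cl (\<lambda>_. t k) \<ominus>\<^bsub>U\<^esub> X k) < 1 / Suc k" by metis
  define K where "K k = cl (\<lambda>_. t k)" for k
  have K: "K k \<in> carrier U" and XU: "X k \<in> carrier U" for k using t(1) X by (auto simp: K_def U_carrier const_cauchy)
  have tC: "t \<in> carrier C"
  proof (rule cauchyI)
    fix e :: real assume e: "0 < e"
    then obtain N where N: "\<And>k l. k \<ge> N \<Longrightarrow> l \<ge> N \<Longrightarrow> cnorm U (X k \<ominus>\<^bsub>U\<^esub> X l) < e / 3" using Cau[of "e/3"] by auto
    obtain M where M: "1 / Suc M < e / 3" using e nat_approx_posE[of "e/3"] by auto
    have "p (t k - t l) < e" if kl: "k \<ge> max N M" "l \<ge> max N M" for k l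
    proof -
      have "p (t k - t l) = cnorm U (K k \<ominus>\<^bsub>U\<^esub> K l)" using t(1) by (simp add: K_def U_diff const_cauchy cnorm_const star_polys_closed)
      also have "\<dots> \<le> cnorm U (K k \<ominus>\<^bsub>U\<^esub> X k) + (cnorm U (X k \<ominus>\<^bsub>U\<^esub> X l) + cnorm U (X l \<ominus>\<^bsub>U\<^esub> K l))"
        using U_diff_triangle[OF K XU K] U_diff_triangle[OF XU XU K] by (meson add_left_mono order_trans)
      also have "\<dots> < e / 3 + (e / 3 + e / 3)"
      proof -
        have "1 / Suc k \<le> 1 / Suc M" "1 / Suc l \<le> 1 / Suc M" using kl by (auto intro!: divide_left_mono)
        then show ?thesis using t(2)[of k] t(2)[of l] N[of k l] M kl comm[OF XU K, of l l] unfolding K_def[symmetric] by linarith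
      qed
      finally show ?thesis by simp
    qed
    then show "\<exists>N. \<forall>k\<ge>N. \<forall>l\<ge>N. p (t k - t l) < e" by blast
  qed (rule t)
  show ?thesis
  proof (rule bexI[of _ "cl t"])
    show clt: "cl t \<in> carrier U" using tC by (simp add: U_carrier)
    show "(\<lambda>k. cnorm U (X k \<ominus>\<^bsub>U\<^esub> cl t)) \<longlonglongrightarrow> 0"
    proof (rule tendsto_sandwich[of "\<lambda>_. 0"])
      show "(\<lambda>k. 1 / Suc k + cnorm U (K k \<ominus>\<^bsub>U\<^esub> cl t)) \<longlonglongrightarrow> 0"
        using tendsto_add[OF LIMSEQ_Suc[OF lim_1_over_n] const_dense[OF tC]] by (simp add: K_def)
      show "\<forall>\<^sub>F k in sequentially. cnorm U (X k \<ominus>\<^bsub>U\<^esub> cl t) \<le> 1 / Suc k + cnorm U (K k \<ominus>\<^bsub>U\<^esub> cl t)"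
      proof (rule always_eventually, rule allI)
        fix k
        show "cnorm U (X k \<ominus>\<^bsub>U\<^esub> cl t) \<le> 1 / Suc k + cnorm U (K k \<ominus>\<^bsub>U\<^esub> cl t)"
          using U_diff_triangle[OF XU[of k] K[of k] clt] t(2)[of k] comm[OF XU[of k] K[of k]] unfolding K_def by linarith
      qed
      have "0 \<le> cnorm U x" if "x \<in> carrier U" for x using that cnorm_C(1) by (auto simp: U_carrier U_ops U_unary_ops)
      then show "\<forall>\<^sub>F k in sequentially. 0 \<le> cnorm U (X k \<ominus>\<^bsub>U\<^esub> cl t)" using XU clt by simp
    qed simp
  qed
qed

lemma cstar_record_U: "cstar_record U"
proof (rule cstar_record.intro[OF ring_U], rule cstar_record_axioms.intro)
  fix x y :: "(nat \<Rightarrow> 'g star_poly) set" and c d :: complex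
  note simps = U_carrier U_ops U_unary_ops add_cauchy mult_cauchy scale_cauchy adj_cauchy const_cauchy
  assume "x \<in> carrier U"
  then obtain s where s: "s \<in> carrier C" "x = cl s" by (auto simp: U_carrier)
  show "c \<odot>\<^bsub>U\<^esub> x \<in> carrier U" "star U x \<in> carrier U"
    "(c + d) \<odot>\<^bsub>U\<^esub> x = c \<odot>\<^bsub>U\<^esub> x \<oplus>\<^bsub>U\<^esub> d \<odot>\<^bsub>U\<^esub> x" "c \<odot>\<^bsub>U\<^esub> (d \<odot>\<^bsub>U\<^esub> x) = (c * d) \<odot>\<^bsub>U\<^esub> x" "1 \<odot>\<^bsub>U\<^esub> x = x"
    "star U (star U x) = x"
    using s by (simp_all add: simps cst_simps distrib_right mult.assoc)
  show "star U (c \<odot>\<^bsub>U\<^esub> x) = cnj c \<odot>\<^bsub>U\<^esub> star U x"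
    using s by (simp add: simps adj_mult cst_simps(6) cst_commute[of "adj _"])
  show "cnorm U (c \<odot>\<^bsub>U\<^esub> x) = cmod c * cnorm U x" "0 \<le> cnorm U x" "cnorm U (star U x \<otimes>\<^bsub>U\<^esub> x) = (cnorm U x)\<^sup>2"
    using s cnorm_C[OF s(1) s(1)] by (auto simp: simps C_ops)
  show "x = \<zero>\<^bsub>U\<^esub>" if "cnorm U x = 0"
  proof -
    have "s \<in> N" using that s by (simp add: simps null_iff)
    then show ?thesis using s cl_eq_iff[of s "\<lambda>k. 0"] by (simp add: simps)
  qed
  assume "y \<in> carrier U"
  then obtain t where t: "t \<in> carrier C" "y = cl t" by (auto simp: U_carrier)
  show "c \<odot>\<^bsub>U\<^esub> (x \<oplus>\<^bsub>U\<^esub> y) = c \<odot>\<^bsub>U\<^esub> x \<oplus>\<^bsub>U\<^esub> c \<odot>\<^bsub>U\<^esub> y" "star U (x \<oplus>\<^bsub>U\<^esub> y) = star U x \<oplus>\<^bsub>U\<^esub> star U y"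
    using s t by (auto simp: simps adj_add algebra_simps)
  show "c \<odot>\<^bsub>U\<^esub> x \<otimes>\<^bsub>U\<^esub> y = c \<odot>\<^bsub>U\<^esub> (x \<otimes>\<^bsub>U\<^esub> y)" "star U (x \<otimes>\<^bsub>U\<^esub> y) = star U y \<otimes>\<^bsub>U\<^esub> star U x"
    using s t by (auto simp: simps adj_mult mult.assoc)
  have "s k * (cst c * t k) = cst c * (s k * t k)" for k by (metis cst_commute mult.assoc)
  then show "x \<otimes>\<^bsub>U\<^esub> (c \<odot>\<^bsub>U\<^esub> y) = c \<odot>\<^bsub>U\<^esub> (x \<otimes>\<^bsub>U\<^esub> y)" using s t by (simp add: simps)
  show "cnorm U (x \<oplus>\<^bsub>U\<^esub> y) \<le> cnorm U x + cnorm U y" "cnorm U (x \<otimes>\<^bsub>U\<^esub> y) \<le> cnorm U x * cnorm U y"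
    using s t cnorm_C[OF s(1) t(1)] by (auto simp: simps C_ops)
qed (rule U_complete)

end

section \<open>Homomorphisms and generators\<close>

text \<open>
  A homomorphism between corners \<open>e A\<close> and \<open>f B\<close>, extended to \<open>A\<close> by \<open>x \<mapsto> F (e x)\<close>: it is defined
  everywhere, but the image of the unit is \<open>f\<close>. Contractivity is part of the definition.
\<close>

definition star_hom :: "('a::unital_cstar \<Rightarrow> 'b::unital_cstar) \<Rightarrow> bool"
  where "star_hom F \<longleftrightarrow> (\<forall>x y. F (x + y) = F x + F y) \<and> (\<forall>x y. F (x * y) = F x * F y) \<and>
    (\<forall>x. F (x\<^sup>\<star>) = (F x)\<^sup>\<star>) \<and> (\<forall>c x. F (c *\<^sub>C x) = c *\<^sub>C F x) \<and> (\<forall>x. norm (F x) \<le> norm x)"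

lemma star_homD:
  assumes "star_hom F"
  shows "F (x + y) = F x + F y" "F (x * y) = F x * F y" "F (x\<^sup>\<star>) = (F x)\<^sup>\<star>" "F (c *\<^sub>C x) = c *\<^sub>C F x"
    "norm (F x) \<le> norm x" "F 0 = 0" "F (- x) = - F x" "F (x - y) = F x - F y" "F (r *\<^sub>R x) = r *\<^sub>R F x"
proof -
  note F = assms[unfolded star_hom_def]
  show *: "F (x + y) = F x + F y" "F (x * y) = F x * F y" "F (x\<^sup>\<star>) = (F x)\<^sup>\<star>" "F (c *\<^sub>C x) = c *\<^sub>C F x"
    "norm (F x) \<le> norm x" for c x y using F by blast+
  show "F 0 = 0" using *(4)[of 0 0] by simp
  show m: "F (- x) = - F x" for x using *(4)[of "-1" x] by simp
  show "F (x - y) = F x - F y" using *(1)[of x "- y"] m by simp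
  show "F (r *\<^sub>R x) = r *\<^sub>R F x" using *(4)[of "complex_of_real r" x] by (simp add: cscale_of_real)
qed

lemma star_hom_continuous: 
  assumes "star_hom F" shows "continuous_on A F"
proof (rule continuous_on_subset[OF _ subset_UNIV], rule lipschitz_on_continuous_on)
  show "1-lipschitz_on UNIV F"
    by (rule lipschitz_onI) (simp_all add: dist_norm star_homD(5)[OF assms] flip: star_homD(8)[OF assms])
qed

lemma star_hom_tendsto: "star_hom F \<Longrightarrow> (f \<longlongrightarrow> a) net \<Longrightarrow> ((\<lambda>x. F (f x)) \<longlongrightarrow> F a) net"
  using continuous_on_tendsto_compose[OF star_hom_continuous[of F UNIV]] by simp

lemma star_hom_pos: "star_hom F \<Longrightarrow> pos a \<Longrightarrow> pos (F a)"
proof -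
  assume F: "star_hom F" and "pos a"
  then obtain h where h: "h\<^sup>\<star> = h" "a = h * h" by (auto simp: pos_def)
  have "(F h)\<^sup>\<star> = F h" using star_homD(3)[OF F, of h] h(1) by simp
  then show "pos (F a)" by (simp add: h(2) star_homD(2)[OF F] pos_square)
qed

lemma star_hom_id: "star_hom (\<lambda>x. x)"
  by (simp add: star_hom_def)

lemma star_hom_compose:
  assumes F: "star_hom F" and G: "star_hom G" shows "star_hom (\<lambda>x. F (G x))"
proof -
  have "norm (F (G x)) \<le> norm x" for x
    using star_homD(5)[OF F, of "G x"] star_homD(5)[OF G, of x] by linarith
  then show ?thesis
    unfolding star_hom_def by (simp add: star_homD(1-4)[OF F] star_homD(1-4)[OF G])
qed

text \<open>
  The corner of \<open>e\<close> is generated, as a C*-algebra with unit \<open>e\<close>, by \<open>S\<close>. The formulation is the induction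
  principle in which this is used; including the adjoints of the generators in \<open>Q\<close> replaces closure under
  the involution.
\<close>

definition generates :: "'a::unital_cstar \<Rightarrow> 'a set \<Rightarrow> bool"
  where "generates e S \<longleftrightarrow> (\<forall>Q. closed Q \<longrightarrow> e \<in> Q \<longrightarrow> S \<subseteq> Q \<longrightarrow> dag ` S \<subseteq> Q \<longrightarrow>
    (\<forall>x\<in>Q. \<forall>y\<in>Q. x + y \<in> Q) \<longrightarrow> (\<forall>x\<in>Q. \<forall>y\<in>Q. x * y \<in> Q) \<longrightarrow> (\<forall>c. \<forall>x\<in>Q. c *\<^sub>C x \<in> Q) \<longrightarrow>
    (\<forall>a. e * a \<in> Q))"

lemma generates_induct:
  assumes "generates e S" "closed Q" "e \<in> Q" "\<And>g. g \<in> S \<Longrightarrow> g \<in> Q" "\<And>g. g \<in> S \<Longrightarrow> g\<^sup>\<star> \<in> Q"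
    "\<And>x y. x \<in> Q \<Longrightarrow> y \<in> Q \<Longrightarrow> x + y \<in> Q" "\<And>x y. x \<in> Q \<Longrightarrow> y \<in> Q \<Longrightarrow> x * y \<in> Q"
    "\<And>c x. x \<in> Q \<Longrightarrow> c *\<^sub>C x \<in> Q"
  shows "e * a \<in> Q"
proof -
  have "S \<subseteq> Q" "dag ` S \<subseteq> Q" using assms(4,5) by auto
  then show ?thesis
    by (intro assms(1)[unfolded generates_def, rule_format, of Q] assms(2,3,6-8))
qed

text \<open>
  Modulo an ideal, products of congruent elements are congruent, so the elements at which \<open>P\<close> and \<open>R\<close>
  agree modulo \<open>J\<close> form a closed subalgebra.
\<close>

lemma homs_agree_mod_ideal:
  assumes gen: "generates e S" and P: "star_hom P" and R: "star_hom R" and J: "closed_ideal_of J"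
    and e: "P e - R e \<in> J" and S: "\<And>g. g \<in> S \<Longrightarrow> P g - R g \<in> J" "\<And>g. g \<in> S \<Longrightarrow> P (g\<^sup>\<star>) - R (g\<^sup>\<star>) \<in> J"
  shows "P (e * a) - R (e * a) \<in> J"
proof -
  note J' = closed_ideal_ofD[OF J] and h = star_homD[OF P] star_homD[OF R]
  have "e * a \<in> {a. P a - R a \<in> J}"
  proof (rule generates_induct[OF gen])
    have "isCont (\<lambda>a. P a - R a) x" for x
      unfolding isCont_def
      by (rule tendsto_diff[OF star_hom_tendsto[OF P tendsto_ident_at] star_hom_tendsto[OF R tendsto_ident_at]])
    then show "closed {a. P a - R a \<in> J}"
      using continuous_closed_vimage[OF J'(1), of "\<lambda>a. P a - R a"] by (simp add: vimage_def)
  next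
    fix x y c assume "x \<in> {a. P a - R a \<in> J}"
    note x = this[unfolded mem_Collect_eq]
    have "c *\<^sub>C (P x - R x) \<in> J" by (rule J'(8)[OF x])
    then show "c *\<^sub>C x \<in> {a. P a - R a \<in> J}" by (simp add: h cscale_diff_right)
    assume "y \<in> {a. P a - R a \<in> J}"
    note y = this[unfolded mem_Collect_eq]
    have "(P x - R x) + (P y - R y) \<in> J" by (rule J'(3)[OF x y])
    then show "x + y \<in> {a. P a - R a \<in> J}" by (simp add: h algebra_simps)
    have "(P x - R x) * P y + R x * (P y - R y) \<in> J" by (rule J'(3)[OF J'(5)[OF x] J'(4)[OF y]])
    then show "x * y \<in> {a. P a - R a \<in> J}" by (simp add: h algebra_simps)
  qed (simp_all add: e S)
  then show ?thesis by simp
qed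

lemma closed_ideal_zero: "closed_ideal_of {0}"
  by (simp add: closed_ideal_of_def)

section \<open>Evaluation of polynomials\<close>

fun letter_value :: "('g \<Rightarrow> 'a::unital_cstar) \<Rightarrow> 'g letter \<Rightarrow> 'a"
  where
    "letter_value c (Gen g) = c g"
  | "letter_value c (Adj g) = (c g)\<^sup>\<star>"

text \<open>The empty word takes the value \<open>e\<close>, the unit of a corner that contains all values.\<close>

definition word_value :: "'a::unital_cstar \<Rightarrow> ('g \<Rightarrow> 'a) \<Rightarrow> 'g star_word \<Rightarrow> 'a"
  where "word_value e c w = e * prod_list (map (letter_value c) (letters w))"

definition eval_poly :: "'a::unital_cstar \<Rightarrow> ('g \<Rightarrow> 'a) \<Rightarrow> 'g star_poly \<Rightarrow> 'a"
  where "eval_poly e c f = (\<Sum>w\<in>Poly_Mapping.keys f. Poly_Mapping.lookup f w *\<^sub>C word_value e c w)"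

locale corner_values =
  fixes e :: "'a::unital_cstar" and c :: "'g \<Rightarrow> 'a"
  assumes e_dag: "e\<^sup>\<star> = e" and e_e: "e * e = e" and e_c: "e * c g = c g" and c_e: "c g * e = c g"
begin

abbreviation "ev \<equiv> eval_poly e c"

lemma e_letter: "e * letter_value c l = letter_value c l" "letter_value c l * e = letter_value c l"
proof -
  have "(c g)\<^sup>\<star> * e = (c g)\<^sup>\<star>" "e * (c g)\<^sup>\<star> = (c g)\<^sup>\<star>" for g
    using arg_cong[OF e_c[of g], of dag] arg_cong[OF c_e[of g], of dag] by (simp_all add: e_dag)
  then show "e * letter_value c l = letter_value c l" "letter_value c l * e = letter_value c l"
    by (cases l; simp add: e_c c_e)+
qed

lemma e_letters: "e * prod_list (map (letter_value c) ls) * e = e * prod_list (map (letter_value c) ls)"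
proof (induct ls)
  case (Cons l ls)
  have "e * prod_list (map (letter_value c) (l # ls)) * e
      = letter_value c l * (e * prod_list (map (letter_value c) ls) * e)"
    by (simp add: e_letter flip: mult.assoc)
  also have "\<dots> = e * prod_list (map (letter_value c) (l # ls))"
    by (simp add: Cons e_letter flip: mult.assoc)
  finally show ?case .
qed (simp add: e_e)

lemma word_value_add: "word_value e c (v + w) = word_value e c v * word_value e c w"
  using e_letters[of "letters v"] by (simp add: word_value_def plus_star_word_def flip: mult.assoc)

lemma word_value_e: "e * word_value e c w = word_value e c w"
  by (simp add: word_value_def e_e flip: mult.assoc)

lemma word_value_adj: "word_value e c (adj_word w) = (word_value e c w)\<^sup>\<star>"
proof -
  have "letter_value c (adj_letter l) = (letter_value c l)\<^sup>\<star>" for l by (cases l) simp_all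
  then have 1: "prod_list (map (letter_value c) (rev (map adj_letter ls))) = (prod_list (map (letter_value c) ls))\<^sup>\<star>" for ls
    by (induct ls) (simp_all add: comp_def)
  have "word_value e c w = word_value e c w * e"
    using e_letters[of "letters w"] by (simp add: word_value_def)
  then have "(word_value e c w)\<^sup>\<star> = e * (word_value e c w)\<^sup>\<star>" by (metis dag_mult e_dag)
  also have "\<dots> = e * ((prod_list (map (letter_value c) (letters w)))\<^sup>\<star> * e)" by (simp add: word_value_def e_dag)
  also have "\<dots> = e * prod_list (map (letter_value c) (rev (map adj_letter (letters w)))) * e" by (simp only: 1 mult.assoc)
  also have "\<dots> = word_value e c (adj_word w)" unfolding e_letters by (simp add: word_value_def adj_word_def)
  finally show ?thesis by simp
qed

lemma ev_superset: "finite S \<Longrightarrow> Poly_Mapping.keys f \<subseteq> S \<Longrightarrow> ev f = (\<Sum>w\<in>S. Poly_Mapping.lookup f w *\<^sub>C word_value e c w)"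
  unfolding eval_poly_def by (rule sum.mono_neutral_left) (auto simp: in_keys_iff)

lemma ev_add: "ev (f + g) = ev f + ev g"
proof -
  let ?S = "Poly_Mapping.keys f \<union> Poly_Mapping.keys g"
  have "ev (f + g) = (\<Sum>w\<in>?S. Poly_Mapping.lookup (f + g) w *\<^sub>C word_value e c w)"
    by (rule ev_superset) (use keys_add[of f g] in auto)
  also have "\<dots> = ev f + ev g"
    by (simp add: ev_superset[of ?S f] ev_superset[of ?S g] lookup_add cscale_add_left sum.distrib)
  finally show ?thesis .
qed

lemma ev_single: "ev (Poly_Mapping.single w a) = a *\<^sub>C word_value e c w"
  using ev_superset[of "{w}" "Poly_Mapping.single w a"] by simp

lemma ev_0: "ev 0 = 0"
  by (simp add: eval_poly_def)

lemma ev_mult: "ev (f * g) = ev f * ev g"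
proof (induct f rule: star_poly_induct)
  case (single v a)
  show ?case
    by (induct g rule: star_poly_induct)
      (simp_all add: ev_0 mult_single ev_single word_value_add ev_add algebra_simps)
qed (simp_all add: ev_0 ev_add algebra_simps)

lemma ev_adj: "ev (adj f) = (ev f)\<^sup>\<star>"
  by (induct f rule: star_poly_induct) (simp_all add: ev_0 ev_add adj_add adj_single ev_single word_value_adj)

lemma ev_cst: "ev (cst a) = a *\<^sub>C e"
  by (simp add: cst_def ev_single word_value_def zero_star_word_def)

lemma ev_gen: "ev (gen g) = c g"
  by (simp add: gen_def ev_single word_value_def e_c)

lemma ev_e: "e * ev f = ev f"
  by (induct f rule: star_poly_induct) (simp_all add: ev_0 ev_add ev_single word_value_e algebra_simps)

lemma ev_cst_mult: "ev (cst a * f) = a *\<^sub>C ev f"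
  by (simp add: ev_mult ev_cst ev_e)

lemma ev_one: "ev 1 = e"
  using ev_cst[of 1] by (simp add: cst_simps)

lemma ev_minus: "ev (- f) = - ev f"
  using ev_cst_mult[of "-1" f] by (simp add: cst_simps)

lemma ev_diff: "ev (f - g) = ev f - ev g"
  using ev_add[of f "- g"] by (simp add: ev_minus)

lemma ev_sum: "ev (\<Sum>i\<in>A. f i) = (\<Sum>i\<in>A. ev (f i))"
  by (induct A rule: infinite_finite_induct) (simp_all add: ev_0 ev_add)

lemmas ev_simps = ev_add ev_0 ev_mult ev_adj ev_cst_mult ev_cst ev_gen ev_one ev_minus ev_diff ev_sum

lemma cstar_seminorm_ev: "cstar_seminorm G (\<lambda>f. norm (ev f))"
  unfolding cstar_seminorm_def by (simp add: ev_simps ev_e cstar_identity norm_triangle_ineq norm_mult_ineq)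

end

section \<open>The completion as a corner\<close>

context poly_seminorm
begin

sublocale UR: cstar_record U by (rule cstar_record_U)

definition canon :: "'g star_poly \<Rightarrow> 'g univ family"
  where "canon f = embed U (cl (\<lambda>k. f))"

definition unit where "unit = embed U \<one>\<^bsub>U\<^esub>"

lemma cl_closed: "f \<in> star_polys G \<Longrightarrow> cl (\<lambda>k. f) \<in> carrier U"
  by (simp add: U_carrier const_cauchy)

lemma canon_simps:
  "f \<in> star_polys G \<Longrightarrow> g \<in> star_polys G \<Longrightarrow> canon (f + g) = canon f + canon g"
  "f \<in> star_polys G \<Longrightarrow> g \<in> star_polys G \<Longrightarrow> canon (f * g) = canon f * canon g"
  "f \<in> star_polys G \<Longrightarrow> g \<in> star_polys G \<Longrightarrow> canon (f - g) = canon f - canon g"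
  "f \<in> star_polys G \<Longrightarrow> canon (adj f) = (canon f)\<^sup>\<star>"
  "f \<in> star_polys G \<Longrightarrow> canon (cst a * f) = a *\<^sub>C canon f"
  "f \<in> star_polys G \<Longrightarrow> norm (canon f) = p f"
proof -
  show "canon (cst a * f) = a *\<^sub>C canon f" if "f \<in> star_polys G"
    by (simp only: canon_def UR.embed_hom(4)[OF cl_closed[OF that], symmetric] U_unary_ops(1)[OF const_cauchy[OF that]])
qed (simp_all add: canon_def cl_closed const_cauchy cnorm_const UR.norm_embed
      flip: UR.embed_hom U_ops U_unary_ops U_diff)

lemma canon_one: "canon 1 = unit"
  by (simp add: canon_def unit_def U_ops)

lemma canon_zero: "canon 0 = 0"
  using canon_simps(5)[of 0 0] by (simp add: cst_simps)

lemma canon_cst: "canon (cst a) = a *\<^sub>C unit"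
  using canon_simps(5)[of 1 a] by (simp add: canon_one)

lemma canon_sum: "(\<And>i. i \<in> A \<Longrightarrow> f i \<in> star_polys G) \<Longrightarrow> canon (\<Sum>i\<in>A. f i) = (\<Sum>i\<in>A. canon (f i)) \<and> (\<Sum>i\<in>A. f i) \<in> star_polys G"
  by (induct A rule: infinite_finite_induct) (simp_all add: canon_zero canon_simps star_polys_closed)

lemma unit_mult: "unit * x = embed U (component x U)" "x * unit = embed U (component x U)"
  by (simp_all add: unit_def UR.embed_one_mult)

lemma unit_canon: "f \<in> star_polys G \<Longrightarrow> unit * canon f = canon f" "f \<in> star_polys G \<Longrightarrow> canon f * unit = canon f"
  using canon_simps(2)[of 1 f] canon_simps(2)[of f 1] by (simp_all add: canon_one)

lemma unit_props: "unit\<^sup>\<star> = unit" "unit * unit = unit" "unit * x = x * unit"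
proof -
  show "unit\<^sup>\<star> = unit" using canon_simps(4)[of 1] by (simp add: canon_one)
  show "unit * unit = unit" using canon_simps(2)[of 1 1] by (simp add: canon_one)
  show "unit * x = x * unit" by (simp only: unit_mult)
qed

lemma canon_dense:
  obtains s where "\<And>k. s k \<in> star_polys G" "(\<lambda>k. canon (s k)) \<longlonglongrightarrow> unit * x"
proof -
  from component_closed[OF UR.rec, of x] obtain s where s: "s \<in> carrier C" "component x U = cl s" by (auto simp: U_carrier)
  have cls: "cl s \<in> carrier U" "cl (\<lambda>_. s k) \<in> carrier U" for k
    using s(1) cl_closed cauchyD(1) by (auto simp: U_carrier)
  have "(\<lambda>k. norm (canon (s k) - unit * x)) \<longlonglongrightarrow> 0"
    using const_dense[OF s(1)]
    by (simp add: canon_def unit_mult s(2) cls UR.norm_embed flip: UR.embed_hom(6))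
  then have "(\<lambda>k. canon (s k)) \<longlonglongrightarrow> unit * x" by (rule LIM_zero_cancel[OF tendsto_norm_zero_cancel])
  with cauchyD(1)[OF s(1)] show ?thesis by (rule that)
qed

lemma generates_canon: "generates unit ((\<lambda>g. canon (gen g)) ` G)"
  unfolding generates_def
proof (intro allI impI)
  fix Q x
  assume Q: "closed Q" "unit \<in> Q" "(\<lambda>g. canon (gen g)) ` G \<subseteq> Q" "dag ` (\<lambda>g. canon (gen g)) ` G \<subseteq> Q"
    "\<forall>x\<in>Q. \<forall>y\<in>Q. x + y \<in> Q" "\<forall>x\<in>Q. \<forall>y\<in>Q. x * y \<in> Q" "\<forall>c. \<forall>x\<in>Q. c *\<^sub>C x \<in> Q"
  have "canon f \<in> Q" if "f \<in> star_polys G" for f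
    using that by (induct rule: star_polys_induct) (use Q in \<open>auto simp: canon_cst canon_simps\<close>)
  moreover obtain s where s: "\<And>k. s k \<in> star_polys G" "(\<lambda>k. canon (s k)) \<longlonglongrightarrow> unit * x" using canon_dense by blast
  ultimately show "unit * x \<in> Q" by (intro closed_sequentially[OF Q(1) _ s(2)]) simp
qed

end

section \<open>Universal C*-algebras\<close>

lemma cstar_seminormD:
  assumes "cstar_seminorm G p" "x \<in> star_polys G" "y \<in> star_polys G"
  shows "0 \<le> p x" "p (cst c * x) = cmod c * p x" "p (adj x * x) = (p x)\<^sup>2" "p (x + y) \<le> p x + p y"
    "p (x * y) \<le> p x * p y"
  using assms unfolding cstar_seminorm_def by blast+

lemma seminorm_one_le: "cstar_seminorm G p \<Longrightarrow> p 1 \<le> 1"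
proof -
  assume "cstar_seminorm G p"
  from cstar_seminormD(3)[OF this, of 1 1] have "p 1 * (p 1 - 1) = 0"
    by (simp add: power2_eq_square algebra_simps)
  then show ?thesis by auto
qed

text \<open>
  The universal seminorm is a supremum; the bound on the generators makes it finite.
\<close>

locale universal =
  fixes G :: "'g set" and R H :: "'g star_poly set"
  assumes gen_bound: "\<exists>M. \<forall>p. admissible G R H p \<longrightarrow> (\<forall>g\<in>G. p (gen g) \<le> M)"
    and R_polys: "R \<subseteq> star_polys G"
begin

abbreviation "pu \<equiv> universal_seminorm G R H"

lemma admissible_bounded:
  assumes "f \<in> star_polys G"
  shows "\<exists>B. \<forall>p. admissible G R H p \<longrightarrow> p f \<le> B"
  using assms
proof (induct rule: star_polys_induct)
  case (cst a)
  have "p (cst a) \<le> cmod a" if "admissible G R H p" for p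
  proof -
    have s: "cstar_seminorm G p" using that by (simp add: admissible_def)
    show ?thesis using cstar_seminormD(2)[OF s, of 1 1 a] seminorm_one_le[OF s]
      by (simp add: mult_left_le)
  qed
  then show ?case by blast
next
  case (gen g)
  then show ?case using gen_bound by blast
next
  case (adj_gen g)
  have "p (adj (gen g)) = p (gen g)" if "admissible G R H p" for p
  proof -
    interpret poly_seminorm G p using that by unfold_locales (simp add: admissible_def)
    show ?thesis using adj_gen by (simp add: p_adj)
  qed
  then show ?case using gen_bound adj_gen by metis
next
  case (add f g)
  then obtain A B where AB: "\<And>p. admissible G R H p \<Longrightarrow> p f \<le> A" "\<And>p. admissible G R H p \<Longrightarrow> p g \<le> B" by blast
  have "p (f + g) \<le> A + B" if p: "admissible G R H p" for p
    using cstar_seminormD(4)[of G p f g] add(1,2) AB[OF p] p by (simp add: admissible_def)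
  then show ?case by blast
next
  case (mult f g)
  then obtain A B where AB: "\<And>p. admissible G R H p \<Longrightarrow> p f \<le> A" "\<And>p. admissible G R H p \<Longrightarrow> p g \<le> B" by blast
  have "p (f * g) \<le> A * B" if p: "admissible G R H p" for p
  proof -
    have s: "cstar_seminorm G p" using p by (simp add: admissible_def)
    have "p (f * g) \<le> p f * p g" by (rule cstar_seminormD(5)[OF s mult(1,2)])
    also have "\<dots> \<le> A * B"
      using AB[OF p] cstar_seminormD(1)[OF s mult(1,1)] cstar_seminormD(1)[OF s mult(2,2)] by (intro mult_mono) auto
    finally show ?thesis .
  qed
  then show ?case by blast
qed

lemma zero_admissible: "admissible G R H (\<lambda>_. 0)"
  by (auto simp: admissible_def cstar_seminorm_def intro!: exI[where x = 0])

lemma admissible_le: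
  assumes "admissible G R H p" "f \<in> star_polys G" shows "p f \<le> pu f"
proof -
  have "bdd_above ((\<lambda>p. p f) ` Collect (admissible G R H))"
    using admissible_bounded[OF assms(2)] by (fastforce intro: bdd_aboveI2)
  then show ?thesis unfolding universal_seminorm_def using assms(1) by (intro cSUP_upper) auto
qed

lemma pu_le:
  assumes "\<And>p. admissible G R H p \<Longrightarrow> p f \<le> B" shows "pu f \<le> B"
  unfolding universal_seminorm_def using zero_admissible assms by (intro cSUP_least) auto

lemma pu_ge_0: "f \<in> star_polys G \<Longrightarrow> 0 \<le> pu f"
  using admissible_le[OF zero_admissible] by simp

lemma pu_seminorm: "cstar_seminorm G pu"
  unfolding cstar_seminorm_def
proof (intro ballI conjI allI)
  fix x y :: "'g star_poly" and c assume x: "x \<in> star_polys G"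
  show "0 \<le> pu x" by (rule pu_ge_0[OF x])
  have s: "cstar_seminorm G p" if "admissible G R H p" for p using that by (simp add: admissible_def)
  have cx: "cst c * x \<in> star_polys G" for c using x by (simp add: star_polys_closed)
  have le: "pu (cst c * x) \<le> cmod c * pu x" if "x \<in> star_polys G" for c x
    by (rule pu_le) (auto simp: cstar_seminormD(2)[OF s that that] intro!: mult_left_mono admissible_le that)
  show "pu (cst c * x) = cmod c * pu x"
  proof (cases "c = 0")
    case True
    have "pu 0 = 0" using le[of 1 0] pu_ge_0[of 0] by (simp add: cst_simps)
    with True show ?thesis by (simp add: cst_simps)
  next
    case False
    have "pu x \<le> cmod (inverse c) * pu (cst c * x)"
      using le[OF cx, of "inverse c" c] False by (simp add: cst_simps flip: mult.assoc cst_simps(5))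
    then have "cmod c * pu x \<le> pu (cst c * x)" using False by (simp add: norm_divide field_simps)
    with le[OF x] show ?thesis by (simp add: antisym)
  qed
  show "pu (adj x * x) = (pu x)\<^sup>2"
  proof (rule antisym)
    show "pu (adj x * x) \<le> (pu x)\<^sup>2"
      by (rule pu_le) (auto simp: cstar_seminormD(3)[OF s x x] intro!: power_mono admissible_le x cstar_seminormD(1)[OF s x x])
    have "pu x \<le> sqrt (pu (adj x * x))"
    proof (rule pu_le)
      fix p assume p: "admissible G R H p"
      have "(p x)\<^sup>2 \<le> pu (adj x * x)"
        using admissible_le[OF p, of "adj x * x"] cstar_seminormD(3)[OF s[OF p] x x] x by (simp add: star_polys_closed)
      then show "p x \<le> sqrt (pu (adj x * x))" by (rule real_le_rsqrt)
    qed
    then have "(pu x)\<^sup>2 \<le> (sqrt (pu (adj x * x)))\<^sup>2" by (rule power_mono) (rule pu_ge_0[OF x])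
    then show "(pu x)\<^sup>2 \<le> pu (adj x * x)" using pu_ge_0[of "adj x * x"] x by (simp add: star_polys_closed)
  qed
  assume y: "y \<in> star_polys G"
  show "pu (x + y) \<le> pu x + pu y"
    by (rule pu_le) (auto intro!: order_trans[OF cstar_seminormD(4)[OF s x y]] add_mono admissible_le x y)
  show "pu (x * y) \<le> pu x * pu y"
  proof (rule pu_le)
    fix p assume p: "admissible G R H p"
    have "p (x * y) \<le> p x * p y" by (rule cstar_seminormD(5)[OF s[OF p] x y])
    also have "\<dots> \<le> pu x * pu y"
      by (intro mult_mono admissible_le[OF p] x y pu_ge_0 cstar_seminormD(1)[OF s[OF p] y y])
    finally show "p (x * y) \<le> pu x * pu y" .
  qed
qed

lemma pu_rel: "r \<in> R \<Longrightarrow> pu r = 0"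
  using R_polys by (intro antisym pu_le pu_ge_0) (auto simp: admissible_def)

end

sublocale universal \<subseteq> poly_seminorm G "universal_seminorm G R H"
  by unfold_locales (rule pu_seminorm)

context universal
begin

lemma universal_cstar_eq: "universal_cstar G R H = U"
  by (simp add: universal_cstar_def Let_def)

lemma universal_gen_eq: "universal_gen G R H g = cl (\<lambda>k. gen g)"
  by (simp add: universal_gen_def Let_def cl_def)

text \<open>
  The norm of the value of a polynomial is an admissible seminorm, hence dominated by the
  universal one, and evaluation extends by continuity. An inequality between elements is treated as an equation: its
  polynomial in \<open>H\<close> takes the value zero.
\<close>

theorem universal_property:
  fixes e :: "'b::unital_cstar"
  assumes "corner_values e c" and rel: "\<And>r. r \<in> R \<union> H \<Longrightarrow> eval_poly e c r = 0"
  obtains F where "star_hom F" "\<And>f. f \<in> star_polys G \<Longrightarrow> F (canon f) = eval_poly e c f" "\<And>x. F (unit * x) = F x"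
    "\<And>x. e * F x = F x"
proof -
  interpret corner_values e c by fact
  have "admissible G R H (\<lambda>f. norm (ev f))"
    using rel by (auto simp: admissible_def cstar_seminorm_ev intro!: bexI[where x = 0])
  then have le: "norm (ev f) \<le> norm (canon f)" if "f \<in> star_polys G" for f
    using admissible_le that by (simp add: canon_simps)
  define L where "L x y \<longleftrightarrow> (\<exists>s. (\<forall>k. s k \<in> star_polys G) \<and> (\<lambda>k. canon (s k)) \<longlonglongrightarrow> unit * x \<and> (\<lambda>k. ev (s k)) \<longlonglongrightarrow> y)" for x y
  have ex: "\<exists>y. L x y" for x
  proof -
    obtain s where s: "\<And>k. s k \<in> star_polys G" "(\<lambda>k. canon (s k)) \<longlonglongrightarrow> unit * x" using canon_dense by blast
    have "Cauchy (\<lambda>k. ev (s k))"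
    proof (rule CauchyI)
      fix \<epsilon> :: real assume "0 < \<epsilon>"
      then obtain M where M: "\<And>m n. m \<ge> M \<Longrightarrow> n \<ge> M \<Longrightarrow> norm (canon (s m) - canon (s n)) < \<epsilon>"
        using CauchyD[OF LIMSEQ_imp_Cauchy[OF s(2)]] by blast
      have "norm (ev (s m) - ev (s n)) < \<epsilon>" if "m \<ge> M" "n \<ge> M" for m n
        using le[of "s m - s n"] M[OF that] s(1) by (simp add: star_polys_closed canon_simps ev_simps)
      then show "\<exists>M. \<forall>m\<ge>M. \<forall>n\<ge>M. norm (ev (s m) - ev (s n)) < \<epsilon>" by blast
    qed
    then show ?thesis using s by (auto simp: Cauchy_convergent_iff convergent_def L_def)
  qed
  have un: "y = z" if "L x y" "L x z" for x y z
  proof -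
    from that(1) obtain s where s: "\<And>k. s k \<in> star_polys G" "(\<lambda>k. canon (s k)) \<longlonglongrightarrow> unit * x"
      "(\<lambda>k. ev (s k)) \<longlonglongrightarrow> y" unfolding L_def by blast
    from that(2) obtain t where t: "\<And>k. t k \<in> star_polys G" "(\<lambda>k. canon (t k)) \<longlonglongrightarrow> unit * x"
      "(\<lambda>k. ev (t k)) \<longlonglongrightarrow> z" unfolding L_def by blast
    have "(\<lambda>k. norm (canon (s k) - canon (t k))) \<longlonglongrightarrow> norm (unit * x - unit * x)" by (intro tendsto_intros s t)
    moreover have "(\<lambda>k. norm (ev (s k) - ev (t k))) \<longlonglongrightarrow> norm (y - z)" by (intro tendsto_intros s t)
    moreover have "norm (ev (s k) - ev (t k)) \<le> norm (canon (s k) - canon (t k))" for k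
      using le[of "s k - t k"] s(1) t(1) by (simp add: star_polys_closed canon_simps ev_simps)
    ultimately have "norm (y - z) \<le> norm (unit * x - unit * x)" by (intro LIMSEQ_le) auto
    then show ?thesis by simp
  qed
  define F where "F x = (SOME y. L x y)" for x
  have LF: "L x (F x)" for x unfolding F_def by (rule someI_ex[OF ex])
  have FI: "F x = y" if "L x y" for x y using un LF that by blast
  have seq: "\<exists>s. (\<forall>k. s k \<in> star_polys G) \<and> (\<lambda>k. canon (s k)) \<longlonglongrightarrow> unit * x \<and> (\<lambda>k. ev (s k)) \<longlonglongrightarrow> F x" for x
    using LF[of x] by (simp add: L_def)
  have hom: "star_hom F"
    unfolding star_hom_def
  proof (intro conjI allI)
    fix x y a
    obtain s where s: "\<And>k. s k \<in> star_polys G" "(\<lambda>k. canon (s k)) \<longlonglongrightarrow> unit * x" "(\<lambda>k. ev (s k)) \<longlonglongrightarrow> F x" using seq by blast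
    obtain t where t: "\<And>k. t k \<in> star_polys G" "(\<lambda>k. canon (t k)) \<longlonglongrightarrow> unit * y" "(\<lambda>k. ev (t k)) \<longlonglongrightarrow> F y" using seq by blast
    show "F (x + y) = F x + F y"
      by (rule FI) (unfold L_def, rule exI[of _ "\<lambda>k. s k + t k"],
        use s t tendsto_add[OF s(2) t(2)] tendsto_add[OF s(3) t(3)] in \<open>auto simp: star_polys_closed canon_simps ev_simps distrib_left\<close>)
    have "unit * (x * y) = unit * x * (unit * y)" by (metis mult.assoc unit_props(2,3))
    then show "F (x * y) = F x * F y"
      by (intro FI) (unfold L_def, rule exI[of _ "\<lambda>k. s k * t k"],
        use s t tendsto_mult[OF s(2) t(2)] tendsto_mult[OF s(3) t(3)] in \<open>auto simp: star_polys_closed canon_simps ev_simps\<close>)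
    have "unit * x\<^sup>\<star> = (unit * x)\<^sup>\<star>" using unit_props(1) unit_props(3)[of "x\<^sup>\<star>"] by simp
    then show "F (x\<^sup>\<star>) = (F x)\<^sup>\<star>"
      by (intro FI) (unfold L_def, rule exI[of _ "\<lambda>k. adj (s k)"],
        use s tendsto_dag[OF s(2)] tendsto_dag[OF s(3)] in \<open>auto simp: star_polys_closed canon_simps ev_simps\<close>)
    show "F (a *\<^sub>C x) = a *\<^sub>C F x"
      by (rule FI) (unfold L_def, rule exI[of _ "\<lambda>k. cst a * s k"],
        use s tendsto_cscale[OF s(2)] tendsto_cscale[OF s(3)] in \<open>auto simp: star_polys_closed canon_simps(5) ev_cst_mult\<close>)
    have "norm (F x) \<le> norm (unit * x)"
      by (rule LIMSEQ_le[OF tendsto_norm[OF s(3)] tendsto_norm[OF s(2)]]) (use le s(1) in blast)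
    also have "\<dots> \<le> norm x"
      using cnorm_component_le[OF UR.rec, of x] component_closed[OF UR.rec, of x] by (simp add: unit_mult UR.norm_embed)
    finally show "norm (F x) \<le> norm x" .
  qed
  show ?thesis
  proof (rule that[OF hom])
    show "F (canon f) = ev f" if "f \<in> star_polys G" for f
      by (rule FI) (unfold L_def, rule exI[of _ "\<lambda>k. f"], use that in \<open>simp add: unit_canon\<close>)
    show "F (unit * x) = F x" for x
      using LF[of x] by (intro FI) (simp add: L_def unit_props(2) flip: mult.assoc)
    show "e * F x = F x" for x
    proof -
      obtain s where s: "(\<lambda>k. ev (s k)) \<longlonglongrightarrow> F x" using seq by blast
      from tendsto_mult_left[OF s, of e] s show ?thesis by (simp add: ev_e LIMSEQ_unique)
    qed
  qed
qed

end

instance unital_cstar \<subseteq> banach ..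

text \<open>
  Indices start at 1, which must not be rewritten to a successor.
\<close>

declare One_nat_def [simp del]

section \<open>The ball relations\<close>

locale even_ball_relations =
  fixes q :: real and n :: nat and e :: "'a::unital_cstar" and z :: "nat \<Rightarrow> 'a"
  assumes q: "0 < q" "q < 1"
    and e_dag: "e\<^sup>\<star> = e" and e_e: "e * e = e"
    and e_z: "i \<in> {1..n} \<Longrightarrow> e * z i = z i" "i \<in> {1..n} \<Longrightarrow> z i * e = z i"
    and z_z: "\<lbrakk>1 \<le> i; i < j; j \<le> n\<rbrakk> \<Longrightarrow> z i * z j = sqrt q *\<^sub>R (z j * z i)"
    and z_zs: "\<lbrakk>1 \<le> i; i < j; j \<le> n\<rbrakk> \<Longrightarrow> z i * (z j)\<^sup>\<star> = (1 / sqrt q) *\<^sub>R ((z j)\<^sup>\<star> * z i)"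
    and zs_z: "i \<in> {1..n} \<Longrightarrow> (z i)\<^sup>\<star> * z i = q *\<^sub>R (z i * (z i)\<^sup>\<star>)
      + (1 - q) *\<^sub>R (e - (\<Sum>j\<in>{i+1..n}. z j * (z j)\<^sup>\<star>))"
begin

definition defect where "defect i = e - (\<Sum>j\<in>{i..n}. z j * (z j)\<^sup>\<star>)"

lemma defect_step: "i \<le> n \<Longrightarrow> defect i = defect (Suc i) - z i * (z i)\<^sup>\<star>"
  by (simp add: defect_def sum.atLeast_Suc_atMost algebra_simps)

lemma defect_commute: "i \<in> {1..n} \<Longrightarrow> defect (Suc i) * z i = z i * defect (Suc i)"
proof -
  assume i: "i \<in> {1..n}"
  have "z i * (z j * (z j)\<^sup>\<star>) = z j * (z j)\<^sup>\<star> * z i" if "j \<in> {Suc i..n}" for j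
  proof -
    have j: "1 \<le> i" "i < j" "j \<le> n" using that i by auto
    have "z i * (z j * (z j)\<^sup>\<star>) = z i * z j * (z j)\<^sup>\<star>" by (simp add: mult.assoc)
    also have "\<dots> = sqrt q *\<^sub>R (z j * (z i * (z j)\<^sup>\<star>))" by (simp add: z_z[OF j] mult.assoc)
    also have "\<dots> = z j * (z j)\<^sup>\<star> * z i" using q by (simp add: z_zs[OF j] mult.assoc)
    finally show ?thesis .
  qed
  then show ?thesis using e_z[OF i] by (simp add: defect_def algebra_simps sum_distrib_left sum_distrib_right)
qed

text \<open>
  The relation for \<open>z\<^sub>i\<close> bounds \<open>\<parallel>z\<^sub>i\<parallel>\<^sup>2\<close> by \<open>1 + S\<^sub>i\<^sub>+\<^sub>1\<close>, where \<open>S\<^sub>i\<close> is the sum of \<open>\<parallel>z\<^sub>j\<parallel>\<^sup>2\<close> over \<open>j \<ge> i\<close>.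
  Hence \<open>S\<^sub>i \<le> 2 S\<^sub>i\<^sub>+\<^sub>1 + 1\<close>.
\<close>

lemma norm_z_le:
  assumes "i \<in> {1..n}" shows "norm (z i) \<le> 2 ^ n"
proof -
  define S where "S i = (\<Sum>j\<in>{i..n}. (norm (z j))\<^sup>2)" for i
  have "norm e * norm e = norm e" using norm_self_adjoint_square[OF e_dag] e_e by (simp add: power2_eq_square)
  then have e1: "norm e \<le> 1" by (metis mult_cancel_right1 norm_zero order_refl zero_le_one norm_eq_zero)
  have "S i \<le> 2 ^ (Suc n - i) - 1" if "1 \<le> i" "i \<le> Suc n" for i
    using that(2,1)
  proof (induct rule: inc_induct)
    case base
    show ?case by (simp add: S_def)
  next
    case (step i)
    then have i: "i \<in> {1..n}" "i \<le> n" by auto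
    have "norm (\<Sum>j\<in>{Suc i..n}. z j * (z j)\<^sup>\<star>) \<le> S (Suc i)"
      unfolding S_def by (rule sum_norm_le) (metis cstar_identity dag_dag norm_dag order_refl)
    then have d: "norm (defect (Suc i)) \<le> 1 + S (Suc i)"
      unfolding defect_def using e1 norm_triangle_ineq4[of e] by (meson add_mono order_trans)
    have "(norm (z i))\<^sup>2 = norm (q *\<^sub>R (z i * (z i)\<^sup>\<star>) + (1 - q) *\<^sub>R defect (Suc i))"
      using zs_z[OF i(1)] cstar_identity[of "z i"] by (simp add: defect_def Suc_eq_plus1)
    also have "\<dots> \<le> q * (norm (z i))\<^sup>2 + (1 - q) * (1 + S (Suc i))"
      using q d cstar_identity[of "(z i)\<^sup>\<star>"] by (intro norm_triangle_mono) (simp_all add: mult_left_mono)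
    finally have "(1 - q) * (norm (z i))\<^sup>2 \<le> (1 - q) * (1 + S (Suc i))" by (simp add: algebra_simps)
    then have "(norm (z i))\<^sup>2 \<le> 1 + S (Suc i)" using q by simp
    moreover have "S i = (norm (z i))\<^sup>2 + S (Suc i)" using i by (simp add: S_def sum.atLeast_Suc_atMost)
    ultimately have "S i \<le> 2 * S (Suc i) + 1" by simp
    also have "\<dots> \<le> 2 ^ (Suc n - i) - 1" using step i by (simp add: Suc_diff_le)
    finally show ?case .
  qed
  from this[of 1] have "S 1 \<le> 2 ^ n - 1" by simp
  moreover have "(norm (z i))\<^sup>2 \<le> S 1" unfolding S_def using assms by (intro member_le_sum) auto
  ultimately have "(norm (z i))\<^sup>2 \<le> 2 ^ n" by linarith
  also have "\<dots> \<le> (2 ^ n)\<^sup>2" using self_le_power[of "2 ^ n :: real" 2] by simp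
  finally show ?thesis by (rule power2_le_imp_le) simp
qed

text \<open>
  Subtracting one \<open>z\<^sub>i z\<^sub>i\<^sup>*\<close> at a time, starting with the last: \<open>z\<^sub>i\<close> commutes with \<open>1 - \<Sum> z\<^sub>j z\<^sub>j\<^sup>*\<close>
  summed over \<open>j > i\<close>, which is what \<open>pos_defect_step\<close> asks for.
\<close>

lemma pos_defect: "pos (defect 1)"
proof (rule inc_induct[of 1 "Suc n"])
  show "pos (defect (Suc n))" using pos_square[OF e_dag] by (simp add: defect_def e_e)
  fix i assume "1 \<le> i" "i < Suc n" and p: "pos (defect (Suc i))"
  then have i: "i \<in> {1..n}" "i \<le> n" by auto
  show "pos (defect i)"
    unfolding defect_step[OF i(2)]
    by (rule pos_defect_step[OF p defect_commute[OF i(1)] q]) (use zs_z[OF i(1)] in \<open>simp add: defect_def Suc_eq_plus1\<close>)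
qed simp

lemma defect_z:
  assumes k: "k \<in> {1..n}" shows "defect 1 * z k = q *\<^sub>R (z k * defect 1)"
proof (rule inc_induct[of 1 k])
  have r: "(z k)\<^sup>\<star> * z k = q *\<^sub>R (z k * (z k)\<^sup>\<star>) + (1 - q) *\<^sub>R defect (Suc k)"
    using zs_z[OF k] by (simp add: defect_def Suc_eq_plus1)
  have "defect k * z k = defect (Suc k) * z k - z k * ((z k)\<^sup>\<star> * z k)"
    using k by (simp add: defect_step algebra_simps)
  also have "\<dots> = q *\<^sub>R (z k * defect k)"
    using k by (simp add: r defect_commute defect_step algebra_simps)
  finally show "defect k * z k = q *\<^sub>R (z k * defect k)" .
  fix i assume i: "1 \<le> i" "i < k" and IH: "defect (Suc i) * z k = q *\<^sub>R (z k * defect (Suc i))"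
  have j: "1 \<le> i" "i < k" "k \<le> n" "i \<le> n" using i k by auto
  have zsz: "(z i)\<^sup>\<star> * z k = sqrt q *\<^sub>R (z k * (z i)\<^sup>\<star>)"
  proof -
    have "z k * (z i)\<^sup>\<star> = (1 / sqrt q) *\<^sub>R ((z i)\<^sup>\<star> * z k)" using arg_cong[OF z_zs[OF j(1-3)], of dag] by simp
    then show ?thesis using q by simp
  qed
  have "z i * (z i)\<^sup>\<star> * z k = sqrt q *\<^sub>R (z i * z k * (z i)\<^sup>\<star>)" by (simp add: mult.assoc zsz)
  also have "\<dots> = q *\<^sub>R (z k * (z i * (z i)\<^sup>\<star>))" using q by (simp add: z_z[OF j(1-3)] mult.assoc)
  finally show "defect i * z k = q *\<^sub>R (z k * defect i)" by (simp add: defect_step[OF j(4)] algebra_simps IH)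
qed (use k in simp)

lemma hom_defect:
  assumes "star_hom F" "\<And>i. i \<in> {1..n} \<Longrightarrow> F (z i) * (F (z i))\<^sup>\<star> = y i * (y i)\<^sup>\<star>"
    "d = F e - (\<Sum>j\<in>{1..n}. y j * (y j)\<^sup>\<star>)"
  shows "F (defect 1) = d"
proof -
  have "F (\<Sum>j\<in>A. z j * (z j)\<^sup>\<star>) = (\<Sum>j\<in>A. y j * (y j)\<^sup>\<star>)" if "A \<subseteq> {1..n}" for A
    using finite_subset[OF that] that
    by (induct A rule: finite_induct) (simp_all add: star_homD[OF assms(1)] assms(2))
  then show ?thesis by (simp add: defect_def star_homD[OF assms(1)] assms(3))
qed

lemma root_z:
  assumes "pos s" "s * s = defect 1" "k \<in> {1..n}" shows "s * z k = sqrt q *\<^sub>R (z k * s)"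
  using pos_sqrt_twisted_commute[OF assms(1), of "sqrt q" "z k"] q defect_z[OF assms(3)] by (simp add: assms(2))

lemma root_zs:
  assumes "pos s" "s * s = defect 1" "k \<in> {1..n}" shows "s * (z k)\<^sup>\<star> = (1 / sqrt q) *\<^sub>R ((z k)\<^sup>\<star> * s)"
  using arg_cong[OF root_z[OF assms], of dag] q by (simp add: pos_dag[OF assms(1)])

end

section \<open>Gluing two balls along their boundary\<close>

text \<open>
  The situation of the theorem, inside two algebras of the class: \<open>eB\<close> and \<open>zB\<close> are unit and generators of
  the even ball, \<open>eO\<close>, \<open>x1\<close> and \<open>zO\<close> those of the odd ball, \<open>s\<close> is the positive root of the defect, \<open>I\<close> and \<open>K\<close> are the
  ideals defining the two boundaries. \<open>F1\<close> and \<open>F2\<close> are the components of the isomorphism, and \<open>\<iota>1\<close> and \<open>\<iota>2\<close>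
  are right inverses of them that avoid \<open>x1\<close>.
\<close>

locale gluing =
  B: even_ball_relations q n eB zB + O: even_ball_relations q n eO zO
  for q n and eB :: "'b::unital_cstar" and zB and eO :: "'o::unital_cstar" and zO +
  fixes lam :: "nat \<Rightarrow> complex" and x1 :: 'o and s :: 'b and F1 F2 :: "'o \<Rightarrow> 'b" and \<iota>1 \<iota>2 :: "'b \<Rightarrow> 'o"
    and I :: "'o set" and K :: "'b set"
  assumes lam: "i \<in> {1..n} \<Longrightarrow> lam i * cnj (lam i) = 1"
    and s: "pos s" "s * s = B.defect 1"
    and x1: "x1\<^sup>\<star> = x1" "eO * x1 = x1" "i \<in> {1..n} \<Longrightarrow> x1 * zO i = sqrt q *\<^sub>R (zO i * x1)"
    and central: "eO * a = a * eO" "eB * b = b * eB"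
    and F: "star_hom F1" "star_hom F2" "F1 (eO * a) = F1 a" "F2 (eO * a) = F2 a" "eB * F1 a = F1 a" 
      "F1 eO = eB" "F2 eO = eB"
      "F1 x1 = s" "F2 x1 = - s" "i \<in> {1..n} \<Longrightarrow> F1 (zO i) = lam i *\<^sub>C zB i" "i \<in> {1..n} \<Longrightarrow> F2 (zO i) = zB i"
    and \<iota>: "star_hom \<iota>1" "star_hom \<iota>2" "\<iota>1 (eB * b) = \<iota>1 b" "eO * \<iota>1 b = \<iota>1 b" "\<iota>1 eB = eO" "\<iota>2 eB = eO" 
      "i \<in> {1..n} \<Longrightarrow> \<iota>1 (zB i) = cnj (lam i) *\<^sub>C zO i" "i \<in> {1..n} \<Longrightarrow> \<iota>2 (zB i) = zO i"
    and gen_O: "generates eO (insert x1 (zO ` {1..n}))" and gen_B: "generates eB (zB ` {1..n})"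
    and I: "closed_ideal_of I" "O.defect 1 - x1 * x1 \<in> I" 
      "closed_ideal_of J \<Longrightarrow> O.defect 1 - x1 * x1 \<in> J \<Longrightarrow> I \<subseteq> J"
    and K: "closed_ideal_of K" "B.defect 1 \<in> K" "closed_ideal_of L \<Longrightarrow> B.defect 1 \<in> L \<Longrightarrow> K \<subseteq> L"
begin

lemma lam': "i \<in> {1..n} \<Longrightarrow> cnj (lam i) * lam i = 1"
  using lam[of i] by (simp add: mult.commute)

lemma defects: "F1 (O.defect 1) = B.defect 1" "F2 (O.defect 1) = B.defect 1"
  "\<iota>1 (B.defect 1) = O.defect 1" "\<iota>2 (B.defect 1) = O.defect 1"
proof -
  show "F1 (O.defect 1) = B.defect 1" by (rule O.hom_defect[OF F(1), of zB]) (simp_all add: F lam lam' B.defect_def)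
  show "F2 (O.defect 1) = B.defect 1" by (rule O.hom_defect[OF F(2), of zB]) (simp_all add: F B.defect_def)
  show "\<iota>1 (B.defect 1) = O.defect 1" by (rule B.hom_defect[OF \<iota>(1), of zO]) (simp_all add: \<iota> lam lam' O.defect_def)
  show "\<iota>2 (B.defect 1) = O.defect 1" by (rule B.hom_defect[OF \<iota>(2), of zO]) (simp_all add: \<iota> O.defect_def)
qed

definition r where "r = \<iota>1 s"

lemma pos_r: "pos r"
  unfolding r_def by (rule star_hom_pos[OF \<iota>(1) s(1)])

lemma r_r: "r * r = O.defect 1"
  by (simp add: r_def s(2) defects(3) flip: star_homD(2)[OF \<iota>(1)])

lemma \<iota>2_s: "\<iota>2 s = r"
  by (rule pos_sqrt_unique[OF star_hom_pos[OF \<iota>(2) s(1)] pos_r])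
    (simp add: r_r s(2) defects(4) flip: star_homD(2)[OF \<iota>(2)])

lemma F1_r: "F1 r = s"
  by (rule pos_sqrt_unique[OF star_hom_pos[OF F(1) pos_r] s(1)])
    (simp add: r_r s(2) defects(1) flip: star_homD(2)[OF F(1)])

lemma F2_r: "F2 r = s"
  by (rule pos_sqrt_unique[OF star_hom_pos[OF F(2) pos_r] s(1)])
    (simp add: r_r s(2) defects(2) flip: star_homD(2)[OF F(2)])

lemma x1_zs: "i \<in> {1..n} \<Longrightarrow> x1 * (zO i)\<^sup>\<star> = (1 / sqrt q) *\<^sub>R ((zO i)\<^sup>\<star> * x1)"
  using arg_cong[OF x1(3), of i dag] O.q by (simp add: x1(1))

lemma x1_defect: "O.defect 1 * x1 = x1 * O.defect 1"
proof -
  have "x1 * (zO i * (zO i)\<^sup>\<star>) = zO i * (zO i)\<^sup>\<star> * x1" if "i \<in> {1..n}" for i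
  proof -
    have "x1 * (zO i * (zO i)\<^sup>\<star>) = sqrt q *\<^sub>R (zO i * (x1 * (zO i)\<^sup>\<star>))"
      using x1(3)[OF that] by (simp flip: mult.assoc)
    then show ?thesis using O.q by (simp add: x1_zs[OF that] mult.assoc)
  qed
  then show ?thesis using x1(2) central(1)[of x1]
    by (simp add: O.defect_def algebra_simps sum_distrib_left sum_distrib_right)
qed

lemma x1_r: "r * x1 = x1 * r"
  using pos_sqrt_twisted_commute[OF pos_r, of 1 x1] x1_defect by (simp add: r_r)

text \<open>
  Two ideals with \<open>Jp Jm \<subseteq> I\<close> that contain \<open>r + x\<^sub>1\<close> and \<open>r - x\<^sub>1\<close>, respectively. Defining them as
  annihilators modulo \<open>I\<close> makes orthogonality immediate and leaves only the ideal property of \<open>Jm\<close> to prove.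
\<close>

definition Jm where "Jm = {a. (r + x1) * a \<in> I}"

definition Jp where "Jp = {c. \<forall>a\<in>Jm. c * a \<in> I}"

lemmas I_rules = closed_ideal_ofD[OF I(1)]

lemma closed_left: "closed {a. c * a \<in> I}" for c
  using continuous_closed_vimage[OF I_rules(1), of "\<lambda>a. c * a"] by (simp add: vimage_def continuous_intros)

lemma closed_right: "closed {a. a * c \<in> I}" for c
  using continuous_closed_vimage[OF I_rules(1), of "\<lambda>a. a * c"] by (simp add: vimage_def continuous_intros)

lemma v_e: "(r + x1) * eO = r + x1"
  using x1(2) \<iota>(4)[of s] central(1) by (simp add: distrib_right r_def)

text \<open>
  \<open>r + x\<^sub>1\<close> commutes with each generator up to a scalar, so the elements that map \<open>Jm\<close> into itself contain
  all generators.
\<close>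

lemma Jm_left: assumes a: "a \<in> Jm" shows "b * a \<in> Jm"
proof -
  let ?Q = "{b. \<forall>a\<in>Jm. (r + x1) * (b * a) \<in> I}"
  have x1Q: "x1 \<in> ?Q"
  proof (clarify)
    fix a assume "a \<in> Jm"
    moreover have "(r + x1) * (x1 * a) = x1 * ((r + x1) * a)" by (simp add: algebra_simps x1_r flip: mult.assoc)
    ultimately show "(r + x1) * (x1 * a) \<in> I" by (simp add: Jm_def I_rules)
  qed
  have zQ: "zO i \<in> ?Q" if i: "i \<in> {1..n}" for i
  proof (clarify)
    fix a assume "a \<in> Jm"
    moreover have "(r + x1) * zO i = sqrt q *\<^sub>R (zO i * (r + x1))"
      using O.root_z[OF pos_r r_r i] x1(3)[OF i] by (simp add: algebra_simps)
    then have "(r + x1) * (zO i * a) = sqrt q *\<^sub>R (zO i * ((r + x1) * a))" by (simp flip: mult.assoc)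
    ultimately show "(r + x1) * (zO i * a) \<in> I" by (simp add: Jm_def I_rules)
  qed
  have zsQ: "(zO i)\<^sup>\<star> \<in> ?Q" if i: "i \<in> {1..n}" for i
  proof (clarify)
    fix a assume "a \<in> Jm"
    moreover have "(r + x1) * (zO i)\<^sup>\<star> = (1 / sqrt q) *\<^sub>R ((zO i)\<^sup>\<star> * (r + x1))"
      using O.root_zs[OF pos_r r_r i] x1_zs[OF i] by (simp add: algebra_simps)
    then have "(r + x1) * ((zO i)\<^sup>\<star> * a) = (1 / sqrt q) *\<^sub>R ((zO i)\<^sup>\<star> * ((r + x1) * a))" by (simp flip: mult.assoc)
    ultimately show "(r + x1) * ((zO i)\<^sup>\<star> * a) \<in> I" by (simp add: Jm_def I_rules)
  qed
  have "eO * b \<in> ?Q"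
  proof (rule generates_induct[OF gen_O])
    show "g \<in> ?Q" "g\<^sup>\<star> \<in> ?Q" if "g \<in> insert x1 (zO ` {1..n})" for g
      using that x1Q zQ zsQ x1(1) by auto
    have "?Q = (\<Inter>a\<in>Jm. {b. ((r + x1) * b) * a \<in> I})" by (auto simp: mult.assoc)
    moreover have "closed {b. ((r + x1) * b) * a \<in> I}" for a
      using continuous_closed_vimage[OF I_rules(1), of "\<lambda>b. (r + x1) * b * a"] by (simp add: vimage_def continuous_intros)
    ultimately show "closed ?Q" by auto
    show "eO \<in> ?Q" by (auto simp: Jm_def v_e simp flip: mult.assoc)
  next
    fix x y c assume x: "x \<in> ?Q"
    show "c *\<^sub>C x \<in> ?Q" using x by (simp add: I_rules)
    assume y: "y \<in> ?Q"
    show "x + y \<in> ?Q"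
    proof (clarify)
      fix a assume "a \<in> Jm"
      then have "(r + x1) * (x * a) + (r + x1) * (y * a) \<in> I" using x y by (simp add: I_rules)
      then show "(r + x1) * ((x + y) * a) \<in> I" by (simp only: distrib_left distrib_right)
    qed
    show "x * y \<in> ?Q"
    proof (clarify)
      fix a assume "a \<in> Jm"
      then have "y * a \<in> Jm" using y by (simp add: Jm_def)
      with x show "(r + x1) * (x * y * a) \<in> I" by (simp add: mult.assoc)
    qed
  qed
  then have "(r + x1) * (eO * b * a) \<in> I" using a by simp
  then show ?thesis by (simp add: Jm_def v_e flip: mult.assoc)
qed

lemma ideal_Jm: "closed_ideal_of Jm"
  unfolding closed_ideal_of_def
  using closed_left[of "r + x1"] Jm_left I_rules by (auto simp: Jm_def distrib_left simp flip: mult.assoc)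

lemma ideal_Jp: "closed_ideal_of Jp"
proof -
  have "Jp = (\<Inter>a\<in>Jm. {c. c * a \<in> I})" by (auto simp: Jp_def)
  then have "closed Jp" using closed_right by auto
  then show ?thesis unfolding closed_ideal_of_def
    using Jm_left I_rules by (auto simp: Jp_def distrib_right mult.assoc)
qed

text \<open>
  On generators \<open>\<iota>\<^sub>1 F\<^sub>1\<close> differs from the identity only at \<open>x\<^sub>1\<close>, where the difference is \<open>x\<^sub>1 - r\<close>.
\<close>

lemma retract_Jm: assumes "eO * a = a" shows "a - \<iota>1 (F1 a) \<in> Jm"
proof -
  note J = closed_ideal_ofD[OF ideal_Jm] and h = star_homD[OF F(1)] star_homD[OF \<iota>(1)]
  have "(r + x1) * (r - x1) = O.defect 1 - x1 * x1" using x1_r by (simp add: algebra_simps r_r)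
  then have "r - x1 \<in> Jm" using I(2) by (simp add: Jm_def)
  from J(6)[OF this] have "x1 - \<iota>1 (F1 x1) \<in> Jm" by (simp add: F(8) r_def)
  moreover have "eO * a - \<iota>1 (F1 (eO * a)) \<in> Jm"
  proof (rule homs_agree_mod_ideal[OF gen_O star_hom_id star_hom_compose[OF \<iota>(1) F(1)] ideal_Jm])
    show "g - \<iota>1 (F1 g) \<in> Jm" "g\<^sup>\<star> - \<iota>1 (F1 (g\<^sup>\<star>)) \<in> Jm" if "g \<in> insert x1 (zO ` {1..n})" for g
      using that calculation x1(1) by (elim insertE imageE; simp add: F(10) \<iota>(7) h lam lam' J)+
  qed (simp add: F(6) \<iota>(5) J)
  ultimately show ?thesis by (simp only: assms)
qed

lemma retract_Jp: assumes "eO * a = a" shows "a - \<iota>2 (F2 a) \<in> Jp"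
proof -
  note J = closed_ideal_ofD[OF ideal_Jp] and h = star_homD[OF F(2)] star_homD[OF \<iota>(2)]
  have "r + x1 \<in> Jp" by (simp add: Jp_def Jm_def)
  then have "x1 - \<iota>2 (F2 x1) \<in> Jp" by (simp add: F(9) h \<iota>2_s add.commute)
  moreover have "eO * a - \<iota>2 (F2 (eO * a)) \<in> Jp"
  proof (rule homs_agree_mod_ideal[OF gen_O star_hom_id star_hom_compose[OF \<iota>(2) F(2)] ideal_Jp])
    show "g - \<iota>2 (F2 g) \<in> Jp" "g\<^sup>\<star> - \<iota>2 (F2 (g\<^sup>\<star>)) \<in> Jp" if "g \<in> insert x1 (zO ` {1..n})" for g
      using that calculation x1(1) by (elim insertE imageE; simp add: F(11) \<iota>(8) h J)+
  qed (simp add: F(7) \<iota>(6) J)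
  ultimately show ?thesis by (simp only: assms)
qed

text \<open>
  If both homomorphisms vanish at \<open>a\<close>, then \<open>a \<in> Jm\<close> and \<open>a\<^sup>* \<in> Jp\<close>.
\<close>

lemma kernel_subset:
  assumes "eO * a = a" "F1 a = 0" "F2 a = 0" shows "a \<in> I"
proof -
  have "a \<in> Jm" using retract_Jm[OF assms(1)] assms(2) by (simp add: star_homD[OF \<iota>(1)])
  moreover have "eO * a\<^sup>\<star> = a\<^sup>\<star>" using arg_cong[OF assms(1), of dag] central(1) by (simp add: O.e_dag)
  from retract_Jp[OF this] have "a\<^sup>\<star> \<in> Jp" using assms(3) by (simp add: star_homD[OF F(2)] star_homD[OF \<iota>(2)])
  ultimately have "a\<^sup>\<star> * a \<in> I" by (simp add: Jp_def)
  then show ?thesis by (rule closed_ideal_of_dag_mult[OF I(1)])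
qed

lemma closed_ideal_kernel: "star_hom F \<Longrightarrow> closed_ideal_of {a. F a = 0}"
  using continuous_closed_preimage_constant[of UNIV F 0] star_hom_continuous[of F UNIV]
  by (auto simp: closed_ideal_of_def star_homD)

lemma I_subset_kernel: "a \<in> I \<Longrightarrow> F1 a = 0 \<and> F2 a = 0"
  using I(3)[OF closed_ideal_kernel[OF F(1)]] I(3)[OF closed_ideal_kernel[OF F(2)]]
  by (auto simp: star_homD[OF F(1)] star_homD[OF F(2)] defects(1) defects(2) F(8,9) s(2))

lemma F1_\<iota>1: "F1 (\<iota>1 b) = eB * b"
proof -
  have "F1 (\<iota>1 (eB * b)) - eB * b \<in> {0}"
    by (rule homs_agree_mod_ideal[OF gen_B star_hom_compose[OF F(1) \<iota>(1)] star_hom_id closed_ideal_zero])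
      (auto simp: star_homD(3,4)[OF F(1)] star_homD(3,4)[OF \<iota>(1)] F(6,10) \<iota>(5,7) lam lam')
  then show ?thesis by (simp add: \<iota>(3))
qed

lemma F2_\<iota>2: "F2 (\<iota>2 (eB * b)) = eB * b"
proof -
  have "F2 (\<iota>2 (eB * b)) - eB * b \<in> {0}"
    by (rule homs_agree_mod_ideal[OF gen_B star_hom_compose[OF F(2) \<iota>(2)] star_hom_id closed_ideal_zero])
      (auto simp: star_homD(3,4)[OF F(2)] star_homD(3,4)[OF \<iota>(2)] F(7,11) \<iota>(6,8))
  then show ?thesis by simp
qed

text \<open>
  If \<open>F\<^sub>2 b = 0\<close> and \<open>F\<^sub>1 b = d\<close>, then \<open>b\<^sup>* \<in> Jp\<close> and \<open>b - \<iota>\<^sub>1 d \<in> Jm\<close>, so \<open>b\<^sup>* b\<close> is congruent to \<open>b\<^sup>* \<iota>\<^sub>1 d\<close>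
  modulo \<open>I\<close>. A cutoff \<open>m\<close> turns this into \<open>\<parallel>b m\<parallel>\<^sup>2 \<le> \<parallel>b m\<parallel> \<parallel>d\<parallel> + \<epsilon>\<^sup>2\<close>, and \<open>b m\<close> has the same images as \<open>b\<close>.
\<close>

lemma lift:
  assumes d: "F1 a = d" "F2 a = 0" and \<epsilon>: "0 < \<epsilon>"
  obtains a' where "F1 a' = d" "F2 a' = 0" "norm a' \<le> norm d + \<epsilon>"
proof -
  define b where "b = eO * a"
  have eb: "eO * b = b" by (simp add: b_def O.e_e flip: mult.assoc)
  have b: "F1 b = d" "F2 b = 0" using d by (simp_all add: b_def F)
  have "eO * b\<^sup>\<star> = b\<^sup>\<star>" using arg_cong[OF eb, of dag] central(1) by (simp add: O.e_dag)
  from retract_Jp[OF this] have "b\<^sup>\<star> \<in> Jp" using b by (simp add: star_homD[OF F(2)] star_homD[OF \<iota>(2)])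
  moreover have "b - \<iota>1 d \<in> Jm" using retract_Jm[OF eb] b by simp
  ultimately have yI: "b\<^sup>\<star> * (b - \<iota>1 d) \<in> I" by (simp add: Jp_def)
  have "0 < \<epsilon>\<^sup>2" using \<epsilon> by simp
  from ideal_cutoff[OF I(1) yI this] obtain m where m: "m\<^sup>\<star> = m" "norm m \<le> 1"
    "norm (b\<^sup>\<star> * (b - \<iota>1 d) * m) \<le> \<epsilon>\<^sup>2" "1 - m \<in> I" by blast
  define t where "t = norm (b * m)"
  have "t\<^sup>2 = norm ((b * m)\<^sup>\<star> * (b * m))" by (simp only: cstar_identity t_def)
  also have "(b * m)\<^sup>\<star> * (b * m) = (b * m)\<^sup>\<star> * (\<iota>1 d * m) + m * (b\<^sup>\<star> * (b - \<iota>1 d) * m)"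
    by (simp add: m(1) algebra_simps)
  also have "norm \<dots> \<le> t * norm d + \<epsilon>\<^sup>2"
  proof (rule norm_triangle_mono)
    have "norm (\<iota>1 d * m) \<le> norm d * 1"
      by (rule order_trans[OF norm_mult_ineq mult_mono]) (use m(2) star_homD(5)[OF \<iota>(1)] in auto)
    then show "norm ((b * m)\<^sup>\<star> * (\<iota>1 d * m)) \<le> t * norm d"
      using order_trans[OF norm_mult_ineq mult_left_mono[of "norm (\<iota>1 d * m)" "norm d" "norm ((b * m)\<^sup>\<star>)"]]
      by (simp only: norm_dag t_def) simp
    have "norm (m * (b\<^sup>\<star> * (b - \<iota>1 d) * m)) \<le> 1 * \<epsilon>\<^sup>2"
      by (rule order_trans[OF norm_mult_ineq mult_mono]) (use m in auto)
    then show "norm (m * (b\<^sup>\<star> * (b - \<iota>1 d) * m)) \<le> \<epsilon>\<^sup>2" by simp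
  qed
  finally have t2: "t\<^sup>2 \<le> t * norm d + \<epsilon>\<^sup>2" .
  have "t \<le> norm d + \<epsilon>"
  proof (rule ccontr)
    assume "\<not> t \<le> norm d + \<epsilon>"
    then have "\<epsilon> < t - norm d" "\<epsilon> < t" using norm_ge_zero[of d] by linarith+
    then have "\<epsilon> * \<epsilon> < t * (t - norm d)" using \<epsilon> by (intro mult_strict_mono) auto
    with t2 show False by (simp add: power2_eq_square algebra_simps)
  qed
  moreover have "b * (1 - m) \<in> I" using m(4) by (rule I_rules)
  from I_subset_kernel[OF this] have "F1 (b * m) = d" "F2 (b * m) = 0"
    using b by (simp_all add: star_homD[OF F(1)] star_homD[OF F(2)] right_diff_distrib)
  ultimately show ?thesis using that[of "b * m"] by (simp add: t_def)
qed

definition L where "L = {d. \<exists>a. F1 a = d \<and> F2 a = 0}"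

lemma L_diff: "d \<in> L \<Longrightarrow> d' \<in> L \<Longrightarrow> d - d' \<in> L"
proof -
  assume "d \<in> L" "d' \<in> L"
  then obtain a a' where "F1 a = d" "F2 a = 0" "F1 a' = d'" "F2 a' = 0" by (auto simp: L_def)
  then show ?thesis unfolding L_def using star_homD(8)[OF F(1), of a a'] star_homD(8)[OF F(2), of a a'] by auto
qed

text \<open>
  A convergent sequence in \<open>L\<close> is replaced by a rapidly convergent subsequence; lifts of its differences
  with almost the same norm can be summed.
\<close>

lemma closed_L: "closed L"
  unfolding closed_sequential_limits
proof (intro allI impI, elim conjE)
  fix f l assume f: "\<forall>k. f k \<in> L" and lim: "f \<longlonglongrightarrow> l"
  have "\<exists>N. norm (f N - l) < (1/2)^k" for k :: nat
    using LIMSEQ_D[OF lim, of "(1/2)^k"] by auto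
  then obtain g where g: "\<And>k. norm (f (g k) - l) < (1/2)^k" by metis
  define h where "h k = f (g k)" for k
  have hL: "h k \<in> L" for k using f by (simp add: h_def)
  have step: "norm (h (Suc k) - h k) \<le> 2 * (1/2)^k" for k
  proof -
    have "norm (h (Suc k) - h k) \<le> norm (h (Suc k) - l) + norm (h k - l)"
      using norm_triangle_ineq4[of "h (Suc k) - l" "h k - l"] by simp
    also have "\<dots> \<le> (1/2)^Suc k + (1/2)^k" using g[of k] g[of "Suc k"] unfolding h_def by linarith
    also have "\<dots> \<le> 2 * (1/2)^k" by simp
    finally show ?thesis .
  qed
  have "\<exists>b. F1 b = h (Suc k) - h k \<and> F2 b = 0 \<and> norm b \<le> 3 * (1/2)^k" for k
  proof -
    from L_diff[OF hL hL] obtain a where a: "F1 a = h (Suc k) - h k" "F2 a = 0" by (auto simp: L_def)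
    have "(0::real) < (1/2)^k" by simp
    from lift[OF a this] obtain b where "F1 b = h (Suc k) - h k" "F2 b = 0" "norm b \<le> norm (h (Suc k) - h k) + (1/2)^k" by blast
    then show ?thesis using step[of k] by (intro exI[of _ b]) auto
  qed
  then obtain b where b: "\<And>k. F1 (b k) = h (Suc k) - h k" "\<And>k. F2 (b k) = 0" "\<And>k. norm (b k) \<le> 3 * (1/2)^k" by metis
  from hL[of 0] obtain a0 where a0: "F1 a0 = h 0" "F2 a0 = 0" by (auto simp: L_def)
  have "summable b"
    by (rule summable_comparison_test'[of "\<lambda>k. 3 * (1/2)^k" 0]) (auto intro!: summable_mult summable_geometric b(3))
  then have lim: "(\<lambda>k. a0 + (\<Sum>j<k. b j)) \<longlonglongrightarrow> a0 + suminf b" by (intro tendsto_intros summable_LIMSEQ)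
  have part: "F1 (a0 + (\<Sum>j<k. b j)) = h k \<and> F2 (a0 + (\<Sum>j<k. b j)) = 0" for k
  proof (induct k)
    case (Suc k)
    have "a0 + (\<Sum>j<Suc k. b j) = (a0 + (\<Sum>j<k. b j)) + b k" by (simp add: add.assoc)
    then show ?case using Suc b star_homD(1)[OF F(1)] star_homD(1)[OF F(2)] by (simp add: add_diff_eq)
  qed (simp add: a0)
  have "h \<longlonglongrightarrow> l"
  proof (rule LIM_zero_cancel, rule Lim_null_comparison)
    show "\<forall>\<^sub>F k in sequentially. norm (h k - l) \<le> (1/2)^k" using g by (auto simp: h_def less_imp_le)
    show "(\<lambda>k. (1/2)^k :: real) \<longlonglongrightarrow> 0" by (rule LIMSEQ_power_zero) simp
  qed
  moreover have "h \<longlonglongrightarrow> F1 (a0 + suminf b)" using star_hom_tendsto[OF F(1) lim] part by simp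
  moreover have "(\<lambda>k. 0) \<longlonglongrightarrow> F2 (a0 + suminf b)" using star_hom_tendsto[OF F(2) lim] part by simp
  ultimately have "F1 (a0 + suminf b) = l" "F2 (a0 + suminf b) = 0" using LIMSEQ_unique tendsto_const by blast+
  then show "l \<in> L" by (auto simp: L_def)
qed

lemma ideal_L: "closed_ideal_of L"
  unfolding closed_ideal_of_def
proof (intro conjI ballI allI closed_L)
  show "0 \<in> L" by (auto simp: L_def star_homD[OF F(1)] star_homD[OF F(2)] intro!: exI[of _ 0])
  fix d d' assume d: "d \<in> L"
  then obtain a where a: "F1 a = d" "F2 a = 0" by (auto simp: L_def)
  have ed: "eB * d = d" using F(5)[of a] a by simp
  have de: "d * eB = d" using central(2)[of d] ed by simp
  have "eB * x * d = x * d" for x using ed by (simp add: central(2)[of x] mult.assoc)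
  moreover have "d * (eB * x) = d * x" for x using de by (simp flip: mult.assoc)
  ultimately have "F1 (\<iota>1 x * a) = x * d" "F2 (\<iota>1 x * a) = 0" "F1 (a * \<iota>1 x) = d * x" "F2 (a * \<iota>1 x) = 0" for x
    by (simp_all add: star_homD(2)[OF F(1)] star_homD(2)[OF F(2)] F1_\<iota>1 a)
  then show "x * d \<in> L" "d * x \<in> L" for x unfolding L_def by blast+
  assume "d' \<in> L"
  then obtain a' where "F1 a' = d'" "F2 a' = 0" by (auto simp: L_def)
  with a show "d + d' \<in> L"
    unfolding L_def using star_homD(1)[OF F(1), of a a'] star_homD(1)[OF F(2), of a a'] by auto
qed

lemma K_lift: assumes "d \<in> K" obtains a where "eO * a = a" "F1 a = d" "F2 a = 0"
proof -
  note L = closed_ideal_ofD[OF ideal_L]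
  have "s + s \<in> L"
    unfolding L_def using F1_r F2_r F(8,9)
    by (auto simp: star_homD[OF F(1)] star_homD[OF F(2)] intro!: exI[of _ "r + x1"])
  from L(9)[OF L(5)[OF this]] have "(1/2) *\<^sub>R ((s + s) * s) \<in> L" .
  moreover have "(1/2) *\<^sub>R ((s + s) * s) = B.defect 1" by (simp add: distrib_right s(2) flip: scaleR_2)
  ultimately have "B.defect 1 \<in> L" by simp
  from K(3)[OF ideal_L this] assms obtain a where "F1 a = d" "F2 a = 0" by (auto simp: L_def)
  then show ?thesis using that[of "eO * a"] by (simp add: F O.e_e flip: mult.assoc)
qed

text \<open>
  At \<open>x\<^sub>1\<close> the difference is \<open>2 s\<close>, which is in \<open>K\<close> because \<open>s\<^sup>* s\<close> is.
\<close>

lemma F1_F2: assumes "eO * a = a" shows "F1 a - F1 (\<iota>2 (F2 a)) \<in> K"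
proof -
  note J = closed_ideal_ofD[OF K(1)] and h = star_homD[OF F(2)] star_homD[OF \<iota>(2)] star_homD[OF F(1)]
  have "s\<^sup>\<star> * s \<in> K" using K(2) by (simp add: pos_dag[OF s(1)] s(2))
  then have "s \<in> K" by (rule closed_ideal_of_dag_mult[OF K(1)])
  then have "F1 x1 - F1 (\<iota>2 (F2 x1)) \<in> K" by (simp add: F(8,9) h \<iota>2_s F1_r J)
  moreover have "F1 (eO * a) - F1 (\<iota>2 (F2 (eO * a))) \<in> K"
  proof (rule homs_agree_mod_ideal[OF gen_O F(1) star_hom_compose[OF F(1) star_hom_compose[OF \<iota>(2) F(2)]] K(1)])
    show "F1 g - F1 (\<iota>2 (F2 g)) \<in> K" "F1 (g\<^sup>\<star>) - F1 (\<iota>2 (F2 (g\<^sup>\<star>))) \<in> K" if "g \<in> insert x1 (zO ` {1..n})" for g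
      using that calculation x1(1) by (elim insertE imageE; simp add: F(10,11) \<iota>(8) J h(3,12,21))+
  qed (simp add: F(6,7) \<iota>(6) J)
  ultimately show ?thesis by (simp only: assms)
qed

end

text \<open>
  If \<open>b\<^sup>* b + c\<^sup>* c\<close> is congruent to a projection modulo \<open>K\<close>, then \<open>b\<close> is congruent to elements of norm
  almost 1: multiply by a cutoff \<open>m\<close> for the difference and drop the positive term \<open>(c m)\<^sup>* (c m)\<close>.
\<close>

lemma quotient_contraction:
  fixes e :: "'a::unital_cstar"
  assumes K: "closed_ideal_of K" and e: "e\<^sup>\<star> = e" "e * e = e"
    and y: "b\<^sup>\<star> * b + c\<^sup>\<star> * c - e \<in> K" and \<epsilon>: "0 < \<epsilon>"
  obtains b' where "b - b' \<in> K" "norm b' \<le> 1 + \<epsilon>"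
proof -
  define y where "y = b\<^sup>\<star> * b + c\<^sup>\<star> * c - e"
  obtain m where m: "m\<^sup>\<star> = m" "norm m \<le> 1" "norm (y * m) \<le> \<epsilon>" "1 - m \<in> K"
    using ideal_cutoff[OF K y \<epsilon>] unfolding y_def by blast
  have "norm e * norm e = norm e" using norm_self_adjoint_square[OF e(1)] e(2) by (simp add: power2_eq_square)
  then have e1: "norm e \<le> 1" by (metis mult_cancel_right1 norm_zero order_refl zero_le_one norm_eq_zero)
  have "(norm (b * m))\<^sup>2 = norm ((b * m)\<^sup>\<star> * (b * m))" by (simp only: cstar_identity)
  also have "\<dots> \<le> norm ((b * m)\<^sup>\<star> * (b * m) + (c * m)\<^sup>\<star> * (c * m))" by (intro norm_pos_mono pos_dag_mult)
  also have "(b * m)\<^sup>\<star> * (b * m) + (c * m)\<^sup>\<star> * (c * m) = m * (e * m) + m * (y * m)"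
    by (simp add: y_def m(1) algebra_simps)
  also have "norm \<dots> \<le> 1 * (1 * 1) + 1 * \<epsilon>"
  proof (rule norm_triangle_mono)
    have em: "norm (e * m) \<le> 1 * 1" by (rule order_trans[OF norm_mult_ineq mult_mono]) (use m e1 in simp_all)
    show "norm (m * (e * m)) \<le> 1 * (1 * 1)"
      by (rule order_trans[OF norm_mult_ineq mult_mono]) (use m em in simp_all)
    show "norm (m * (y * m)) \<le> 1 * \<epsilon>"
      by (rule order_trans[OF norm_mult_ineq mult_mono]) (use m in simp_all)
  qed
  also have "\<dots> \<le> (1 + \<epsilon>)\<^sup>2" using \<epsilon> by (simp add: power2_eq_square algebra_simps)
  finally have "norm (b * m) \<le> 1 + \<epsilon>" using \<epsilon> power2_le_imp_le[of "norm (b * m)" "1 + \<epsilon>"] by simp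
  moreover have "b * (1 - m) \<in> K" using m(4) by (rule closed_ideal_ofD[OF K])
  ultimately show ?thesis using that[of "b * m"] by (simp add: right_diff_distrib)
qed

section \<open>Closed ideals and quotients of C*-records\<close>

context cstar_record
begin

definition unit_elem where "unit_elem = embed A \<one>"

lemma unit_embed: "x \<in> carrier A \<Longrightarrow> unit_elem * embed A x = embed A x"
  by (simp add: unit_elem_def embed_one_mult component_embed_self)

lemma corner_eq: "unit_elem * t = t \<Longrightarrow> t = embed A (component t A)"
  by (simp add: unit_elem_def embed_one_mult)

lemma unit_central: "unit_elem * t = t * unit_elem"
  by (simp add: unit_elem_def embed_one_mult)

lemma unit_unit: "unit_elem * unit_elem = unit_elem"
  by (simp add: unit_elem_def flip: embed_hom(2))

lemma star_one: "star A \<one> = \<one>"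
proof -
  have "star A (star A \<one> \<otimes> \<one>) = star A \<one> \<otimes> star A (star A \<one>)"
    by (rule star_mult) (simp_all add: star_closed)
  then have "\<one> = star A \<one>" by (simp add: star_closed star_star)
  then show ?thesis by (rule sym)
qed

lemma unit_dag: "unit_elem\<^sup>\<star> = unit_elem"
  by (simp add: unit_elem_def star_one flip: embed_hom(3))

lemma embed_mult_right: "x \<in> carrier A \<Longrightarrow> embed A x * t = embed A (x \<otimes> component t A)"
  and embed_mult_left: "x \<in> carrier A \<Longrightarrow> t * embed A x = embed A (component t A \<otimes> x)"
proof -
  assume x: "x \<in> carrier A"
  have "embed A x * t = embed A x * (unit_elem * t)"
    using unit_embed[OF x] unit_central[of "embed A x"] by (simp flip: mult.assoc)
  then show "embed A x * t = embed A (x \<otimes> component t A)"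
    using x by (simp add: unit_elem_def embed_one_mult embed_hom component_closed rec)
  have "t * embed A x = (t * unit_elem) * embed A x" using unit_embed[OF x] by (simp add: mult.assoc)
  then show "t * embed A x = embed A (component t A \<otimes> x)"
    using x by (simp add: unit_elem_def embed_one_mult embed_hom component_closed rec)
qed

lemma embed_finsum:
  assumes "finite S" "\<And>i. i \<in> S \<Longrightarrow> f i \<in> carrier A"
  shows "(\<Oplus>i\<in>S. f i) \<in> carrier A" "embed A (\<Oplus>i\<in>S. f i) = (\<Sum>i\<in>S. embed A (f i))"
proof -
  have "(\<forall>i\<in>S. f i \<in> carrier A) \<longrightarrow>
    (\<Oplus>i\<in>S. f i) \<in> carrier A \<and> embed A (\<Oplus>i\<in>S. f i) = (\<Sum>i\<in>S. embed A (f i))"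
    using assms(1)
  proof (induct S rule: finite_induct)
    case (insert i S)
    show ?case
    proof
      assume "\<forall>i\<in>insert i S. f i \<in> carrier A"
      then have "f \<in> S \<rightarrow> carrier A" "f i \<in> carrier A" by auto
      then show "(\<Oplus>i\<in>insert i S. f i) \<in> carrier A \<and>
        embed A (\<Oplus>i\<in>insert i S. f i) = (\<Sum>i\<in>insert i S. embed A (f i))"
        using insert by (auto simp: embed_hom)
    qed
  qed (simp add: embed_zero)
  with assms(2) show "(\<Oplus>i\<in>S. f i) \<in> carrier A" "embed A (\<Oplus>i\<in>S. f i) = (\<Sum>i\<in>S. embed A (f i))" by blast+
qed

text \<open>
  The positive root in the ambient algebra is unique, so the central unit of the corner fixes it: it
  belongs to the corner.
\<close>

lemma cstar_sqrt_props:
  assumes a: "a \<in> carrier A" "pos (embed A a)"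
  shows "cstar_sqrt A a \<in> carrier A" "pos (embed A (cstar_sqrt A a))"
    "embed A (cstar_sqrt A a) * embed A (cstar_sqrt A a) = embed A a"
proof -
  obtain s where s: "pos s" "s * s = embed A a" using pos_sqrt[OF a(2)] by blast
  have "pos (unit_elem * s)"
  proof -
    have "unit_elem\<^sup>\<star> * s * unit_elem = unit_elem * (s * unit_elem)"
      by (simp add: unit_dag mult.assoc)
    also have "\<dots> = unit_elem * (unit_elem * s)" by (simp only: unit_central[of s])
    also have "\<dots> = unit_elem * s" by (simp add: unit_unit flip: mult.assoc)
    finally have "unit_elem\<^sup>\<star> * s * unit_elem = unit_elem * s" .
    then show ?thesis using pos_conj[OF s(1), of unit_elem] by simp
  qed
  moreover have "(unit_elem * s) * (unit_elem * s) = s * s"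
  proof -
    have "(unit_elem * s) * (unit_elem * s) = unit_elem * (s * unit_elem) * s" by (simp add: mult.assoc)
    also have "\<dots> = unit_elem * unit_elem * (s * s)" by (simp add: unit_central[of s, symmetric] mult.assoc)
    finally show ?thesis by (simp add: unit_unit s(2) unit_embed a(1))
  qed
  ultimately have es: "unit_elem * s = s" by (intro pos_sqrt_unique[OF _ s(1)])
  define b where "b = component s A"
  have b: "b \<in> carrier A" "embed A b = s" using corner_eq[OF es] by (simp_all add: b_def component_closed rec)
  have bb: "b \<otimes> b = a"
    using b a s(2) embed_inject[of "b \<otimes> b" a] by (simp add: embed_hom)
  have pb: "Defs.positive A b"
  proof -
    from s(1) obtain g where g: "g\<^sup>\<star> = g" "s = g * g" by (auto simp: pos_def)
    define c where "c = component g A"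
    have c: "c \<in> carrier A" by (simp add: c_def component_closed rec)
    have ec: "embed A c = unit_elem * g" by (simp add: c_def unit_elem_def embed_one_mult)
    have "(embed A c)\<^sup>\<star> * embed A c = g * (unit_elem * unit_elem) * g" by (simp add: ec unit_dag g(1) mult.assoc)
    also have "\<dots> = unit_elem * s" by (simp add: unit_unit g(2) unit_central[of g, symmetric] mult.assoc)
    finally have "embed A (star A c \<otimes> c) = embed A b" using c b es by (simp add: embed_hom star_closed)
    then have "b = star A c \<otimes> c" using c b embed_inject[of "star A c \<otimes> c" b] by (simp add: star_closed)
    then show ?thesis using c by (auto simp: Defs.positive_def)
  qed
  have un: "b' = b" if "Defs.positive A b' \<and> b' \<otimes> b' = a" for b'
  proof -
    from that obtain c where c: "c \<in> carrier A" "b' = star A c \<otimes> c" by (auto simp: Defs.positive_def)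
    then have b': "b' \<in> carrier A" "pos (embed A b')" using pos_dag_mult[of "embed A c"] by (simp_all add: star_closed embed_hom)
    have "embed A b' * embed A b' = s * s" using that b' s(2) by (simp flip: embed_hom(2))
    then have "embed A b' = embed A b" unfolding b(2) by (rule pos_sqrt_unique[OF b'(2) s(1)])
    then show ?thesis using embed_inject[OF b'(1) b(1)] by blast
  qed
  have "cstar_sqrt A a = b"
    unfolding cstar_sqrt_def
  proof (rule the_equality)
    show "Defs.positive A b \<and> b \<otimes> b = a" using pb bb by (rule conjI)
  qed (rule un)
  then show "cstar_sqrt A a \<in> carrier A" "pos (embed A (cstar_sqrt A a))"
    "embed A (cstar_sqrt A a) * embed A (cstar_sqrt A a) = embed A a" using b s by simp_all
qed

text \<open>
  This lemma and the next match the closed ideals of the record with closed ideals of the class.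
\<close>

lemma closed_ideal_embed:
  assumes "closed_ideal A J" shows "closed_ideal_of (embed A ` J)"
proof -
  interpret J: ideal J A using assms by (simp add: closed_ideal_def)
  have sub: "x \<in> carrier A" if "x \<in> J" for x using that J.Icarr by blast
  have clo: "closed (embed A ` J)"
    unfolding closed_sequential_limits
  proof (intro allI impI, elim conjE)
    fix f t assume f: "\<forall>k. f k \<in> embed A ` J" and lim: "f \<longlonglongrightarrow> t"
    then have "\<forall>k. \<exists>x. x \<in> J \<and> f k = embed A x" by blast
    then obtain j where j: "\<And>k. j k \<in> J" "\<And>k. f k = embed A (j k)" by metis
    have cl: "component t A \<in> carrier A" by (simp add: component_closed rec)
    have "(\<lambda>k. unit_elem * f k) \<longlonglongrightarrow> unit_elem * t" by (intro tendsto_intros lim)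
    moreover have "unit_elem * f k = f k" for k using sub[OF j(1)] by (simp add: j(2) unit_embed)
    ultimately have "f \<longlonglongrightarrow> unit_elem * t" by simp
    from LIMSEQ_unique[OF this lim] have t: "unit_elem * t = t" .
    have te: "embed A (component t A) = t" using corner_eq[OF t] by simp
    have "(\<lambda>k. norm (f k - t)) \<longlonglongrightarrow> 0" by (rule tendsto_norm_zero[OF LIM_zero[OF lim]])
    moreover have "norm (f k - t) = cnorm A (j k \<ominus> component t A)" for k
      using norm_embed[of "j k \<ominus> component t A"] sub[OF j(1)] cl by (simp add: embed_hom te j(2))
    ultimately have "(\<lambda>k. cnorm A (j k \<ominus> component t A)) \<longlonglongrightarrow> 0" by simp
    then have "component t A \<in> J" using assms cl j(1) unfolding closed_ideal_def by blast
    then show "t \<in> embed A ` J" using te by (metis imageI)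
  qed
  have zer: "0 \<in> embed A ` J" using imageI[OF additive_subgroup.zero_closed[OF J.additive_subgroup_axioms], of "embed A"] by (simp add: embed_zero)
  have add: "a + b \<in> embed A ` J" if "a \<in> embed A ` J" "b \<in> embed A ` J" for a b
  proof -
    from that obtain x y where xy: "x \<in> J" "y \<in> J" "a = embed A x" "b = embed A y" by blast
    show ?thesis
      using imageI[OF J.a_closed[OF xy(1,2)], of "embed A"] sub xy by (simp add: embed_hom)
  qed
  have mul: "t * a \<in> embed A ` J" "a * t \<in> embed A ` J" if "a \<in> embed A ` J" for a t
  proof -
    from that obtain x where x: "x \<in> J" "a = embed A x" by blast
    have cl: "component t A \<in> carrier A" by (simp add: component_closed rec)
    have "t * a = embed A (component t A \<otimes> x)" "a * t = embed A (x \<otimes> component t A)"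
      unfolding x(2) by (rule embed_mult_left[OF sub[OF x(1)]], rule embed_mult_right[OF sub[OF x(1)]])
    moreover have "component t A \<otimes> x \<in> J" "x \<otimes> component t A \<in> J"
      using x(1) cl by (rule J.I_l_closed, rule J.I_r_closed)
    ultimately show "t * a \<in> embed A ` J" "a * t \<in> embed A ` J" by (metis imageI)+
  qed
  show ?thesis
    unfolding closed_ideal_of_def by (intro conjI ballI allI clo zer add mul)
qed

lemma closed_ideal_preimage:
  assumes "closed_ideal_of L" shows "closed_ideal A {x \<in> carrier A. embed A x \<in> L}"
  unfolding closed_ideal_def
proof (intro conjI allI ballI impI)
  note L = closed_ideal_ofD[OF assms]
  show "ideal {x \<in> carrier A. embed A x \<in> L} A"
  proof (rule idealI[OF ring_axioms])
    show "subgroup {x \<in> carrier A. embed A x \<in> L} (add_monoid A)"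
      by (rule add.subgroupI) (auto simp: embed_hom L embed_zero intro: zero_closed)
  qed (auto simp: embed_hom L)
  fix s a assume a: "a \<in> carrier A" and s: "range s \<subseteq> {x \<in> carrier A. embed A x \<in> L}"
    and lim: "(\<lambda>k::nat. cnorm A (s k \<ominus> a)) \<longlonglongrightarrow> 0"
  have sc: "s k \<in> carrier A" "embed A (s k) \<in> L" for k using s by auto
  have "(\<lambda>k. norm (embed A (s k) - embed A a)) \<longlonglongrightarrow> 0"
    using lim sc a by (simp add: norm_embed flip: embed_hom(6))
  then have "(\<lambda>k. embed A (s k)) \<longlonglongrightarrow> embed A a" by (rule LIM_zero_cancel[OF tendsto_norm_zero_cancel])
  with sc(2) have "embed A a \<in> L" by (rule closed_sequentially[OF L(1)])
  with a show "a \<in> {x \<in> carrier A. embed A x \<in> L}" by simp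
qed

lemma closed_ideal_gen:
  assumes "a \<in> carrier A"
  shows "closed_ideal A (closed_ideal_gen A a)" "a \<in> closed_ideal_gen A a"
    "closed_ideal_of L \<Longrightarrow> embed A a \<in> L \<Longrightarrow> embed A ` closed_ideal_gen A a \<subseteq> L"
proof -
  let ?S = "{J. closed_ideal A J \<and> a \<in> J}"
  have "closed_ideal A (carrier A)" using oneideal by (simp add: closed_ideal_def)
  with assms have ne: "?S \<noteq> {}" by blast
  have "ideal (\<Inter>?S) A" using ne by (intro i_Intersect) (auto simp: closed_ideal_def)
  then show "closed_ideal A (closed_ideal_gen A a)"
    unfolding closed_ideal_gen_def closed_ideal_def by blast
  show "a \<in> closed_ideal_gen A a" by (simp add: closed_ideal_gen_def)
  assume "closed_ideal_of L" "embed A a \<in> L"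
  then have "{x \<in> carrier A. embed A x \<in> L} \<in> ?S" using closed_ideal_preimage assms by simp
  then show "embed A ` closed_ideal_gen A a \<subseteq> L" by (auto simp: closed_ideal_gen_def)
qed

end

text \<open>The quotient by the closed ideal generated by a self-adjoint element.\<close>

locale cstar_quotient = cstar_record A for A :: "'a cstar" (structure) +
  fixes a J
  assumes a: "a \<in> carrier A" "star A a = a" and J: "J = closed_ideal_gen A a"
begin

abbreviation "J' \<equiv> embed A ` J"

lemma J': "closed_ideal_of J'" "embed A a \<in> J'" "closed_ideal_of L \<Longrightarrow> embed A a \<in> L \<Longrightarrow> J' \<subseteq> L"
  using closed_ideal_embed[OF closed_ideal_gen(1)[OF a(1)]] closed_ideal_gen(2,3)[OF a(1)] by (auto simp: J)

lemma ideal_J: "ideal J A"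
  using closed_ideal_gen(1)[OF a(1)] by (simp add: J closed_ideal_def)

sublocale cstar_ideal J A by (rule cstar_ideal.intro[OF ideal_J])

lemma J_iff: "x \<in> carrier A \<Longrightarrow> x \<in> J \<longleftrightarrow> embed A x \<in> J'"
  using Icarr embed_inject by auto

lemma J'_dag: "t \<in> J' \<Longrightarrow> t\<^sup>\<star> \<in> J'"
proof -
  have "closed {t. t\<^sup>\<star> \<in> J'}"
    using continuous_closed_vimage[OF closed_ideal_ofD(1)[OF J'(1)], of dag]
    by (simp add: vimage_def isCont_def tendsto_dag)
  then have "closed_ideal_of {t. t\<^sup>\<star> \<in> J'}"
    using closed_ideal_ofD[OF J'(1)] by (simp add: closed_ideal_of_def)
  moreover have "(embed A a)\<^sup>\<star> = embed A a" using a embed_hom(3)[OF a(1)] by simp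
  ultimately have "J' \<subseteq> {t. t\<^sup>\<star> \<in> J'}" using J'(2,3) by simp
  then show "t \<in> J' \<Longrightarrow> t\<^sup>\<star> \<in> J'" by blast
qed

text \<open>
  The quotient map, precomposed with the projection onto the corner, so that it is defined
  everywhere.
\<close>

definition proj :: "'a family \<Rightarrow> 'a set" where "proj t = J +> component t A"

abbreviation "Q \<equiv> cstar_quot A J"

lemma proj_embed: "x \<in> carrier A \<Longrightarrow> proj (embed A x) = J +> x"
  by (simp add: proj_def component_embed_self)

lemma carrier_Q: "carrier Q = range proj"
proof -
  have "carrier A = range (\<lambda>t. component t A)"
  proof
    show "carrier A \<subseteq> range (\<lambda>t. component t A)"
    proof
      fix x assume "x \<in> carrier A"
      then show "x \<in> range (\<lambda>t. component t A)" using component_embed_self[of x] by (metis rangeI)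
    qed
    show "range (\<lambda>t. component t A) \<subseteq> carrier A" by (auto simp: component_closed rec)
  qed
  then show ?thesis unfolding cstar_quot_simps proj_def by (simp only: image_image)
qed

lemma proj_eq_iff: "proj t = proj u \<longleftrightarrow> unit_elem * (t - u) \<in> J'"
proof -
  have "proj t = proj u \<longleftrightarrow> component (t - u) A \<in> J"
    by (simp add: proj_def coset_eq_iff component_closed rec component_simps)
  also have "\<dots> \<longleftrightarrow> embed A (component (t - u) A) \<in> J'" by (rule J_iff) (simp add: component_closed rec)
  finally show ?thesis by (simp add: unit_elem_def embed_one_mult)
qed

lemma proj_cong: "t - u \<in> J' \<Longrightarrow> proj t = proj u"
  using closed_ideal_ofD(4)[OF J'(1)] by (simp add: proj_eq_iff)

lemma proj_unit: "proj (unit_elem * t) = proj t"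
  by (simp add: proj_def component_simps rec unit_elem_def component_embed_self component_closed)

lemma proj_hom:
  "proj (t + u) = proj t \<oplus>\<^bsub>Q\<^esub> proj u" "proj (t * u) = proj t \<otimes>\<^bsub>Q\<^esub> proj u"
  "proj 1 = \<one>\<^bsub>Q\<^esub>" "proj (c *\<^sub>C t) = c \<odot>\<^bsub>Q\<^esub> proj t" "proj (t\<^sup>\<star>) = star Q (proj t)"
proof -
  have cl: "component t A \<in> carrier A" for t by (simp add: component_closed rec)
  show "proj (t + u) = proj t \<oplus>\<^bsub>Q\<^esub> proj u" "proj (t * u) = proj t \<otimes>\<^bsub>Q\<^esub> proj u"
    by (simp_all add: proj_def component_simps rec cstar_quot_ops cl)
  show "proj 1 = \<one>\<^bsub>Q\<^esub>" by (simp add: proj_def component_simps rec cstar_quot_simps)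
  have sc: "J +> (c \<odot> z) = J +> (c \<odot> x)" if "z \<in> carrier A" "x \<in> carrier A" "z \<ominus> x \<in> J" for z x
  proof -
    have "c *\<^sub>C embed A (z \<ominus> x) \<in> J'" using that by (intro closed_ideal_ofD(8)[OF J'(1)]) blast
    then have "proj (c *\<^sub>C embed A z) = proj (c *\<^sub>C embed A x)"
      using that by (intro proj_cong) (simp add: embed_hom cscale_diff_right)
    then show ?thesis using that by (simp add: proj_def component_cscale rec component_embed_self)
  qed
  have st: "J +> (star A z) = J +> (star A x)" if "z \<in> carrier A" "x \<in> carrier A" "z \<ominus> x \<in> J" for z x
  proof -
    have "(embed A (z \<ominus> x))\<^sup>\<star> \<in> J'" using that by (intro J'_dag) blast
    then have "proj ((embed A z)\<^sup>\<star>) = proj ((embed A x)\<^sup>\<star>)"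
      using that by (intro proj_cong) (simp add: embed_hom)
    then show ?thesis using that by (simp add: proj_def component_dag rec component_embed_self)
  qed
  show "proj (c *\<^sub>C t) = c \<odot>\<^bsub>Q\<^esub> proj t"
    using coset_Union[OF cl[of t], where f = "\<lambda>x. c \<odot> x"] sc cl by (simp add: proj_def component_cscale rec cstar_quot_simps)
  show "proj (t\<^sup>\<star>) = star Q (proj t)"
    using coset_Union[OF cl[of t], where f = "star A"] st cl by (simp add: proj_def component_dag rec cstar_quot_simps)
qed

lemma automorphism_hom:
  assumes "\<beta> \<in> star_iso Q Q"
  shows "\<beta> (proj (t + u)) = \<beta> (proj t) \<oplus>\<^bsub>Q\<^esub> \<beta> (proj u)" "\<beta> (proj (t * u)) = \<beta> (proj t) \<otimes>\<^bsub>Q\<^esub> \<beta> (proj u)"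
    "\<beta> (proj 1) = \<one>\<^bsub>Q\<^esub>" "\<beta> (proj (c *\<^sub>C t)) = c \<odot>\<^bsub>Q\<^esub> \<beta> (proj t)" "\<beta> (proj (t\<^sup>\<star>)) = star Q (\<beta> (proj t))"
    "\<beta> (proj t) \<in> carrier Q"
  using assms unfolding star_iso_def ring_iso_def ring_hom_def by (auto simp: carrier_Q proj_hom)

text \<open>
  Automorphisms of the quotient are bounded for an algebraic reason. After scaling by \<open>r\<close>, the element
  \<open>t\<close> has norm at most 1, so \<open>t\<^sup>* t + k\<^sup>* k = 1\<close> for some \<open>k\<close>; this equation survives \<open>\<beta>\<close> and bounds the norm of the
  image by \<open>quotient_contraction\<close>.
\<close>

lemma automorphism_contraction:
  assumes \<beta>: "\<beta> \<in> star_iso Q Q" and b: "proj b = \<beta> (proj t)" and t: "norm t < r"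
  obtains b' where "unit_elem * b - b' \<in> J'" "norm b' \<le> 2 * r"
proof -
  have r: "0 < r" using t norm_ge_zero[of t] by linarith
  note hom = automorphism_hom[OF \<beta>]
  define u where "u = (1 / r) *\<^sub>R t"
  have "norm u \<le> 1" using t r by (simp add: u_def)
  then have "norm (u\<^sup>\<star> * u) \<le> 1" by (simp add: cstar_identity power_le_one)
  then have "pos (1 *\<^sub>R 1 - u\<^sup>\<star> * u)" by (intro pos_diff_norm) simp_all
  then obtain k where k: "k\<^sup>\<star> = k" "u\<^sup>\<star> * u + k\<^sup>\<star> * k = 1" by (auto simp: pos_def algebra_simps)
  obtain c where c: "\<beta> (proj k) = proj c" using hom(6)[of k] by (auto simp: carrier_Q)
  define d where "d = (1 / r) *\<^sub>R b"
  have d: "\<beta> (proj u) = proj d"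
    unfolding u_def d_def cscale_of_real[symmetric] by (simp only: hom b[symmetric]) (simp only: proj_hom)
  have "proj (d\<^sup>\<star> * d + c\<^sup>\<star> * c) = star Q (proj d) \<otimes>\<^bsub>Q\<^esub> proj d \<oplus>\<^bsub>Q\<^esub> star Q (proj c) \<otimes>\<^bsub>Q\<^esub> proj c"
    by (simp only: proj_hom)
  also have "\<dots> = \<beta> (proj (u\<^sup>\<star> * u + k\<^sup>\<star> * k))" by (simp only: hom c d)
  also have "\<dots> = proj 1" by (simp only: k(2) hom(3)) (simp only: proj_hom(3))
  finally have "unit_elem * (d\<^sup>\<star> * d + c\<^sup>\<star> * c - 1) \<in> J'" by (simp add: proj_eq_iff)
  moreover have "unit_elem * (d\<^sup>\<star> * d + c\<^sup>\<star> * c - 1)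
      = (unit_elem * d)\<^sup>\<star> * (unit_elem * d) + (unit_elem * c)\<^sup>\<star> * (unit_elem * c) - unit_elem"
  proof -
    have "(unit_elem * x)\<^sup>\<star> * (unit_elem * x) = unit_elem * (x\<^sup>\<star> * x)" for x
    proof -
      have "(unit_elem * x)\<^sup>\<star> * (unit_elem * x) = x\<^sup>\<star> * (unit_elem * unit_elem) * x" by (simp add: unit_dag mult.assoc)
      also have "\<dots> = unit_elem * (x\<^sup>\<star> * x)" using unit_central[of "x\<^sup>\<star>"] by (simp add: unit_unit flip: mult.assoc)
      finally show ?thesis .
    qed
    then show ?thesis by (simp add: right_diff_distrib distrib_left)
  qed
  ultimately have "(unit_elem * d)\<^sup>\<star> * (unit_elem * d) + (unit_elem * c)\<^sup>\<star> * (unit_elem * c) - unit_elem \<in> J'" by simp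
  from quotient_contraction[OF J'(1) unit_dag unit_unit this zero_less_one]
  obtain d' where d': "unit_elem * d - d' \<in> J'" "norm d' \<le> 1 + 1" by blast
  show ?thesis
  proof (rule that[of "r *\<^sub>R d'"])
    have "r *\<^sub>R (unit_elem * d - d') \<in> J'" using d'(1) by (rule closed_ideal_ofD[OF J'(1)])
    then show "unit_elem * b - r *\<^sub>R d' \<in> J'" using r by (simp add: d_def scaleR_diff_right)
    show "norm (r *\<^sub>R d') \<le> 2 * r" using d'(2) r by simp
  qed
qed

text \<open>
  Both sides are continuous in \<open>t\<close>, the left one by \<open>automorphism_contraction\<close>.
\<close>

lemma automorphism_closed:
  assumes \<beta>: "\<beta> \<in> star_iso Q Q" and \<theta>: "star_hom \<theta>"
  shows "closed {t. \<beta> (proj t) = proj (\<theta> t)}"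
  unfolding closed_sequential_limits
proof (intro allI impI, elim conjE)
  fix f t assume f: "\<forall>k. f k \<in> {t. \<beta> (proj t) = proj (\<theta> t)}" and lim: "f \<longlonglongrightarrow> t"
  note hom = automorphism_hom[OF \<beta>]
  obtain b where b: "\<beta> (proj t) = proj b" using hom(6)[of t] by (auto simp: carrier_Q)
  have "\<exists>y\<in>J'. dist y (unit_elem * (b - \<theta> t)) < e" if e: "0 < e" for e
  proof -
    obtain k where k: "norm (f k - t) < e / 4" using LIMSEQ_D[OF lim, of "e/4"] e by auto
    have "proj (b - \<theta> (f k)) = \<beta> (proj (t - f k))"
    proof -
      have m: "x - y = x + (-1) *\<^sub>C y" for x y :: "'a family" by simp
      have "\<beta> (proj (t - f k)) = proj b \<oplus>\<^bsub>Q\<^esub> (-1) \<odot>\<^bsub>Q\<^esub> proj (\<theta> (f k))"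
        using f unfolding m by (simp only: hom b mem_Collect_eq)
      then show ?thesis unfolding m by (simp only: proj_hom)
    qed
    moreover have "norm (t - f k) < e / 4" using k by (simp add: norm_minus_commute)
    ultimately obtain b' where b': "unit_elem * (b - \<theta> (f k)) - b' \<in> J'" "norm b' \<le> 2 * (e / 4)"
      by (rule automorphism_contraction[OF \<beta>])
    show ?thesis
    proof (rule bexI[OF _ b'(1)])
      have "unit_elem * (b - \<theta> t) - (unit_elem * (b - \<theta> (f k)) - b') = b' + unit_elem * \<theta> (f k - t)"
        by (simp add: star_homD(8)[OF \<theta>] algebra_simps)
      also have "norm \<dots> \<le> 2 * (e / 4) + 1 * norm (f k - t)"
      proof (rule norm_triangle_mono[OF b'(2)])
        have "norm unit_elem \<le> 1" by (simp add: unit_elem_def norm_embed cnorm_one_le)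
        then show "norm (unit_elem * \<theta> (f k - t)) \<le> 1 * norm (f k - t)"
          by (intro order_trans[OF norm_mult_ineq] mult_mono star_homD(5)[OF \<theta>]) auto
      qed
      also have "\<dots> < e" using k e by simp
      finally show "dist (unit_elem * (b - \<theta> (f k)) - b') (unit_elem * (b - \<theta> t)) < e"
        by (simp add: dist_norm norm_minus_commute)
    qed
  qed
  then have "unit_elem * (b - \<theta> t) \<in> closure J'" by (simp add: closure_approachable)
  then have "proj b = proj (\<theta> t)" using closed_ideal_ofD(1)[OF J'(1)] by (simp add: proj_eq_iff)
  then show "t \<in> {t. \<beta> (proj t) = proj (\<theta> t)}" by (simp add: b)
qed

end

section \<open>The quantum balls\<close>

lemma powr_half: "0 < q \<Longrightarrow> q powr (1/2) = sqrt q" "0 < q \<Longrightarrow> q powr (-1/2) = 1 / sqrt q"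
  using powr_minus_divide[of q "1/2"] by (simp_all add: powr_half_sqrt)

lemma even_rels_subset: "even_rels q n \<subseteq> star_polys {1..n}"
proof -
  have s: "(\<Sum>j\<in>A. gen j * adj (gen j)) \<in> star_polys {1..n}" if "A \<subseteq> {1..n}" for A
    using finite_subset[OF that] that
    by (induct A rule: finite_induct) (auto simp: star_polys_closed)
  show ?thesis
    unfolding even_rels_def by (auto simp: star_polys_closed intro!: star_polys_closed s)
qed

lemma odd_rels_subset: "odd_rels q n \<subseteq> star_polys {1..n+1}"
proof -
  have s: "(\<Sum>j\<in>A. gen j * adj (gen j)) \<in> star_polys {1..n+1}" if "A \<subseteq> {1..n+1}" for A
    using finite_subset[OF that] that
    by (induct A rule: finite_induct) (auto simp: star_polys_closed)
  show ?thesis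
    unfolding odd_rels_def by (auto simp: star_polys_closed intro!: star_polys_closed s)
qed

context poly_seminorm
begin

lemma canon_eq_0: "f \<in> star_polys G \<Longrightarrow> p f = 0 \<Longrightarrow> canon f = 0"
  using canon_simps(6)[of f] by simp

lemma canon_gen_products: "i \<in> G \<Longrightarrow> j \<in> G \<Longrightarrow> canon (gen i * gen j) = canon (gen i) * canon (gen j)"
  "i \<in> G \<Longrightarrow> j \<in> G \<Longrightarrow> canon (gen i * adj (gen j)) = canon (gen i) * (canon (gen j))\<^sup>\<star>"
  "i \<in> G \<Longrightarrow> j \<in> G \<Longrightarrow> canon (adj (gen i) * gen j) = (canon (gen i))\<^sup>\<star> * canon (gen j)"
  by (simp_all add: canon_simps star_polys_closed)

lemma canon_defect: "A \<subseteq> G \<Longrightarrow> canon (1 - (\<Sum>j\<in>A. gen j * adj (gen j))) = unit - (\<Sum>j\<in>A. canon (gen j) * (canon (gen j))\<^sup>\<star>)"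
  "A \<subseteq> G \<Longrightarrow> 1 - (\<Sum>j\<in>A. gen j * adj (gen j)) \<in> star_polys G"
proof -
  assume A: "A \<subseteq> G"
  have *: "gen j * adj (gen j) \<in> star_polys G" if "j \<in> A" for j using A that by (auto intro!: star_polys_closed)
  then have **: "canon (\<Sum>j\<in>A. gen j * adj (gen j)) = (\<Sum>j\<in>A. canon (gen j) * (canon (gen j))\<^sup>\<star>)"
      "(\<Sum>j\<in>A. gen j * adj (gen j)) \<in> star_polys G"
    using canon_sum[of A "\<lambda>j. gen j * adj (gen j)"] A by (auto simp: canon_gen_products subset_iff)
  then show "1 - (\<Sum>j\<in>A. gen j * adj (gen j)) \<in> star_polys G" by (simp add: star_polys_closed)
  from ** show "canon (1 - (\<Sum>j\<in>A. gen j * adj (gen j))) = unit - (\<Sum>j\<in>A. canon (gen j) * (canon (gen j))\<^sup>\<star>)"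
    by (simp add: canon_simps canon_one)
qed

lemma commutation_relation:
  assumes "a \<in> star_polys G" "b \<in> star_polys G" "p (a - cst (of_real c) * b) = 0"
  shows "canon a = c *\<^sub>R canon b"
proof -
  have "canon (a - cst (of_real c) * b) = 0" using assms by (intro canon_eq_0) (auto intro!: star_polys_closed)
  then show ?thesis using assms by (simp add: canon_simps canon_cst unit_canon star_polys_closed cscale_of_real)
qed

lemma square_relation:
  assumes "a \<in> star_polys G" "b \<in> star_polys G" "d \<in> star_polys G"
    "p (a - cst (of_real c) * b - cst (of_real c') * d) = 0"
  shows "canon a = c *\<^sub>R canon b + c' *\<^sub>R canon d"
proof -
  have "canon (a - cst (of_real c) * b - cst (of_real c') * d) = 0"
    using assms by (intro canon_eq_0) (auto intro!: star_polys_closed)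
  then show ?thesis using assms by (simp add: canon_simps canon_cst unit_canon star_polys_closed cscale_of_real diff_diff_eq)
qed

text \<open>
  The map \<open>g\<close> serves both balls: it is the identity for the even one, and the shift by 1 for the odd one.
\<close>

lemma even_relations:
  assumes G: "\<And>i. i \<in> {1..n} \<Longrightarrow> g i \<in> G" and q: "0 < q" "q < 1"
    and r1: "\<And>i j. \<lbrakk>1 \<le> i; i < j; j \<le> n\<rbrakk> \<Longrightarrow> p (gen (g i) * gen (g j) - cst (of_real (q powr (1/2))) * (gen (g j) * gen (g i))) = 0"
    and r2: "\<And>i j. \<lbrakk>1 \<le> i; i < j; j \<le> n\<rbrakk> \<Longrightarrow> p (gen (g i) * adj (gen (g j)) - cst (of_real (q powr (-1/2))) * (adj (gen (g j)) * gen (g i))) = 0"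
    and r3: "\<And>i. i \<in> {1..n} \<Longrightarrow> p (adj (gen (g i)) * gen (g i) - cst (of_real q) * (gen (g i) * adj (gen (g i)))
       - cst (of_real (1 - q)) * (1 - (\<Sum>j\<in>g ` {i+1..n}. gen j * adj (gen j)))) = 0" 
    and inj: "inj_on g {1..n}"
  shows "even_ball_relations q n unit (\<lambda>i. canon (gen (g i)))"
proof
  fix i j assume ij: "1 \<le> i" "i < j" "j \<le> n"
  then have G': "g i \<in> G" "g j \<in> G" using G by auto
  show "canon (gen (g i)) * canon (gen (g j)) = sqrt q *\<^sub>R (canon (gen (g j)) * canon (gen (g i)))"
    using commutation_relation[OF _ _ r1[OF ij]] G' q
    by (simp add: canon_gen_products star_polys_closed powr_half)
  show "canon (gen (g i)) * (canon (gen (g j)))\<^sup>\<star> = (1 / sqrt q) *\<^sub>R ((canon (gen (g j)))\<^sup>\<star> * canon (gen (g i)))"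
    using commutation_relation[OF _ _ r2[OF ij]] G' q
    by (simp only: canon_gen_products star_polys_closed star_polys_basic powr_half simp_thms)
next
  fix i assume i: "i \<in> {1..n}"
  then have G': "g i \<in> G" and sub: "g ` {i+1..n} \<subseteq> G" using G by auto
  show "unit * canon (gen (g i)) = canon (gen (g i))" "canon (gen (g i)) * unit = canon (gen (g i))"
    using G' by (simp_all add: unit_canon)
  have "inj_on g {i+1..n}" using i by (intro inj_on_subset[OF inj]) auto
  then show "(canon (gen (g i)))\<^sup>\<star> * canon (gen (g i)) = q *\<^sub>R (canon (gen (g i)) * (canon (gen (g i)))\<^sup>\<star>)
      + (1 - q) *\<^sub>R (unit - (\<Sum>j\<in>{i+1..n}. canon (gen (g j)) * (canon (gen (g j)))\<^sup>\<star>))"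
    using square_relation[OF _ _ _ r3[OF i]] G' canon_defect[OF sub]
    by (simp add: canon_gen_products star_polys_closed sum.reindex)
qed (use q in \<open>simp_all add: unit_props(1,2)\<close>)

end

lemma even_ball_relations_canon:
  fixes p :: "nat star_poly \<Rightarrow> real"
  assumes "poly_seminorm {1..n} p" "0 < q" "q < 1" and rel: "\<And>r. r \<in> even_rels q n \<Longrightarrow> p r = 0"
  shows "even_ball_relations q n (poly_seminorm.unit {1..n} p) (\<lambda>i. poly_seminorm.canon {1..n} p (gen i))"
proof -
  interpret poly_seminorm "{1..n}" p by fact
  show ?thesis
  proof (rule even_relations[of n "\<lambda>i. i" q])
    fix i j assume "1 \<le> i" "i < j" "j \<le> n"
    then show "p (gen i * gen j - cst (of_real (q powr (1/2))) * (gen j * gen i)) = 0"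
      "p (gen i * adj (gen j) - cst (of_real (q powr (-1/2))) * (adj (gen j) * gen i)) = 0"
      by (intro rel; unfold even_rels_def; blast)+
  next
    fix i assume "i \<in> {1..n}"
    then have "1 \<le> i \<and> i \<le> n" by simp
    then show "p (adj (gen i) * gen i - cst (of_real q) * (gen i * adj (gen i))
       - cst (of_real (1 - q)) * (1 - (\<Sum>j\<in>(\<lambda>i. i) ` {i+1..n}. gen j * adj (gen j)))) = 0"
      unfolding image_ident by (intro rel; unfold even_rels_def; blast)
  qed (use assms in auto)
qed

lemma odd_ball_relations_canon:
  fixes p :: "nat star_poly \<Rightarrow> real"
  assumes "poly_seminorm {1..n+1} p" "0 < q" "q < 1" and rel: "\<And>r. r \<in> odd_rels q n \<Longrightarrow> p r = 0"
  shows "even_ball_relations q n (poly_seminorm.unit {1..n+1} p) (\<lambda>i. poly_seminorm.canon {1..n+1} p (gen (i+1)))"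
    "(poly_seminorm.canon {1..n+1} p (gen 1))\<^sup>\<star> = poly_seminorm.canon {1..n+1} p (gen 1)"
    "i \<in> {1..n} \<Longrightarrow> poly_seminorm.canon {1..n+1} p (gen 1) * poly_seminorm.canon {1..n+1} p (gen (i+1))
      = sqrt q *\<^sub>R (poly_seminorm.canon {1..n+1} p (gen (i+1)) * poly_seminorm.canon {1..n+1} p (gen 1))"
proof -
  interpret poly_seminorm "{1..n+1}" p by fact
  show "even_ball_relations q n unit (\<lambda>i. canon (gen (i+1)))"
  proof (rule even_relations[of n "\<lambda>i. i + 1" q])
    fix i j assume "1 \<le> i" "i < j" "j \<le> n"
    then have "1 \<le> i + 1 \<and> i + 1 < j + 1 \<and> j + 1 \<le> n + 1" "2 \<le> i + 1 \<and> i + 1 < j + 1 \<and> j + 1 \<le> n + 1" by auto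
    then show "p (gen (i+1) * gen (j+1) - cst (of_real (q powr (1/2))) * (gen (j+1) * gen (i+1))) = 0"
      "p (gen (i+1) * adj (gen (j+1)) - cst (of_real (q powr (-1/2))) * (adj (gen (j+1)) * gen (i+1))) = 0"
      by (intro rel; unfold odd_rels_def; blast)+
  next
    fix i assume "i \<in> {1..n}"
    then have "2 \<le> i + 1 \<and> i + 1 \<le> n + 1" by simp
    moreover have "(\<lambda>i. i + 1) ` {i+1..n} = {i+1+1..n+1}" by (rule image_add_atLeastAtMost')
    ultimately show "p (adj (gen (i+1)) * gen (i+1) - cst (of_real q) * (gen (i+1) * adj (gen (i+1)))
       - cst (of_real (1 - q)) * (1 - (\<Sum>j\<in>(\<lambda>i. i + 1) ` {i+1..n}. gen j * adj (gen j)))) = 0"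
      by (simp only:) (intro rel; unfold odd_rels_def; blast)
  qed (use assms in auto)
  have "gen 1 - adj (gen 1) \<in> odd_rels q n" by (simp add: odd_rels_def)
  then have "canon (gen 1 - adj (gen 1)) = 0" by (intro canon_eq_0 rel) (auto intro!: star_polys_closed)
  then show "(canon (gen 1))\<^sup>\<star> = canon (gen 1)" by (simp add: canon_simps star_polys_closed)
  assume "i \<in> {1..n}"
  then have i: "1 \<le> (1::nat) \<and> 1 < i + 1 \<and> i + 1 \<le> n + 1" by simp
  then have "p (gen 1 * gen (i+1) - cst (of_real (q powr (1/2))) * (gen (i+1) * gen 1)) = 0"
    by (intro rel; unfold odd_rels_def; blast)
  from commutation_relation[OF _ _ this] i assms(2)
  show "canon (gen 1) * canon (gen (i+1)) = sqrt q *\<^sub>R (canon (gen (i+1)) * canon (gen 1))"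
    by (simp add: canon_gen_products star_polys_closed powr_half)
qed

lemma even_universal:
  assumes q: "0 < q" "q < 1" shows "universal {1..n} (even_rels q n) {}"
proof
  have "p (gen i) \<le> 2 ^ n" if p: "admissible {1..n} (even_rels q n) {} p" and i: "i \<in> {1..n}" for p i
  proof -
    have ps: "poly_seminorm {1..n} p" using p by unfold_locales (simp add: admissible_def)
    interpret poly_seminorm "{1..n}" p by (fact ps)
    interpret even_ball_relations q n unit "\<lambda>i. canon (gen i)"
      using p by (intro even_ball_relations_canon[OF ps q]) (simp add: admissible_def)
    show ?thesis using norm_z_le[OF i] i by (simp add: canon_simps)
  qed
  then show "\<exists>M. \<forall>p. admissible {1..n} (even_rels q n) {} p \<longrightarrow> (\<forall>g\<in>{1..n}. p (gen g) \<le> M)" by blast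
qed (rule even_rels_subset)

text \<open>
  The generators after the first are bounded as in the even ball. For the first one, the positivity
  relation provides \<open>b\<close> such that \<open>x\<^sub>1\<^sup>2 + b\<^sup>* b\<close> is within 1 of a combination of the others; since
  \<open>b\<^sup>* b\<close> is positive, it bounds \<open>x\<^sub>1\<^sup>2\<close>.
\<close>

lemma odd_universal:
  assumes q: "0 < q" "q < 1" shows "universal {1..n+1} (odd_rels q n) (odd_pos_rels n)"
proof
  have "p (gen i) \<le> 2 ^ n + (2 + real n * 2 ^ n * 2 ^ n)"
    if p: "admissible {1..n+1} (odd_rels q n) (odd_pos_rels n) p" and i: "i \<in> {1..n+1}" for p i
  proof -
    have ps: "poly_seminorm {1..n+1} p" using p by unfold_locales (simp add: admissible_def)
    interpret poly_seminorm "{1..n+1}" p by (fact ps)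
    have rel: "p r = 0" if "r \<in> odd_rels q n" for r using p that by (simp add: admissible_def)
    note rels = odd_ball_relations_canon[OF ps q rel]
    interpret even_ball_relations q n unit "\<lambda>i. canon (gen (i+1))" by (rule rels(1))
    define x where "x = canon (gen 1)"
    define S where "S = (\<Sum>j\<in>{1..n}. canon (gen (j+1)) * (canon (gen (j+1)))\<^sup>\<star>)"
    show ?thesis
    proof (cases "i = 1")
      case False
      with i have "i - 1 \<in> {1..n}" "i - 1 + 1 = i" by auto
      then have "p (gen i) \<le> 2 ^ n" using norm_z_le[of "i - 1"] i by (simp add: canon_simps)
      then show ?thesis by (rule order_trans) (simp add: add_increasing2)
    next
      case True
      let ?h = "1 - ((gen 1)\<^sup>2 + (\<Sum>j\<in>{2..n+1}. gen j * adj (gen j))) :: nat star_poly"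
      have "\<exists>b\<in>star_polys {1..n+1}. p (?h - adj b * b) < 1"
      proof -
        have "?h \<in> odd_pos_rels n" by (simp add: odd_pos_rels_def)
        with p have "\<forall>\<epsilon>>0. \<exists>b\<in>star_polys {1..n+1}. p (?h - adj b * b) < \<epsilon>" unfolding admissible_def by blast
        then show ?thesis using zero_less_one by blast
      qed
      then obtain b where b: "b \<in> star_polys {1..n+1}" "p (?h - adj b * b) < 1" by blast
      have sub: "{2..n+1} \<subseteq> {1..n+1}" by auto
      have h: "?h = (1 - (\<Sum>j\<in>{2..n+1}. gen j * adj (gen j))) - gen 1 * gen 1" by (simp add: power2_eq_square algebra_simps)
      have shift: "(\<Sum>j\<in>{2..n+1}. canon (gen j) * (canon (gen j))\<^sup>\<star>) = S"
        unfolding S_def using sum.shift_bounds_cl_nat_ivl[of "\<lambda>j. canon (gen j) * (canon (gen j))\<^sup>\<star>" 1 1 n] by simp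
      have cl: "gen 1 * gen 1 \<in> star_polys {1..n+1}" "adj b * b \<in> star_polys {1..n+1}"
        "(1 - (\<Sum>j\<in>{2..n+1}. gen j * adj (gen j))) - gen 1 * gen 1 \<in> star_polys {1..n+1}"
        using b(1) by (auto intro!: star_polys_closed canon_defect(2)[OF sub])
      have "canon (?h - adj b * b) = unit - S - x * x - (canon b)\<^sup>\<star> * canon b"
        unfolding h using b(1) cl canon_defect[OF sub]
        by (simp add: canon_simps canon_gen_products star_polys_closed shift x_def)
      moreover have "norm (canon (?h - adj b * b)) < 1"
        using b(2) cl unfolding h by (subst canon_simps(6)) (auto intro: star_polys_closed)
      ultimately have n1: "norm (unit - S - x * x - (canon b)\<^sup>\<star> * canon b) < 1" by simp
      have nS: "norm S \<le> real n * (2 ^ n * 2 ^ n)"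
      proof -
        have "norm (canon (gen (j+1)) * (canon (gen (j+1)))\<^sup>\<star>) \<le> 2 ^ n * 2 ^ n" if "j \<in> {1..n}" for j
          using norm_z_le[OF that] by (intro order_trans[OF norm_mult_ineq mult_mono]) simp_all
        then have "norm S \<le> of_nat (card {1..n}) * (2 ^ n * 2 ^ n)" unfolding S_def by (rule sum_norm_bound)
        then show ?thesis by simp
      qed
      have nu: "norm unit \<le> 1" using seminorm_one_le[OF seminorm] by (simp add: canon_simps flip: canon_one)
      have "(norm x)\<^sup>2 = norm (x * x)" using rels(2) by (simp add: x_def norm_self_adjoint_square)
      also have "\<dots> \<le> norm (x * x + (canon b)\<^sup>\<star> * canon b)"
        using rels(2) pos_square[of x] by (intro norm_pos_mono pos_dag_mult) (simp add: x_def)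
      also have "x * x + (canon b)\<^sup>\<star> * canon b = unit - S - (unit - S - x * x - (canon b)\<^sup>\<star> * canon b)" by simp
      also have "norm \<dots> \<le> 1 + real n * (2 ^ n * 2 ^ n) + 1"
        using n1 nS nu by (intro order_trans[OF norm_triangle_ineq4 add_mono] order_trans[OF norm_triangle_ineq4 add_mono]) auto
      finally have x2: "(norm x)\<^sup>2 \<le> 2 + real n * (2 ^ n * 2 ^ n)" by simp
      have "norm x \<le> 2 + real n * (2 ^ n * 2 ^ n)"
      proof (cases "norm x \<le> 1")
        case False
        then have "norm x * 1 \<le> norm x * norm x" by (intro mult_left_mono) auto
        with x2 show ?thesis by (simp add: power2_eq_square)
      qed (simp add: add_increasing2)
      then have "norm x \<le> 2 ^ n + (2 + real n * 2 ^ n * 2 ^ n)" by (simp add: mult.assoc add_increasing)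
      then show ?thesis using True i by (simp add: x_def canon_simps)
    qed
  qed
  then show "\<exists>M. \<forall>p. admissible {1..n+1} (odd_rels q n) (odd_pos_rels n) p \<longrightarrow> (\<forall>g\<in>{1..n+1}. p (gen g) \<le> M)" by blast
qed (rule odd_rels_subset)

lemma cscale_scaleR: "c *\<^sub>C (r *\<^sub>R x) = r *\<^sub>R (c *\<^sub>C x)" "r *\<^sub>R (c *\<^sub>C x) = (of_real r * c) *\<^sub>C x"
  by (simp_all flip: cscale_of_real add: mult.commute)

context even_ball_relations
begin

lemma rotated:
  assumes "\<And>i. i \<in> {1..n} \<Longrightarrow> cmod (u i) = 1"
  shows "even_ball_relations q n e (\<lambda>i. u i *\<^sub>C z i)"
proof
  have u: "u i * cnj (u i) = 1" "cnj (u i) * u i = 1" if "i \<in> {1..n}" for i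
    using assms[OF that] complex_norm_square[of "u i"] by (simp_all add: mult.commute)
  fix i j assume ij: "1 \<le> i" "i < j" "j \<le> n"
  show "(u i *\<^sub>C z i) * (u j *\<^sub>C z j) = sqrt q *\<^sub>R ((u j *\<^sub>C z j) * (u i *\<^sub>C z i))"
    by (simp add: z_z[OF ij] cscale_scaleR(2) flip: cscale_of_real add: ac_simps)
  show "(u i *\<^sub>C z i) * (u j *\<^sub>C z j)\<^sup>\<star> = (1 / sqrt q) *\<^sub>R ((u j *\<^sub>C z j)\<^sup>\<star> * (u i *\<^sub>C z i))"
    by (simp add: z_zs[OF ij] flip: cscale_of_real add: ac_simps)
next
  have u: "u i * cnj (u i) = 1" "cnj (u i) * u i = 1" if "i \<in> {1..n}" for i
    using assms[OF that] complex_norm_square[of "u i"] by (simp_all add: mult.commute)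
  fix i assume i: "i \<in> {1..n}"
  show "e * (u i *\<^sub>C z i) = u i *\<^sub>C z i" "(u i *\<^sub>C z i) * e = u i *\<^sub>C z i" using i by (simp_all add: e_z)
  have "(\<Sum>j\<in>{i+1..n}. (u j *\<^sub>C z j) * (u j *\<^sub>C z j)\<^sup>\<star>) = (\<Sum>j\<in>{i+1..n}. z j * (z j)\<^sup>\<star>)"
    using i by (intro sum.cong) (auto simp: u)
  then show "(u i *\<^sub>C z i)\<^sup>\<star> * (u i *\<^sub>C z i) = q *\<^sub>R ((u i *\<^sub>C z i) * (u i *\<^sub>C z i)\<^sup>\<star>)
      + (1 - q) *\<^sub>R (e - (\<Sum>j\<in>{i+1..n}. (u j *\<^sub>C z j) * (u j *\<^sub>C z j)\<^sup>\<star>))"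
    using i by (simp add: u zs_z[OF i])
qed (use q e_dag e_e in auto)

lemma rotated_defect:
  assumes "\<And>i. i \<in> {1..n} \<Longrightarrow> cmod (u i) = 1"
  shows "even_ball_relations.defect n e (\<lambda>i. u i *\<^sub>C z i) 1 = defect 1"
proof -
  interpret R: even_ball_relations q n e "\<lambda>i. u i *\<^sub>C z i" by (rule rotated[OF assms])
  have u: "u i * cnj (u i) = 1" "cnj (u i) * u i = 1" if "i \<in> {1..n}" for i
    using assms[OF that] complex_norm_square[of "u i"] by (simp_all add: mult.commute)
  have "(\<Sum>j\<in>{1..n}. (u j *\<^sub>C z j) * (u j *\<^sub>C z j)\<^sup>\<star>) = (\<Sum>j\<in>{1..n}. z j * (z j)\<^sup>\<star>)"
    by (intro sum.cong) (simp_all add: u)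
  then show ?thesis unfolding R.defect_def defect_def by simp
qed

text \<open>
  Zero is a default value for generators outside the range of indices.
\<close>

definition even_value where "even_value i = (if i \<in> {1..n} then z i else 0)"

lemma even_value_corner: "corner_values e even_value"
  by unfold_locales (simp_all add: e_dag e_e even_value_def e_z)

lemma even_value_rel: assumes "r \<in> even_rels q n" shows "eval_poly e even_value r = 0"
proof -
  interpret corner_values e even_value by (rule even_value_corner)
  consider (1) i j where "1 \<le> i" "i < j" "j \<le> n" "r = gen i * gen j - cst (of_real (q powr (1/2))) * (gen j * gen i)"
    | (2) i j where "1 \<le> i" "i < j" "j \<le> n" "r = gen i * adj (gen j) - cst (of_real (q powr (-1/2))) * (adj (gen j) * gen i)"
    | (3) i where "1 \<le> i" "i \<le> n" "r = adj (gen i) * gen i - cst (of_real q) * (gen i * adj (gen i))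
       - cst (of_real (1 - q)) * (1 - (\<Sum>j\<in>{i+1..n}. gen j * adj (gen j)))"
    using assms unfolding even_rels_def by blast
  then show ?thesis
  proof cases
    case 1
    then show ?thesis using z_z[OF 1(1-3)] q
      by (simp only: ev_diff ev_cst_mult) (simp add: ev_mult ev_gen even_value_def powr_half cscale_of_real)
  next
    case 2
    then show ?thesis using z_zs[OF 2(1-3)] q
      by (simp only: ev_diff ev_cst_mult powr_half) (simp add: ev_mult ev_gen ev_adj even_value_def cscale_of_real del: of_real_divide)
  next
    case 3
    then have "i \<in> {1..n}" by simp
    moreover have "(\<Sum>j\<in>{i+1..n}. even_value j * (even_value j)\<^sup>\<star>) = (\<Sum>j\<in>{i+1..n}. z j * (z j)\<^sup>\<star>)"
      using 3 by (intro sum.cong) (auto simp: even_value_def)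
    moreover have "even_value i = z i" using 3 by (simp add: even_value_def)
    ultimately show ?thesis using zs_z[of i] unfolding 3(3)
      by (simp only: ev_diff ev_cst_mult) (simp only: ev_mult ev_gen ev_adj ev_sum ev_one ev_diff cscale_of_real, simp)
  qed
qed

text \<open>
  Any self-adjoint root \<open>t\<close> of the defect that commutes with the generators up to \<open>q\<^sup>1\<^sup>/\<^sup>2\<close> extends the
  generators of an even ball to those of the boundary of an odd ball. It will be the positive root or its
  negative.
\<close>

definition odd_value where "odd_value t i = (if i = 1 then t else even_value (i - 1))"

context
  fixes t
  assumes t: "t\<^sup>\<star> = t" "e * t = t" "t * e = t" "t * t = defect 1"
    and tz: "\<And>i. i \<in> {1..n} \<Longrightarrow> t * z i = sqrt q *\<^sub>R (z i * t)"
begin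

lemma odd_value_corner: "corner_values e (odd_value t)"
  by unfold_locales (simp_all add: e_dag e_e odd_value_def even_value_def e_z t)

lemma odd_value_simps: "odd_value t 1 = t" "2 \<le> i \<Longrightarrow> i \<le> n + 1 \<Longrightarrow> odd_value t i = z (i - 1)"
  by (auto simp: odd_value_def even_value_def)

lemma odd_value_sum:
  assumes "1 \<le> i"
  shows "(\<Sum>j\<in>{i+1..n+1}. odd_value t j * (odd_value t j)\<^sup>\<star>) = (\<Sum>j\<in>{i..n}. z j * (z j)\<^sup>\<star>)"
proof -
  have "(\<Sum>j\<in>{i+1..n+1}. odd_value t j * (odd_value t j)\<^sup>\<star>) = (\<Sum>j\<in>{i..n}. odd_value t (j+1) * (odd_value t (j+1))\<^sup>\<star>)"
    by (rule sum.shift_bounds_cl_nat_ivl)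
  also have "\<dots> = (\<Sum>j\<in>{i..n}. z j * (z j)\<^sup>\<star>)"
    using assms by (intro sum.cong) (auto simp: odd_value_def even_value_def)
  finally show ?thesis .
qed

lemma odd_value_rel: assumes "r \<in> odd_rels q n \<union> odd_pos_rels n" shows "eval_poly e (odd_value t) r = 0"
proof -
  interpret corner_values e "odd_value t" by (rule odd_value_corner)
  consider (0) "r = gen 1 - adj (gen 1)"
    | (1) i j where "1 \<le> i" "i < j" "j \<le> n + 1" "r = gen i * gen j - cst (of_real (q powr (1/2))) * (gen j * gen i)"
    | (2) i j where "2 \<le> i" "i < j" "j \<le> n + 1" "r = gen i * adj (gen j) - cst (of_real (q powr (-1/2))) * (adj (gen j) * gen i)"
    | (3) i where "2 \<le> i" "i \<le> n + 1" "r = adj (gen i) * gen i - cst (of_real q) * (gen i * adj (gen i))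
       - cst (of_real (1 - q)) * (1 - (\<Sum>j\<in>{i+1..n+1}. gen j * adj (gen j)))"
    | (4) "r = 1 - ((gen 1)\<^sup>2 + (\<Sum>j\<in>{2..n+1}. gen j * adj (gen j)))"
    using assms unfolding odd_rels_def odd_pos_rels_def by blast
  then show ?thesis
  proof cases
    case 0
    then show ?thesis by (simp add: ev_simps odd_value_simps t)
  next
    case 1
    have "odd_value t i * odd_value t j = sqrt q *\<^sub>R (odd_value t j * odd_value t i)"
    proof (cases "i = 1")
      case True
      then have "j - 1 \<in> {1..n}" "2 \<le> j" using 1 by auto
      then show ?thesis using tz[of "j - 1"] 1 True by (simp add: odd_value_simps)
    next
      case False
      then have "1 \<le> i - 1" "i - 1 < j - 1" "j - 1 \<le> n" "2 \<le> i" "2 \<le> j" using 1 by auto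
      then show ?thesis using z_z[of "i - 1" "j - 1"] 1 by (simp add: odd_value_simps)
    qed
    then show ?thesis using q unfolding 1(4)
      by (simp only: ev_diff ev_cst_mult) (simp add: ev_mult ev_gen powr_half cscale_of_real)
  next
    case 2
    then have "1 \<le> i - 1" "i - 1 < j - 1" "j - 1 \<le> n" "2 \<le> i" "2 \<le> j" by auto
    then show ?thesis using z_zs[of "i - 1" "j - 1"] 2 q
      by (simp only: ev_diff ev_cst_mult powr_half) (simp add: ev_mult ev_gen ev_adj odd_value_simps cscale_of_real del: of_real_divide)
  next
    case 3
    then have i: "i - 1 \<in> {1..n}" "1 \<le> i" and i1: "i - 1 + 1 = i" by auto
    have "odd_value t i = z (i - 1)" using 3 by (simp add: odd_value_simps)
    with zs_z[OF i(1)] odd_value_sum[OF i(2)] show ?thesis unfolding 3(3) i1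
      by (simp only: ev_diff ev_cst_mult) (simp only: ev_mult ev_gen ev_adj ev_sum ev_one ev_diff cscale_of_real, simp)
  next
    case 4
    have "(\<Sum>j\<in>{2..n+1}. odd_value t j * (odd_value t j)\<^sup>\<star>) = (\<Sum>j\<in>{1..n}. z j * (z j)\<^sup>\<star>)"
      using odd_value_sum[of 1] by simp
    then show ?thesis unfolding 4 power2_eq_square
      by (simp only: ev_simps) (simp add: odd_value_simps t defect_def)
  qed
qed

end

end

section \<open>The isomorphism\<close>

locale quantum_balls =
  fixes q :: real and n :: nat
  assumes q: "0 < q" "q < 1"
begin

sublocale E: universal "{1..n}" "even_rels q n" "{}" by (rule even_universal[OF q])
sublocale D: universal "{1..n+1}" "odd_rels q n" "odd_pos_rels n" by (rule odd_universal[OF q])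

abbreviation zB where "zB i \<equiv> E.canon (gen i)"
abbreviation zO where "zO i \<equiv> D.canon (gen (i + 1))"
abbreviation x1 where "x1 \<equiv> D.canon (gen 1)"

sublocale B: even_ball_relations q n E.unit "\<lambda>i. E.canon (gen i)"
  by (rule even_ball_relations_canon[OF E.poly_seminorm_axioms q E.pu_rel])

lemma odd_canon:
  "even_ball_relations q n D.unit (\<lambda>i. D.canon (gen (i + 1)))" "x1\<^sup>\<star> = x1"
  "i \<in> {1..n} \<Longrightarrow> x1 * zO i = sqrt q *\<^sub>R (zO i * x1)"
  by (rule odd_ball_relations_canon[OF D.poly_seminorm_axioms q D.pu_rel]; assumption)+

sublocale O: even_ball_relations q n D.unit "\<lambda>i. D.canon (gen (i + 1))"
  by (rule odd_canon(1))

lemma even_ball_eq: "even_ball q n = E.U"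
  by (simp add: even_ball_def E.universal_cstar_eq)

lemma odd_ball_eq: "odd_ball q n = D.U"
  by (simp add: odd_ball_def D.universal_cstar_eq)

lemma z_gen_eq: "z_gen q n i = E.cl (\<lambda>k. gen i)"
  by (simp add: z_gen_def E.universal_gen_eq)

lemma x_gen_eq: "x_gen q n i = D.cl (\<lambda>k. gen i)"
  by (simp add: x_gen_def D.universal_gen_eq)

lemma z_gen: "i \<in> {1..n} \<Longrightarrow> z_gen q n i \<in> carrier E.U" "embed E.U (z_gen q n i) = zB i"
  by (simp_all add: z_gen_eq E.cl_closed E.canon_def)

lemma x_gen: "i \<in> {1..n+1} \<Longrightarrow> x_gen q n i \<in> carrier D.U" "embed D.U (x_gen q n i) = D.canon (gen i)"
  by (simp_all add: x_gen_eq D.cl_closed D.canon_def)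

lemma unit_eq: "E.unit = E.UR.unit_elem" "D.unit = D.UR.unit_elem"
  by (simp_all add: E.unit_def E.UR.unit_elem_def D.unit_def D.UR.unit_elem_def)

lemma even_defect: "even_defect q n \<in> carrier E.U" "embed E.U (even_defect q n) = B.defect 1"
proof -
  have z: "z_gen q n j \<otimes>\<^bsub>E.U\<^esub> star E.U (z_gen q n j) \<in> carrier E.U"
    "embed E.U (z_gen q n j \<otimes>\<^bsub>E.U\<^esub> star E.U (z_gen q n j)) = zB j * (zB j)\<^sup>\<star>" if "j \<in> {1..n}" for j
    using z_gen(1)[OF that] by (simp_all add: E.UR.star_closed E.UR.embed_hom z_gen(2))
  have "(\<Oplus>\<^bsub>E.U\<^esub>j\<in>{1..n}. z_gen q n j \<otimes>\<^bsub>E.U\<^esub> star E.U (z_gen q n j)) \<in> carrier E.U"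
    "embed E.U (\<Oplus>\<^bsub>E.U\<^esub>j\<in>{1..n}. z_gen q n j \<otimes>\<^bsub>E.U\<^esub> star E.U (z_gen q n j)) = (\<Sum>j\<in>{1..n}. zB j * (zB j)\<^sup>\<star>)"
    using E.UR.embed_finsum[of "{1..n}" "\<lambda>j. z_gen q n j \<otimes>\<^bsub>E.U\<^esub> star E.U (z_gen q n j)", OF finite_atLeastAtMost z(1)]
    by (simp_all add: z(2))
  then show "even_defect q n \<in> carrier E.U" "embed E.U (even_defect q n) = B.defect 1"
    by (simp_all add: even_defect_def even_ball_eq Let_def E.UR.embed_hom B.defect_def flip: E.unit_def)
qed

lemma odd_defect: "odd_defect q n \<in> carrier D.U" "embed D.U (odd_defect q n) = O.defect 1 - x1 * x1"
proof -
  have z: "x_gen q n j \<otimes>\<^bsub>D.U\<^esub> star D.U (x_gen q n j) \<in> carrier D.U"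
    "embed D.U (x_gen q n j \<otimes>\<^bsub>D.U\<^esub> star D.U (x_gen q n j)) = D.canon (gen j) * (D.canon (gen j))\<^sup>\<star>" if "j \<in> {2..n+1}" for j
    using x_gen(1)[of j] that by (simp_all add: D.UR.star_closed D.UR.embed_hom x_gen(2))
  have sh: "(\<Sum>j\<in>{2..n+1}. D.canon (gen j) * (D.canon (gen j))\<^sup>\<star>) = (\<Sum>j\<in>{1..n}. zO j * (zO j)\<^sup>\<star>)"
    using sum.shift_bounds_cl_nat_ivl[of "\<lambda>j. D.canon (gen j) * (D.canon (gen j))\<^sup>\<star>" 1 1 n] by simp
  have "(\<Oplus>\<^bsub>D.U\<^esub>j\<in>{2..n+1}. x_gen q n j \<otimes>\<^bsub>D.U\<^esub> star D.U (x_gen q n j)) \<in> carrier D.U"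
    "embed D.U (\<Oplus>\<^bsub>D.U\<^esub>j\<in>{2..n+1}. x_gen q n j \<otimes>\<^bsub>D.U\<^esub> star D.U (x_gen q n j)) = (\<Sum>j\<in>{1..n}. zO j * (zO j)\<^sup>\<star>)"
    using D.UR.embed_finsum[of "{2..n+1}" "\<lambda>j. x_gen q n j \<otimes>\<^bsub>D.U\<^esub> star D.U (x_gen q n j)", OF finite_atLeastAtMost z(1)]
    by (simp_all add: z(2) sh)
  moreover have "x_gen q n 1 \<in> carrier D.U" by (rule x_gen) simp
  ultimately show "odd_defect q n \<in> carrier D.U" "embed D.U (odd_defect q n) = O.defect 1 - x1 * x1"
    by (simp_all add: odd_defect_def odd_ball_eq Let_def D.UR.embed_hom O.defect_def x_gen(2) flip: D.unit_def)
qed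

sublocale K: cstar_quotient E.U "even_defect q n" "even_ideal q n"
proof unfold_locales
  have "embed E.U (star E.U (even_defect q n)) = embed E.U (even_defect q n)"
    using even_defect pos_dag[OF B.pos_defect] by (simp add: E.UR.embed_hom)
  then show "star E.U (even_defect q n) = even_defect q n"
    using even_defect(1) by (simp add: E.UR.embed_inject E.UR.star_closed)
qed (simp_all add: even_defect(1) even_ideal_def even_ball_eq)

sublocale I: cstar_quotient D.U "odd_defect q n" "odd_ideal q n"
proof unfold_locales
  have "embed D.U (star D.U (odd_defect q n)) = embed D.U (odd_defect q n)"
    using odd_defect pos_dag[OF O.pos_defect] odd_canon(2) by (simp add: D.UR.embed_hom)
  then show "star D.U (odd_defect q n) = odd_defect q n"
    using odd_defect(1) by (simp add: D.UR.embed_inject D.UR.star_closed)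
qed (simp_all add: odd_defect(1) odd_ideal_def odd_ball_eq)

definition root where "root = embed E.U (cstar_sqrt E.U (even_defect q n))"

lemma root: "cstar_sqrt E.U (even_defect q n) \<in> carrier E.U" "pos root" "root * root = B.defect 1" 
    "E.unit * root = root" "root * E.unit = root"
proof -
  have p: "pos (embed E.U (even_defect q n))" using B.pos_defect by (simp add: even_defect)
  note s = E.UR.cstar_sqrt_props[OF even_defect(1) p]
  show "cstar_sqrt E.U (even_defect q n) \<in> carrier E.U" "pos root" "root * root = B.defect 1"
    using s by (simp_all add: root_def even_defect(2))
  show "E.unit * root = root" using E.UR.unit_embed[OF s(1)] by (simp add: root_def unit_eq)
  then show "root * E.unit = root" using E.unit_props(3)[of root] by simp
qed

text \<open>
  All four homomorphisms come from the universal property; the phases \<open>lam\<close> are absorbed by the fact that the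
  relations are invariant under rotation of the generators.
\<close>

lemma gluing_data:
  assumes lam: "\<And>j. j \<in> {1..n} \<Longrightarrow> cmod (lam j) = 1"
  obtains F1 F2 \<iota>1 \<iota>2 where "gluing q n E.unit zB D.unit zO lam x1 root F1 F2 \<iota>1 \<iota>2 I.J' K.J'"
    "\<And>x. E.unit * F2 x = F2 x"
proof -
  interpret R: even_ball_relations q n E.unit "\<lambda>i. lam i *\<^sub>C zB i" by (rule B.rotated[OF lam])
  have lam': "\<And>i. i \<in> {1..n} \<Longrightarrow> cmod (cnj (lam i)) = 1" using lam by simp
  interpret R': even_ball_relations q n D.unit "\<lambda>i. cnj (lam i) *\<^sub>C zO i" by (rule O.rotated[OF lam'])
  note rz = B.root_z[OF root(2,3)]
  have s1: "root\<^sup>\<star> = root" "root * root = R.defect 1" "i \<in> {1..n} \<Longrightarrow> root * (lam i *\<^sub>C zB i) = sqrt q *\<^sub>R (lam i *\<^sub>C zB i * root)" for i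
    using root(2,3) B.rotated_defect[OF lam] rz[of i] by (simp_all add: pos_dag cscale_scaleR(1))
  have s2: "(- root)\<^sup>\<star> = - root" "- root * - root = B.defect 1" "i \<in> {1..n} \<Longrightarrow> - root * zB i = sqrt q *\<^sub>R (zB i * - root)"
    "E.unit * - root = - root" "- root * E.unit = - root" for i
    using root rz[of i] by (simp_all add: pos_dag)
  have c1: "corner_values E.unit (R.odd_value root)" by (rule R.odd_value_corner) (fact s1 root)+
  have r1: "eval_poly E.unit (R.odd_value root) r = 0" if "r \<in> odd_rels q n \<union> odd_pos_rels n" for r
    by (rule R.odd_value_rel) (fact s1 root that)+
  have c2: "corner_values E.unit (B.odd_value (- root))" by (rule B.odd_value_corner) (fact s2)+
  have r2: "eval_poly E.unit (B.odd_value (- root)) r = 0" if "r \<in> odd_rels q n \<union> odd_pos_rels n" for r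
    by (rule B.odd_value_rel) (fact s2 that)+
  obtain F1 where F1: "star_hom F1" "\<And>f. f \<in> star_polys {1..n+1} \<Longrightarrow> F1 (D.canon f) = eval_poly E.unit (R.odd_value root) f"
    "\<And>x. F1 (D.unit * x) = F1 x" "\<And>x. E.unit * F1 x = F1 x"
    by (rule D.universal_property[OF c1 r1]) auto
  obtain F2 where F2: "star_hom F2" "\<And>f. f \<in> star_polys {1..n+1} \<Longrightarrow> F2 (D.canon f) = eval_poly E.unit (B.odd_value (- root)) f"
    "\<And>x. F2 (D.unit * x) = F2 x" "\<And>x. E.unit * F2 x = F2 x"
    by (rule D.universal_property[OF c2 r2]) auto
  obtain \<iota>1 where \<iota>1: "star_hom \<iota>1" "\<And>f. f \<in> star_polys {1..n} \<Longrightarrow> \<iota>1 (E.canon f) = eval_poly D.unit R'.even_value f"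
    "\<And>x. \<iota>1 (E.unit * x) = \<iota>1 x" "\<And>x. D.unit * \<iota>1 x = \<iota>1 x"
    by (rule E.universal_property[OF R'.even_value_corner]) (auto simp: R'.even_value_rel)
  obtain \<iota>2 where \<iota>2: "star_hom \<iota>2" "\<And>f. f \<in> star_polys {1..n} \<Longrightarrow> \<iota>2 (E.canon f) = eval_poly D.unit O.even_value f"
    "\<And>x. \<iota>2 (E.unit * x) = \<iota>2 x" "\<And>x. D.unit * \<iota>2 x = \<iota>2 x"
    by (rule E.universal_property[OF O.even_value_corner]) (auto simp: O.even_value_rel)
  have "gluing q n E.unit zB D.unit zO lam x1 root F1 F2 \<iota>1 \<iota>2 I.J' K.J'"
  proof unfold_locales
    fix i assume i: "i \<in> {1..n}"
    show "lam i * cnj (lam i) = 1" using lam[OF i] complex_norm_square[of "lam i"] by simp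
    show "x1 * zO i = sqrt q *\<^sub>R (zO i * x1)" by (rule odd_canon(3)[OF i])
    show "F1 (zO i) = lam i *\<^sub>C zB i" "F2 (zO i) = zB i"
      using i by (simp_all add: F1(2) F2(2) corner_values.ev_gen[OF c1] corner_values.ev_gen[OF c2] R.odd_value_def R.even_value_def
        B.odd_value_def B.even_value_def)
    show "\<iota>1 (zB i) = cnj (lam i) *\<^sub>C zO i" "\<iota>2 (zB i) = zO i"
      using i by (simp_all add: \<iota>1(2) \<iota>2(2) corner_values.ev_gen[OF R'.even_value_corner] corner_values.ev_gen[OF O.even_value_corner]
        R'.even_value_def O.even_value_def)
  next
    show "F1 D.unit = E.unit" "F2 D.unit = E.unit"
      using F1(2)[of 1] F2(2)[of 1] by (simp_all add: D.canon_one corner_values.ev_one[OF c1] corner_values.ev_one[OF c2])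
    show "F1 x1 = root" "F2 x1 = - root"
      by (simp_all add: F1(2) F2(2) corner_values.ev_gen[OF c1] corner_values.ev_gen[OF c2] R.odd_value_def B.odd_value_def)
    show "\<iota>1 E.unit = D.unit" "\<iota>2 E.unit = D.unit"
      using \<iota>1(2)[of 1] \<iota>2(2)[of 1]
      by (simp_all add: E.canon_one corner_values.ev_one[OF R'.even_value_corner] corner_values.ev_one[OF O.even_value_corner])
    show "D.unit * x1 = x1" by (rule D.unit_canon) simp
    show "x1\<^sup>\<star> = x1" by (rule odd_canon(2))
  next
    have "{1..n+1} = insert 1 ((\<lambda>i. i + 1) ` {1..n})" by (auto simp: image_iff Suc_eq_plus1 intro!: bexI[of _ "_ - 1"])
    then have "(\<lambda>g. D.canon (gen g)) ` {1..n+1} = insert x1 (zO ` {1..n})" by (simp only: image_insert image_image)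
    then show "generates D.unit (insert x1 (zO ` {1..n}))" using D.generates_canon by simp
    show "generates E.unit (zB ` {1..n})" by (rule E.generates_canon)
    show "closed_ideal_of I.J'" "O.defect 1 - x1 * x1 \<in> I.J'" using I.J'(1,2) by (simp_all add: odd_defect)
    show "I.J' \<subseteq> J" if "closed_ideal_of J" "O.defect 1 - x1 * x1 \<in> J" for J
      using I.J'(3)[OF that(1)] that(2) by (simp add: odd_defect)
    show "closed_ideal_of K.J'" "B.defect 1 \<in> K.J'" using K.J'(1,2) by (simp_all add: even_defect)
    show "K.J' \<subseteq> L" if "closed_ideal_of L" "B.defect 1 \<in> L" for L
      using K.J'(3)[OF that(1)] that(2) by (simp add: even_defect)
  qed (fact root F1 F2 \<iota>1 \<iota>2 D.unit_props(3) E.unit_props(3))+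
  then show ?thesis using F2(4) by (rule that)
qed

end

theorem proposition5p1:
  fixes q :: real and n :: nat and lam :: "nat \<Rightarrow> complex"
    and \<beta> :: "nat univ set \<Rightarrow> nat univ set"
  assumes "0 < q" and "q < 1" and "n \<ge> 1"
    and "\<And>j. j \<in> {1..n} \<Longrightarrow> cmod (lam j) = 1"
    and "\<beta> \<in> star_iso (even_boundary q n) (even_boundary q n)"
    and "\<And>j. j \<in> {1..n} \<Longrightarrow> \<beta> (w_gen q n j) = lam j \<odot>\<^bsub>even_boundary q n\<^esub> w_gen q n j"
  shows "\<exists>\<phi> \<in> star_iso (odd_boundary q n) (glued_sphere q n \<beta>).
    \<forall>i\<in>{1..n+1}. \<phi> (t_gen q n i) = e_gen q n lam (i - 1)"
proof -
  interpret quantum_balls q n using assms(1,2) by unfold_locales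
  obtain F1 F2 \<iota>1 \<iota>2 where gl: "gluing q n E.unit zB D.unit zO lam x1 root F1 F2 \<iota>1 \<iota>2 I.J' K.J'"
    and eF2: "\<And>x. E.unit * F2 x = F2 x" using gluing_data[of lam] assms(4) by blast
  interpret G: gluing q n E.unit zB D.unit zO lam x1 root F1 F2 \<iota>1 \<iota>2 "I.J'" "K.J'" by (fact gl)
  define \<theta> where "\<theta> t = F1 (\<iota>2 t)" for t
  have \<theta>: "star_hom \<theta>" unfolding \<theta>_def by (rule star_hom_compose[OF G.F(1) G.\<iota>(2)])
  have bd: "even_boundary q n = K.Q" by (simp add: even_boundary_def even_ball_eq)
  have \<beta>: "\<beta> \<in> star_iso K.Q K.Q" using assms(5) by (simp add: bd)
  note hom = K.automorphism_hom[OF \<beta>]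
  have zproj: "K.proj (zB j) = w_gen q n j" if "j \<in> {1..n}" for j
    using K.proj_embed[OF z_gen(1)[OF that]] by (simp add: z_gen(2) w_gen_def even_proj_def even_ball_eq)
  \<comment> \<open>\<open>\<beta>\<close> is induced by \<open>\<theta>\<close>: this holds on generators, and both sides are continuous.\<close>
  have "E.unit * t \<in> {t. \<beta> (K.proj t) = K.proj (\<theta> t)}" for t
  proof (rule generates_induct[OF G.gen_B])
    show "closed {t. \<beta> (K.proj t) = K.proj (\<theta> t)}" by (rule K.automorphism_closed[OF \<beta> \<theta>])
    have "K.proj E.unit = K.proj 1" using K.proj_unit[of 1] by (simp add: unit_eq)
    then show "E.unit \<in> {t. \<beta> (K.proj t) = K.proj (\<theta> t)}"
      using hom(3) K.proj_hom(3) by (simp add: \<theta>_def G.\<iota>(6) G.F(6))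
    fix g assume "g \<in> zB ` {1..n}"
    then obtain i where i: "i \<in> {1..n}" and g: "g = zB i" by blast
    have tz: "\<theta> g = lam i *\<^sub>C g" by (simp add: \<theta>_def g G.\<iota>(8)[OF i] G.F(10)[OF i])
    have bz: "\<beta> (K.proj g) = K.proj (\<theta> g)"
      using assms(6)[OF i] by (simp add: tz K.proj_hom) (simp add: g zproj[OF i] bd)
    then show "g \<in> {t. \<beta> (K.proj t) = K.proj (\<theta> t)}" by simp
    have "\<beta> (K.proj (g\<^sup>\<star>)) = K.proj (\<theta> (g\<^sup>\<star>))"
      by (simp only: hom bz star_homD(3)[OF \<theta>]) (simp only: K.proj_hom)
    then show "g\<^sup>\<star> \<in> {t. \<beta> (K.proj t) = K.proj (\<theta> t)}" by simp
  next
    fix x y c assume "x \<in> {t. \<beta> (K.proj t) = K.proj (\<theta> t)}"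
    then have x: "\<beta> (K.proj x) = K.proj (\<theta> x)" by simp
    have "\<beta> (K.proj (c *\<^sub>C x)) = K.proj (\<theta> (c *\<^sub>C x))"
      by (simp only: hom x star_homD(4)[OF \<theta>]) (simp only: K.proj_hom)
    then show "c *\<^sub>C x \<in> {t. \<beta> (K.proj t) = K.proj (\<theta> t)}" by simp
    assume "y \<in> {t. \<beta> (K.proj t) = K.proj (\<theta> t)}"
    then have y: "\<beta> (K.proj y) = K.proj (\<theta> y)" by simp
    have "\<beta> (K.proj (x + y)) = K.proj (\<theta> (x + y))" "\<beta> (K.proj (x * y)) = K.proj (\<theta> (x * y))"
      by (simp only: hom x y star_homD(1,2)[OF \<theta>], simp only: K.proj_hom)+
    then show "x + y \<in> {t. \<beta> (K.proj t) = K.proj (\<theta> t)}" "x * y \<in> {t. \<beta> (K.proj t) = K.proj (\<theta> t)}" by simp_all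
  qed
  moreover have "\<theta> (E.unit * t) = \<theta> t" for t
    by (simp add: \<theta>_def star_homD(2)[OF G.\<iota>(2)] G.\<iota>(6) G.F(3))
  moreover have "K.proj (E.unit * t) = K.proj t" for t using K.proj_unit[of t] by (simp add: unit_eq)
  ultimately have \<beta>\<theta>: "\<beta> (K.proj t) = K.proj (\<theta> t)" for t by simp
  define c where "c t = component t E.U" for t
  have c_emb: "embed E.U (c t) = t" if "E.unit * t = t" for t
    using E.UR.corner_eq[of t] that by (simp add: c_def unit_eq)
  have c_closed: "c t \<in> carrier E.U" for t by (simp add: c_def component_closed E.UR.rec)
  have c_proj: "even_proj q n (c t) = K.proj t" for t by (simp add: even_proj_def even_ball_eq K.proj_def c_def)
  \<comment> \<open>A coset is sent to the images of any representative; \<open>F1\<close> and \<open>F2\<close> vanish on the ideal.\<close>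
  define \<phi> where "\<phi> X = (let t = SOME t. I.proj t = X in (c (F1 t), c (F2 t)))" for X
  have \<phi>: "\<phi> (I.proj t) = (c (F1 t), c (F2 t))" for t
  proof -
    define u where "u = (SOME u. I.proj u = I.proj t)"
    have "I.proj u = I.proj t" unfolding u_def by (rule someI[where x = t]) simp
    then have "D.unit * (u - t) \<in> I.J'" by (simp add: I.proj_eq_iff unit_eq)
    from G.I_subset_kernel[OF this] have "F1 u = F1 t" "F2 u = F2 t"
      by (simp_all add: G.F(3,4) star_homD(8)[OF G.F(1)] star_homD(8)[OF G.F(2)])
    then show ?thesis by (simp add: \<phi>_def u_def)
  qed
  have bdO: "odd_boundary q n = I.Q" by (simp add: odd_boundary_def odd_ball_eq)
  note gs = glued_sphere_def[of q n \<beta>, unfolded even_ball_eq Let_def]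
  note cs = component_simps[OF E.UR.rec] component_cscale[OF E.UR.rec] component_dag[OF E.UR.rec]
  have in_glued: "\<phi> X \<in> carrier (glued_sphere q n \<beta>)" if X: "X \<in> carrier I.Q" for X
  proof -
    from X obtain t where t: "X = I.proj t" by (auto simp: I.carrier_Q)
    have "F1 (D.unit * t) - F1 (\<iota>2 (F2 (D.unit * t))) \<in> K.J'"
      by (rule G.F1_F2) (simp add: D.unit_props(2) flip: mult.assoc)
    then have "K.proj (F1 t) = K.proj (\<theta> (F2 t))" unfolding G.F(3,4) \<theta>_def by (rule K.proj_cong)
    then show ?thesis by (simp add: t \<phi> gs c_closed c_proj \<beta>\<theta>)
  qed
  have "\<phi> \<in> ring_hom I.Q (glued_sphere q n \<beta>)"
  proof (rule ring_hom_memI)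
    show "\<phi> X \<in> carrier (glued_sphere q n \<beta>)" if "X \<in> carrier I.Q" for X by (rule in_glued[OF that])
    fix X Y assume "X \<in> carrier I.Q" "Y \<in> carrier I.Q"
    then obtain t u where tu: "X = I.proj t" "Y = I.proj u" by (auto simp: I.carrier_Q)
    show "\<phi> (X \<otimes>\<^bsub>I.Q\<^esub> Y) = \<phi> X \<otimes>\<^bsub>glued_sphere q n \<beta>\<^esub> \<phi> Y"
      unfolding tu I.proj_hom[symmetric] \<phi> by (simp add: gs c_def cs star_homD[OF G.F(1)] star_homD[OF G.F(2)])
    show "\<phi> (X \<oplus>\<^bsub>I.Q\<^esub> Y) = \<phi> X \<oplus>\<^bsub>glued_sphere q n \<beta>\<^esub> \<phi> Y"
      unfolding tu I.proj_hom[symmetric] \<phi> by (simp add: gs c_def cs star_homD[OF G.F(1)] star_homD[OF G.F(2)])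
  next
    have "F1 1 = E.unit" "F2 1 = E.unit" using G.F(3)[of 1] G.F(4)[of 1] G.F(6,7) by simp_all
    then show "\<phi> \<one>\<^bsub>I.Q\<^esub> = \<one>\<^bsub>glued_sphere q n \<beta>\<^esub>"
      unfolding I.proj_hom(3)[symmetric] \<phi> by (simp add: gs c_def E.unit_def E.UR.component_embed_self)
  qed
  moreover have "bij_betw \<phi> (carrier I.Q) (carrier (glued_sphere q n \<beta>))"
    unfolding bij_betw_def
  proof
    show "inj_on \<phi> (carrier I.Q)"
    proof (rule inj_onI)
      fix X Y assume "X \<in> carrier I.Q" "Y \<in> carrier I.Q" and eq: "\<phi> X = \<phi> Y"
      then obtain t u where tu: "X = I.proj t" "Y = I.proj u" by (auto simp: I.carrier_Q)
      have "c (F1 t) = c (F1 u)" "c (F2 t) = c (F2 u)" using eq by (simp_all add: tu \<phi>)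
      then have "F1 t = F1 u" "F2 t = F2 u" using c_emb G.F(5) eF2 by metis+
      then have "D.unit * (t - u) \<in> I.J'"
        by (intro G.kernel_subset) (simp_all add: G.F star_homD[OF G.F(1)] star_homD[OF G.F(2)] D.unit_props(2) flip: mult.assoc)
      then show "X = Y" by (simp add: tu I.proj_eq_iff unit_eq)
    qed
    show "\<phi> ` carrier I.Q = carrier (glued_sphere q n \<beta>)"
    proof
      show "carrier (glued_sphere q n \<beta>) \<subseteq> \<phi> ` carrier I.Q"
      proof
        fix P assume "P \<in> carrier (glued_sphere q n \<beta>)"
        then obtain x y where P: "P = (x, y)" "x \<in> carrier E.U" "y \<in> carrier E.U" "even_proj q n x = \<beta> (even_proj q n y)"
          by (auto simp: gs)
        define u v where "u = embed E.U x" and "v = embed E.U y"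
        have uv: "c u = x" "c v = y" "E.unit * u = u" "E.unit * v = v"
          using P by (simp_all add: u_def v_def c_def E.UR.component_embed_self E.UR.unit_embed unit_eq)
        have "K.proj u = K.proj (\<theta> v)" using P(4) c_proj[of u] c_proj[of v] by (simp add: uv \<beta>\<theta>)
        \<comment> \<open>\<open>\<iota>2 v\<close> is sent to \<open>(\<theta> v, v)\<close>, and what remains is \<open>(u - \<theta> v, 0)\<close>.\<close>
        then have "E.unit * (u - \<theta> v) \<in> K.J'" by (simp add: K.proj_eq_iff unit_eq)
        then have "u - \<theta> v \<in> K.J'" using uv(3) G.F(5)[of "\<iota>2 v"] by (simp add: right_diff_distrib \<theta>_def)
        then obtain a where a: "F1 a = u - \<theta> v" "F2 a = 0" by (rule G.K_lift)
        have "F1 (a + \<iota>2 v) = u" "F2 (a + \<iota>2 v) = v"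
          using a G.F2_\<iota>2[of v] uv(4) by (simp_all add: star_homD[OF G.F(1)] star_homD[OF G.F(2)] \<theta>_def)
        then have "P = \<phi> (I.proj (a + \<iota>2 v))" by (simp add: \<phi> P(1) uv)
        then show "P \<in> \<phi> ` carrier I.Q" by (simp add: I.carrier_Q)
      qed
    qed (use in_glued in blast)
  qed
  moreover have "\<phi> (a \<odot>\<^bsub>I.Q\<^esub> X) = a \<odot>\<^bsub>glued_sphere q n \<beta>\<^esub> \<phi> X" "\<phi> (star I.Q X) = star (glued_sphere q n \<beta>) (\<phi> X)"
    if X: "X \<in> carrier I.Q" for X a
  proof -
    from X obtain t where t: "X = I.proj t" by (auto simp: I.carrier_Q)
    show "\<phi> (a \<odot>\<^bsub>I.Q\<^esub> X) = a \<odot>\<^bsub>glued_sphere q n \<beta>\<^esub> \<phi> X" "\<phi> (star I.Q X) = star (glued_sphere q n \<beta>) (\<phi> X)"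
      unfolding t I.proj_hom[symmetric] \<phi> by (simp_all add: gs c_def cs star_homD[OF G.F(1)] star_homD[OF G.F(2)])
  qed
  ultimately have iso: "\<phi> \<in> star_iso (odd_boundary q n) (glued_sphere q n \<beta>)"
    by (simp add: star_iso_def ring_iso_def bdO)
  have "\<phi> (t_gen q n i) = e_gen q n lam (i - 1)" if i: "i \<in> {1..n+1}" for i
  proof -
    have t: "t_gen q n i = I.proj (D.canon (gen i))"
      using I.proj_embed[OF x_gen(1)[OF i]] by (simp add: t_gen_def odd_ball_eq x_gen(2))
    show ?thesis
    proof (cases "i = 1")
      case True
      have "c root = cstar_sqrt E.U (even_defect q n)" by (simp add: c_def root_def E.UR.component_embed_self root(1))
      then have "\<phi> (I.proj x1) = e_gen q n lam 0"
        by (simp add: \<phi> G.F(8,9) e_gen_def even_ball_eq Let_def) (simp add: c_def cs)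
      then show ?thesis using t True by simp
    next
      case False
      with i have j: "i - 1 \<in> {1..n}" "i - 1 + 1 = i" by auto
      have cz: "c (zB (i - 1)) = z_gen q n (i - 1)"
        using E.UR.component_embed_self[OF z_gen(1)[OF j(1)]] by (simp add: c_def z_gen(2))
      have "F1 (D.canon (gen i)) = lam (i - 1) *\<^sub>C zB (i - 1)" "F2 (D.canon (gen i)) = zB (i - 1)"
        using G.F(10,11)[OF j(1)] by (simp_all add: j(2))
      then show ?thesis unfolding t \<phi> using False i cz by (simp add: e_gen_def even_ball_eq) (simp add: c_def cs)
    qed
  qed
  with iso show ?thesis by blast
qed

end
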